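(* Let $n\in\mathbb{Z}_{\ge0}$ and $(\nu,k)\in\mathcal{Y}_k$ with $\varphi_n(\nu,k)$ in the first alcove. Define $$\Delta_{k,\mathcal{O}_n}^{z,n}(\nu)=\mathcal{O}_n\text{-span}\{\tilde f_{\mathsf t,n}\mid\mathsf t\in\mathrm{Std}_k(\nu)\setminus\mathrm{Std}_k^n(\nu)\},$$ $$\Delta_{k,\mathcal{O}_{n+1}}^{z,n+1}(\nu)=\mathcal{O}_{n+1}\text{-span}\{\tilde f_{\mathsf t,n+1}\mid\mathsf t\in\mathrm{Std}_k(\nu)\setminus\mathrm{Std}_k^{n+1}(\nu)\},$$ and $\mathbb{F}$-vector spaces $\Delta_{k,\mathbb{F}}^{z,n}(\nu)=\Delta_{k,\mathcal{O}_n}^{z,n}(\nu)\otimes_{\mathcal{O}_n}\mathbb{F}$ and $\Delta_{k,\mathbb{F}}^{z,n+1}(\nu)=\Delta_{k,\mathcal{O}_{n+1}}^{z,n+1}(\nu)\otimes_{\mathcal{O}_{n+1}}\mathbb{F}$ (identified with the $\mathbb{F}$-spans of the same elements in $\Delta_{k,\mathbb{F}}^z(\nu)$). Then there are inclusions of $\mathbb{F}$-vector spaces $$\Delta_{k,\mathbb{F}}^{z,n+1}(\nu)\subseteq\Delta_{k,\mathbb{F}}^{z,n}(\nu)\subseteq\Delta_{k,\mathbb{F}}^{z}(\nu).$$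
   Context: Here $n$ below stands for any non-negative integer (the definitions are applied to both $n$ and $n+1$). Rings. $R=\mathbb{Z}[z]$, $\mathbb{F}=\mathbb{Q}(z)$, $\mathcal{O}_n$ is the localisation of $R$ at the prime ideal $(z-n)$, and $\pi_n:\mathcal{O}_n\to\mathbb{Q}$ is specialisation $z\mapsto n$. All modules are right modules. Partition algebras. For a commutative ring $S$, $\delta\in S$ and $r\ge 0$, $P_{2r}^S(\delta)$ is the free $S$-module on set-partitions of $\{1,\dots,r,\bar1,\dots,\bar r\}$, drawn as diagrams with northern vertices $\bar1,\dots,\bar r$ and southern vertices $1,\dots,r$. The product $xy$ is given by placing $x$ above $y$, identifying the southern vertices of $x$ with the northern vertices of $y$, and replacing each connected component consisting only of middle vertices by a factor $\delta$. $P_{2r-1}^S(\delta)\subset P_{2r}^S(\delta)$ is spanned by the set-partitions with $r,\bar r$ in the same block, and $P_{2r}^S(\delta)\subset P_{2r+1}^S(\delta)$ by adding the block $\{r+1,\overline{r+1}\}$; $P_0^S(\delta)=S$. The anti-involution $*$ flips diagrams. Branching graph. $\mathcal{Y}_k=\{(\lambda,k)\mid \lambda \text{ a partition of some } l\le\lfloor k/2\rfloor\}$. There is an edge $(\mu,k-1)\to(\lambda,k)$ iff $\lambda=\mu$, or $k$ is even and $\lambda$ is $\mu$ with one box added, or $k$ is odd and $\lambda$ is $\mu$ with one box removed. $\mathrm{Std}_k(\lambda)$ is the set of paths $\mathsf t=(\mathsf t(0),\dots,\mathsf t(k))$ from $(\varnothing,0)$ to $(\lambda,k)$; $\mathrm{Std}_k=\bigcup_\lambda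 \mathrm{Std}_k(\lambda)$; $\mathsf t{\downarrow}_{i}=(\mathsf t(0),\dots,\mathsf t(i))$; we identify $\mathsf t(i)$ with its partition. Order: $\lambda\rhd\mu$ if $|\lambda|<|\mu|$, or $|\lambda|=|\mu|$ and $\lambda$ strictly dominates $\mu$; $\unrhd$ means $\rhd$ or $=$. Cell modules and the basis $m_{\mathsf t}$. For each $k$ let $\{m_{\mathsf s\mathsf t}\mid \mathsf s,\mathsf t\in\mathrm{Std}_k(\lambda),(\lambda,k)\in\mathcal{Y}_k\}$ be the Murphy-type $R$-basis of $P_k^R(z)$ of Enyang and Goodman. Its relevant properties are: (C1) it is a cellular basis: $m_{\mathsf s\mathsf t}^*=m_{\mathsf t\mathsf s}$ and, for $a\in P_k^R(z)$, $m_{\mathsf s\mathsf t}a\equiv\sum_{\mathsf u\in \mathrm{Std}_k(\lambda)}r_{\mathsf t\mathsf u}(a)m_{\mathsf s\mathsf u}$ modulo the span of the $m_{\mathsf q\mathsf r}$ with $\mathsf q,\mathsf r\in\mathrm{Std}_k(\mu)$, $\mu\rhd\lambda$, with $r_{\mathsf t\mathsf u}(a)\in R$ independent of $\mathsf s$; the cell module $\Delta_{k,R}^z(\lambda)$ has $R$-basis $\{m_{\mathsf t}\mid\mathsf t\in\mathrm{Std}_k(\lambda)\}$ and action $m_{\mathsf t}a=\sum_{\mathsf u} r_{\mathsf t\mathsf u}(a)m_{\mathsf u}$. (C2) If $(\rho,k-1)\to(\lambda,k)$ is an edge, then $N^{\unrhd\rho}=\mathrm{span}_R\{m_{\mathsf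 t}\mid\mathsf t(k-1)\unrhd\rho\}$ and $N^{\rhd\rho}=\mathrm{span}_R\{m_{\mathsf t}\mid\mathsf t(k-1)\rhd\rho\}$ are $P_{k-1}^R(z)$-submodules of $\Delta_{k,R}^z(\lambda)$ and $m_{\mathsf t}+N^{\rhd\rho}\mapsto m_{\mathsf t{\downarrow}_{k-1}}$ (for $\mathsf t(k-1)=\rho$) is an isomorphism $N^{\unrhd\rho}/N^{\rhd\rho}\to\Delta_{k-1,R}^z(\rho)$. (C3) After base change to $K=\mathbb{F}$ the cell module is isomorphic to the standard module $S(\lambda)\otimes_{K\mathfrak{S}_l}W_k(l)$, $l=|\lambda|$. Here $S(\lambda)$ is the simple right $K\mathfrak S_l$-module labelled by $\lambda$ ($S((l))$ trivial). With $r=\lceil k/2\rceil$ and $l'=l$ ($k$ even) or $l'=l+1$ ($k$ odd), $W_k(l)$ has basis the set-partitions of $\{\bar1,\dots,\bar{l'},1,\dots,r\}$ with $\bar1,\dots,\bar{l'}$ in distinct blocks, each meeting $\{1,\dots,r\}$, and with $\overline{l+1}$ in the block of $r$ if $k$ is odd; $P_k$ acts by concatenation from below, the result being $0$ if not of this form; $\mathfrak S_l$ permutes $\bar1,\dots,\bar l$. Write $\Delta_{k,\mathbb{F}}^z(\lambda)$, $\Delta_{k,\mathcal{O}_n}^z(\lambda)$ for base changes of $\Delta^z_{k,R}(\lambda)$. Residues. Let $c((i,j))=j-i$ be the content of a box in row $i$, column $j$. For $\mathsf t\in\mathrm{Std}_k$ and $1\le i\le k$: if $i$ is even, $c_{\mathsf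 t}(i)=z-|\mathsf t(i)|$ if $\mathsf t(i)=\mathsf t(i-1)$ and $c_{\mathsf t}(i)=c(a)$ if $\mathsf t(i)=\mathsf t(i-1)\cup\{a\}$; if $i$ is odd, $c_{\mathsf t}(i)=|\mathsf t(i)|$ if $\mathsf t(i)=\mathsf t(i-1)$ and $c_{\mathsf t}(i)=z-c(a)$ if $\mathsf t(i)=\mathsf t(i-1)\setminus\{a\}$. Put $r_{n,\mathsf t}(i)=\pi_n(c_{\mathsf t}(i))$. Write $\mathsf s\approx_n\mathsf t$ if $r_{n,\mathsf s}(i)=r_{n,\mathsf t}(i)$ for all $i$, and $[\mathsf t]_n=\{\mathsf s\in\mathrm{Std}_k\mid\mathsf s\approx_n\mathsf t\}$. Idempotents. $P_k^{\mathbb{F}}(z)$ is split semisimple with simple modules $\Delta_{k,\mathbb{F}}^z(\lambda)$; let $F_{(\lambda,k)}$ be the primitive central idempotent acting as the identity on $\Delta_{k,\mathbb{F}}^z(\lambda)$. For $\mathsf t\in\mathrm{Std}_k$ put $F_{\mathsf t}=\prod_{i=0}^kF_{(\mathsf t(i),i)}\in P_k^{\mathbb{F}}(z)$ (equivalently, the joint eigenspace projector $\prod_{i}\prod_{c_{\mathsf u}(i)\neq c_{\mathsf t}(i)}\frac{L_i-c_{\mathsf u}(i)}{c_{\mathsf t}(i)-c_{\mathsf u}(i)}$ for the Jucys--Murphy elements $L_i$). Put $F_{[\mathsf t]_n}=\sum_{\mathsf s\in[\mathsf t]_n}F_{\mathsf s}$, which is known to lie in $P_k^{\mathcal{O}_n}(z)$,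 and $\tilde f_{\mathsf t,n}=m_{\mathsf t}F_{[\mathsf t]_n}\in\Delta_{k,\mathcal{O}_n}^z(\lambda)$ for $\mathsf t\in\mathrm{Std}_k(\lambda)$. Geometry. For a partition $\lambda$ put $\lambda_{[n]}=(n-|\lambda|,\lambda_1,\lambda_2,\dots)$ and $\rho=(0,-1,-2,\dots)$, vectors $(x_0,x_1,x_2,\dots)$ of integers. $\varphi_n(\lambda,k)=\lambda_{[n]}+\rho$ if $k$ is even and $\lambda_{[n-1]}+\rho$ if $k$ is odd. A vector $x$ is on the $j$-th wall ($j\ge1$) if $x_0=x_j$; in the first alcove if $x_0>x_1>x_2>\cdots$; in the $j$-th alcove ($j>1$) if $x_1>\dots>x_{j-1}>x_0>x_j>x_{j+1}>\cdots$. Permissible paths. $\mathrm{Std}_k^n(\lambda)$ is the set of $n$-permissible $\mathsf t\in\mathrm{Std}_k(\lambda)$: if $\varphi_n(\lambda,k)$ is on a wall, every $\mathsf t$ is $n$-permissible; if it is in the first alcove, $\mathsf t$ is $n$-permissible iff $\varphi_n(\mathsf t(i))$ is in the first alcove for all $0\le i\le k$; if it is in the $j$-th alcove with $j\ge2$, $\mathsf t$ is $n$-permissible iff for the largest $i$ with $\varphi_n(\mathsf t(i))$ not in the $j$-th alcove, $\varphi_n(\mathsf t(i))$ is on the $(j-1)$-th wall. *)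

theory Defs
  imports
    "HOL-Library.Disjoint_Sets"
    "HOL-Library.Function_Algebras"
    "HOL-Combinatorics.Permutations"
    "HOL-Computational_Algebra.Polynomial_Factorial"
begin

section \<open>Free modules\<close>

text \<open>
  The free module on a finite set \<open>X\<close> is the set of coefficient functions vanishing off \<open>X\<close>.
  Spans and linear independence are those of the library locale \<open>module\<close>, taken with respect
  to the pointwise scalar multiplication \<open>smul\<close>. The pointwise product of functions provided by
  \<open>Function_Algebras\<close> is never used as an algebra product.
\<close>

definition smul :: "'a::comm_ring_1 \<Rightarrow> ('x \<Rightarrow> 'a) \<Rightarrow> 'x \<Rightarrow> 'a" where
  "smul c f = (\<lambda>x. c * f x)"

lemma module_smul: "module smul"
  by unfold_locales (auto simp: smul_def fun_eq_iff algebra_simps)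

definition free_mod :: "'x set \<Rightarrow> ('x \<Rightarrow> 'a::comm_ring_1) set" where
  "free_mod X = {f. \<forall>x. x \<notin> X \<longrightarrow> f x = 0}"

definition unit_vec :: "'x \<Rightarrow> 'x \<Rightarrow> 'a::comm_ring_1" where
  "unit_vec x = (\<lambda>y. if y = x then 1 else 0)"

text \<open>
  \<open>\<theta>\<close> induces an isomorphism from the quotient \<open>N / N'\<close> onto \<open>M\<close> of right modules over the
  algebra with carrier \<open>A\<close>.
\<close>

definition induces_module_iso ::
  "'e set \<Rightarrow> (('x \<Rightarrow> 'a::comm_ring_1) \<Rightarrow> 'e \<Rightarrow> ('x \<Rightarrow> 'a)) \<Rightarrow> ('x \<Rightarrow> 'a) set \<Rightarrow> ('x \<Rightarrow> 'a) set
    \<Rightarrow> (('y \<Rightarrow> 'a) \<Rightarrow> 'e \<Rightarrow> ('y \<Rightarrow> 'a)) \<Rightarrow> ('y \<Rightarrow> 'a) set \<Rightarrow> (('x \<Rightarrow> 'a) \<Rightarrow> ('y \<Rightarrow> 'a)) \<Rightarrow> bool" where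
  "induces_module_iso A actN N N' actM M \<theta> \<longleftrightarrow>
     (\<forall>v\<in>N. \<forall>w\<in>N. \<theta> (v + w) = \<theta> v + \<theta> w) \<and>
     (\<forall>c. \<forall>v\<in>N. \<theta> (smul c v) = smul c (\<theta> v)) \<and>
     (\<forall>a\<in>A. \<forall>v\<in>N. \<theta> (actN v a) = actM (\<theta> v) a) \<and>
     {v \<in> N. \<theta> v = 0} = N' \<and>
     \<theta> ` N = M"


section \<open>The ground rings\<close>

text \<open>\<open>\<int>[z]\<close> is \<open>int poly\<close> and \<open>\<rat>(z)\<close> is its field of fractions \<open>int poly fract\<close>.\<close>

definition z :: "int poly" where
  "z = [:0, 1:]"

definition loc_ring :: "nat \<Rightarrow> int poly fract set" where
  "loc_ring n = {x. \<exists>a b. \<not> (z - of_nat n) dvd b \<and> x = Fract a b}"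

text \<open>Meaningful on \<open>loc_ring n\<close> only, where the value does not depend on the representing fraction.\<close>

definition specialise :: "nat \<Rightarrow> int poly fract \<Rightarrow> rat" where
  "specialise n x =
     (THE q. \<exists>a b. \<not> (z - of_nat n) dvd b \<and> x = Fract a b \<and>
        q = of_int (poly a (int n)) / of_int (poly b (int n)))"

definition loc_span :: "nat \<Rightarrow> ('x \<Rightarrow> int poly fract) set \<Rightarrow> ('x \<Rightarrow> int poly fract) set" where
  "loc_span n B =
     {\<Sum>b\<in>T. smul (c b) b | T c. finite T \<and> T \<subseteq> B \<and> (\<forall>b\<in>T. c b \<in> loc_ring n)}"


section \<open>Partition algebras\<close>

text \<open>\<open>North j\<close> is the vertex written with a bar over \<open>j\<close> and \<open>South j\<close> is the vertex \<open>j\<close>.\<close>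

datatype vertex = North nat | South nat

type_synonym diagram = "vertex set set"

text \<open>The algebra \<open>P_k\<close> lives on \<open>half k\<close> strands, the ceiling of \<open>k/2\<close>.\<close>

definition half :: "nat \<Rightarrow> nat" where
  "half k = (k + 1) div 2"

definition diagrams :: "nat \<Rightarrow> diagram set" where
  "diagrams k =
     {d. partition_on (North ` {1..half k} \<union> South ` {1..half k}) d \<and>
         (odd k \<longrightarrow> (\<exists>B\<in>d. North (half k) \<in> B \<and> South (half k) \<in> B))}"

datatype vertex3 = Top nat | Mid nat | Bot nat

fun upper :: "vertex \<Rightarrow> vertex3" where
  "upper (North j) = Top j"
| "upper (South j) = Mid j"

fun lower :: "vertex \<Rightarrow> vertex3" where
  "lower (North j) = Mid j"
| "lower (South j) = Bot j"

fun outer :: "vertex \<Rightarrow> vertex3" where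
  "outer (North j) = Top j"
| "outer (South j) = Bot j"

text \<open>The connected components of the graph obtained by placing \<open>d\<close> above \<open>d'\<close>.\<close>

definition components :: "diagram \<Rightarrow> diagram \<Rightarrow> vertex3 set set" where
  "components d d' =
     (let A = (\<lambda>B. upper ` B) ` d \<union> (\<lambda>B. lower ` B) ` d'
      in (\<Union>A) // {(u, v). \<exists>B\<in>A. u \<in> B \<and> v \<in> B}\<^sup>+)"

definition compose :: "diagram \<Rightarrow> diagram \<Rightarrow> diagram" where
  "compose d d' = {outer -` C | C. C \<in> components d d' \<and> outer -` C \<noteq> {}}"

definition loops :: "diagram \<Rightarrow> diagram \<Rightarrow> nat" where
  "loops d d' = card {C \<in> components d d'. C \<subseteq> range Mid}"

abbreviation PA :: "nat \<Rightarrow> (diagram \<Rightarrow> 'a::comm_ring_1) set" where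
  "PA k \<equiv> free_mod (diagrams k)"

definition pa_mult ::
  "'a::comm_ring_1 \<Rightarrow> nat \<Rightarrow> (diagram \<Rightarrow> 'a) \<Rightarrow> (diagram \<Rightarrow> 'a) \<Rightarrow> diagram \<Rightarrow> 'a" where
  "pa_mult \<delta> k x y = (\<lambda>e. \<Sum>d\<in>diagrams k. \<Sum>d'\<in>diagrams k.
     x d * y d' * (if compose d d' = e then \<delta> ^ loops d d' else 0))"

fun flip_vertex :: "vertex \<Rightarrow> vertex" where
  "flip_vertex (North j) = South j"
| "flip_vertex (South j) = North j"

definition pa_star :: "(diagram \<Rightarrow> 'a) \<Rightarrow> diagram \<Rightarrow> 'a" where
  "pa_star x = (\<lambda>d. x ((\<lambda>B. flip_vertex ` B) ` d))"

text \<open>The inclusion of \<open>P_i\<close> in \<open>P_k\<close> for \<open>i \<le> k\<close> adds vertical strands on the right.\<close>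

definition diag_incl :: "nat \<Rightarrow> nat \<Rightarrow> diagram \<Rightarrow> diagram" where
  "diag_incl i k d = d \<union> {{North j, South j} | j. half i < j \<and> j \<le> half k}"

definition pa_incl :: "nat \<Rightarrow> nat \<Rightarrow> (diagram \<Rightarrow> 'a::comm_ring_1) \<Rightarrow> diagram \<Rightarrow> 'a" where
  "pa_incl i k x = (\<lambda>e. \<Sum>d\<in>diagrams i. if diag_incl i k d = e then x d else 0)"

definition pa_one :: "nat \<Rightarrow> diagram \<Rightarrow> 'a::comm_ring_1" where
  "pa_one k = unit_vec {{North j, South j} | j. 1 \<le> j \<and> j \<le> half k}"


section \<open>Partitions and the branching graph\<close>

text \<open>
  A partition is the weakly decreasing list of its nonzero parts; its size is \<open>sum_list\<close>.
  \<open>part \<alpha> i\<close> is the \<open>i\<close>-th part, counted from 1, and 0 beyond the length.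
\<close>

type_synonym partn = "nat list"

definition is_partn :: "partn \<Rightarrow> bool" where
  "is_partn \<alpha> \<longleftrightarrow> sorted_wrt (\<ge>) \<alpha> \<and> 0 \<notin> set \<alpha>"

definition part :: "partn \<Rightarrow> nat \<Rightarrow> nat" where
  "part \<alpha> i = (if 1 \<le> i \<and> i \<le> length \<alpha> then \<alpha> ! (i - 1) else 0)"

definition boxes :: "partn \<Rightarrow> (nat \<times> nat) set" where
  "boxes \<alpha> = {(i, j). 1 \<le> i \<and> 1 \<le> j \<and> j \<le> part \<alpha> i}"

fun content :: "nat \<times> nat \<Rightarrow> int" where
  "content (i, j) = int j - int i"

definition add_box :: "partn \<Rightarrow> partn \<Rightarrow> bool" where
  "add_box \<mu> \<alpha> \<longleftrightarrow> (\<exists>b. b \<notin> boxes \<mu> \<and> boxes \<alpha> = insert b (boxes \<mu>))"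

definition dominates :: "partn \<Rightarrow> partn \<Rightarrow> bool" where
  "dominates \<alpha> \<mu> \<longleftrightarrow> (\<forall>i. (\<Sum>j=1..i. part \<mu> j) \<le> (\<Sum>j=1..i. part \<alpha> j))"

definition order_gt :: "partn \<Rightarrow> partn \<Rightarrow> bool"  (infix \<open>\<rhd>\<close> 50) where
  "\<alpha> \<rhd> \<mu> \<longleftrightarrow>
     sum_list \<alpha> < sum_list \<mu> \<or> (sum_list \<alpha> = sum_list \<mu> \<and> dominates \<alpha> \<mu> \<and> \<alpha> \<noteq> \<mu>)"

definition order_ge :: "partn \<Rightarrow> partn \<Rightarrow> bool"  (infix \<open>\<unrhd>\<close> 50) where
  "\<alpha> \<unrhd> \<mu> \<longleftrightarrow> \<alpha> \<rhd> \<mu> \<or> \<alpha> = \<mu>"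

text \<open>\<open>\<alpha> \<in> Y k\<close> stands for the vertex \<open>(\<alpha>, k)\<close> on level \<open>k\<close>.\<close>

definition Y :: "nat \<Rightarrow> partn set" where
  "Y k = {\<alpha>. is_partn \<alpha> \<and> sum_list \<alpha> \<le> k div 2}"

text \<open>\<open>edge k \<mu> \<alpha>\<close> stands for an edge from \<open>(\<mu>, k)\<close> to \<open>(\<alpha>, k + 1)\<close>.\<close>

definition edge :: "nat \<Rightarrow> partn \<Rightarrow> partn \<Rightarrow> bool" where
  "edge k \<mu> \<alpha> \<longleftrightarrow> \<mu> \<in> Y k \<and> \<alpha> \<in> Y (Suc k) \<and>
     (\<alpha> = \<mu> \<or> (even (Suc k) \<and> add_box \<mu> \<alpha>) \<or> (odd (Suc k) \<and> add_box \<alpha> \<mu>))"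

type_synonym path = "partn list"

definition Std :: "nat \<Rightarrow> partn \<Rightarrow> path set" where
  "Std k \<alpha> = {t. length t = Suc k \<and> t ! 0 = [] \<and> t ! k = \<alpha> \<and> (\<forall>i<k. edge i (t ! i) (t ! Suc i))}"

definition Std_all :: "nat \<Rightarrow> path set" where
  "Std_all k = (\<Union>\<alpha>\<in>Y k. Std k \<alpha>)"


section \<open>Residues\<close>

definition residue :: "path \<Rightarrow> nat \<Rightarrow> int poly" where
  "residue t i =
     (if even i then
        (if t ! i = t ! (i - 1) then z - of_nat (sum_list (t ! i))
         else of_int (content (the_elem (boxes (t ! i) - boxes (t ! (i - 1))))))
      else
        (if t ! i = t ! (i - 1) then of_nat (sum_list (t ! i))
         else z - of_int (content (the_elem (boxes (t ! (i - 1)) - boxes (t ! i))))))"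

definition spec_residue :: "nat \<Rightarrow> path \<Rightarrow> nat \<Rightarrow> rat" where
  "spec_residue n t i = specialise n (to_fract (residue t i))"

definition residue_class :: "nat \<Rightarrow> nat \<Rightarrow> path \<Rightarrow> path set" where
  "residue_class n k t =
     {s \<in> Std_all k. \<forall>i\<in>{1..k}. spec_residue n s i = spec_residue n t i}"


section \<open>Cell modules\<close>

text \<open>
  The cell module with label \<open>\<alpha>\<close> over \<open>S\<close> is \<open>free_mod (Std k \<alpha>)\<close> with coefficients in \<open>S\<close>; its
  basis element \<open>m_t\<close> is \<open>unit_vec t\<close>. The action of \<open>P_k\<close> is given by structure constants:
  \<open>r t u a\<close> is the coefficient of \<open>m_u\<close> in \<open>m_t a\<close>, for \<open>a\<close> in the algebra over \<open>\<int>[z]\<close>.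
\<close>

type_synonym structure_constants = "path \<Rightarrow> path \<Rightarrow> (diagram \<Rightarrow> int poly) \<Rightarrow> int poly"

definition cell_actR ::
  "structure_constants \<Rightarrow> nat \<Rightarrow> partn \<Rightarrow> (path \<Rightarrow> int poly) \<Rightarrow> (diagram \<Rightarrow> int poly)
    \<Rightarrow> path \<Rightarrow> int poly" where
  "cell_actR r k \<alpha> v a = (\<lambda>u. if u \<in> Std k \<alpha> then \<Sum>t\<in>Std k \<alpha>. v t * r t u a else 0)"

text \<open>Base change to \<open>\<rat>(z)\<close>: the structure constants are extended linearly in the algebra element.\<close>

definition cell_actF ::
  "structure_constants \<Rightarrow> nat \<Rightarrow> partn \<Rightarrow> (path \<Rightarrow> int poly fract) \<Rightarrow> (diagram \<Rightarrow> int poly fract)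
    \<Rightarrow> path \<Rightarrow> int poly fract" where
  "cell_actF r k \<alpha> v a =
     (\<lambda>u. if u \<in> Std k \<alpha>
          then \<Sum>t\<in>Std k \<alpha>. v t * (\<Sum>d\<in>diagrams k. a d * to_fract (r t u (unit_vec d)))
          else 0)"

abbreviation DeltaF :: "nat \<Rightarrow> partn \<Rightarrow> (path \<Rightarrow> int poly fract) set" where
  "DeltaF k \<alpha> \<equiv> free_mod (Std k \<alpha>)"


section \<open>Standard modules\<close>

text \<open>
  The group algebra of the symmetric group on \<open>{1..l}\<close> is \<open>free_mod {\<sigma>. \<sigma> permutes {1..l}}\<close>, the
  product of permutations being composition of maps. The simple right module labelled by \<open>\<alpha>\<close> is
  the right ideal generated by the Young symmetriser of the row-reading tableau
  (the trivial module if \<open>\<alpha>\<close> has one row, the sign module if it has one column).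
\<close>

type_synonym perm = "nat \<Rightarrow> nat"

definition row_reading :: "partn \<Rightarrow> nat \<times> nat \<Rightarrow> nat" where
  "row_reading \<alpha> b = (\<Sum>i=1..<fst b. part \<alpha> i) + snd b"

definition row_group :: "partn \<Rightarrow> perm set" where
  "row_group \<alpha> = {\<sigma>. \<sigma> permutes {1..sum_list \<alpha>} \<and>
     (\<forall>b\<in>boxes \<alpha>. \<exists>b'\<in>boxes \<alpha>. fst b' = fst b \<and> \<sigma> (row_reading \<alpha> b) = row_reading \<alpha> b')}"

definition column_group :: "partn \<Rightarrow> perm set" where
  "column_group \<alpha> = {\<sigma>. \<sigma> permutes {1..sum_list \<alpha>} \<and>
     (\<forall>b\<in>boxes \<alpha>. \<exists>b'\<in>boxes \<alpha>. snd b' = snd b \<and> \<sigma> (row_reading \<alpha> b) = row_reading \<alpha> b')}"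

definition young_symmetriser :: "partn \<Rightarrow> perm \<Rightarrow> int poly fract" where
  "young_symmetriser \<alpha> = (\<lambda>\<pi>. \<Sum>\<sigma>\<in>row_group \<alpha>. \<Sum>\<tau>\<in>column_group \<alpha>.
     if \<sigma> \<circ> \<tau> = \<pi> then of_int (sign \<tau>) else 0)"

definition perm_act :: "(perm \<Rightarrow> 'a) \<Rightarrow> perm \<Rightarrow> perm \<Rightarrow> 'a" where
  "perm_act x \<sigma> = (\<lambda>\<tau>. x (\<tau> \<circ> inv \<sigma>))"

definition specht :: "partn \<Rightarrow> (perm \<Rightarrow> int poly fract) set" where
  "specht \<alpha> =
     module.span smul {perm_act (young_symmetriser \<alpha>) \<sigma> | \<sigma>. \<sigma> permutes {1..sum_list \<alpha>}}"

text \<open>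
  The basis of \<open>W_k(l)\<close>. Here \<open>l\<close>, respectively \<open>l + 1\<close>, northern vertices sit above \<open>half k\<close>
  southern ones.
\<close>

definition W_north :: "nat \<Rightarrow> nat \<Rightarrow> nat" where
  "W_north k l = (if even k then l else l + 1)"

definition W_basis :: "nat \<Rightarrow> nat \<Rightarrow> diagram set" where
  "W_basis k l =
     {w. partition_on (North ` {1..W_north k l} \<union> South ` {1..half k}) w \<and>
         (\<forall>B\<in>w. \<forall>i j. North i \<in> B \<and> North j \<in> B \<longrightarrow> i = j) \<and>
         (\<forall>B\<in>w. \<forall>i. North i \<in> B \<longrightarrow> (\<exists>j. South j \<in> B)) \<and>
         (odd k \<longrightarrow> (\<exists>B\<in>w. North (l + 1) \<in> B \<and> South (half k) \<in> B))}"

fun permute_vertex :: "perm \<Rightarrow> vertex \<Rightarrow> vertex" where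
  "permute_vertex \<sigma> (North j) = North (\<sigma> j)"
| "permute_vertex \<sigma> (South j) = South j"

definition W_perm :: "perm \<Rightarrow> diagram \<Rightarrow> diagram" where
  "W_perm \<sigma> w = (\<lambda>B. permute_vertex \<sigma> ` B) ` w"

text \<open>
  The tensor product over the field of the right ideal \<open>specht \<alpha>\<close> with the free module \<open>W_k(l)\<close>
  consists of functions \<open>f\<close> of pairs \<open>(w, \<sigma>)\<close> whose component at each basis element \<open>w\<close> lies in
  \<open>specht \<alpha>\<close>. The tensor product over the group algebra is its quotient by \<open>tensor_rel k \<alpha>\<close>.
\<close>

definition tensor_space :: "nat \<Rightarrow> partn \<Rightarrow> (diagram \<times> perm \<Rightarrow> int poly fract) set" where
  "tensor_space k \<alpha> =
     {f. (\<forall>w. (\<lambda>\<sigma>. f (w, \<sigma>)) \<in> specht \<alpha>) \<and>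
         (\<forall>w \<sigma>. w \<notin> W_basis k (sum_list \<alpha>) \<longrightarrow> f (w, \<sigma>) = 0)}"

definition pure_tensor ::
  "(perm \<Rightarrow> int poly fract) \<Rightarrow> diagram \<Rightarrow> diagram \<times> perm \<Rightarrow> int poly fract" where
  "pure_tensor x w = (\<lambda>(w', \<sigma>). if w' = w then x \<sigma> else 0)"

definition tensor_rel :: "nat \<Rightarrow> partn \<Rightarrow> (diagram \<times> perm \<Rightarrow> int poly fract) set" where
  "tensor_rel k \<alpha> =
     module.span smul
       {pure_tensor (perm_act x \<sigma>) w - pure_tensor x (W_perm \<sigma> w) | x \<sigma> w.
          x \<in> specht \<alpha> \<and> \<sigma> permutes {1..sum_list \<alpha>} \<and> w \<in> W_basis k (sum_list \<alpha>)}"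

definition tensor_act ::
  "nat \<Rightarrow> partn \<Rightarrow> (diagram \<times> perm \<Rightarrow> int poly fract) \<Rightarrow> (diagram \<Rightarrow> int poly fract)
    \<Rightarrow> diagram \<times> perm \<Rightarrow> int poly fract" where
  "tensor_act k \<alpha> f a =
     (\<lambda>(w', \<sigma>). if w' \<in> W_basis k (sum_list \<alpha>)
        then \<Sum>w\<in>W_basis k (sum_list \<alpha>). \<Sum>d\<in>diagrams k.
               f (w, \<sigma>) * a d * (if compose w d = w' then to_fract z ^ loops w d else 0)
        else 0)"


section \<open>Murphy-type bases\<close>

definition cell_index :: "nat \<Rightarrow> (path \<times> path) set" where
  "cell_index k = {(s, t). \<exists>\<alpha>\<in>Y k. s \<in> Std k \<alpha> \<and> t \<in> Std k \<alpha>}"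

text \<open>
  A cellular basis of \<open>P_k\<close> over \<open>\<int>[z]\<close>, together with its structure constants. The level \<open>k\<close> is
  determined by the length of the paths, so that \<open>m\<close> and \<open>r\<close> carry no argument for it.
\<close>

definition cellular_basis ::
  "(path \<Rightarrow> path \<Rightarrow> diagram \<Rightarrow> int poly) \<Rightarrow> structure_constants \<Rightarrow> nat \<Rightarrow> bool" where
  "cellular_basis m r k \<longleftrightarrow>
     inj_on (\<lambda>(s, t). m s t) (cell_index k) \<and>
     \<not> module.dependent smul ((\<lambda>(s, t). m s t) ` cell_index k) \<and>
     module.span smul ((\<lambda>(s, t). m s t) ` cell_index k) = PA k \<and>
     (\<forall>(s, t)\<in>cell_index k. pa_star (m s t) = m t s) \<and>
     (\<forall>\<alpha>\<in>Y k. \<forall>s\<in>Std k \<alpha>. \<forall>t\<in>Std k \<alpha>. \<forall>a\<in>PA k.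
        pa_mult z k (m s t) a - (\<Sum>u\<in>Std k \<alpha>. smul (r t u a) (m s u))
          \<in> module.span smul
              {m p q | p q \<mu>. \<mu> \<in> Y k \<and> \<mu> \<rhd> \<alpha> \<and> p \<in> Std k \<mu> \<and> q \<in> Std k \<mu>})"

definition cell_filtration_ge :: "nat \<Rightarrow> partn \<Rightarrow> partn \<Rightarrow> (path \<Rightarrow> int poly) set" where
  "cell_filtration_ge k \<alpha> \<rho> =
     module.span smul {unit_vec t | t. t \<in> Std (Suc k) \<alpha> \<and> t ! k \<unrhd> \<rho>}"

definition cell_filtration_gt :: "nat \<Rightarrow> partn \<Rightarrow> partn \<Rightarrow> (path \<Rightarrow> int poly) set" where
  "cell_filtration_gt k \<alpha> \<rho> =
     module.span smul {unit_vec t | t. t \<in> Std (Suc k) \<alpha> \<and> t ! k \<rhd> \<rho>}"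

text \<open>
  For each edge \<open>(\<rho>, k) \<rightarrow> (\<alpha>, k + 1)\<close>, both members of the filtration are \<open>P_k\<close>-submodules, and
  \<open>m_t \<mapsto> m_s\<close> with \<open>s\<close> the truncation \<open>take (Suc k) t\<close> (the path up to level \<open>k\<close>) induces an
  isomorphism of their quotient with the cell module on level \<open>k\<close>.
\<close>

definition restriction_compatible :: "structure_constants \<Rightarrow> nat \<Rightarrow> bool" where
  "restriction_compatible r k \<longleftrightarrow>
     (\<forall>\<rho> \<alpha>. edge k \<rho> \<alpha> \<longrightarrow>
        (\<forall>N\<in>{cell_filtration_ge k \<alpha> \<rho>, cell_filtration_gt k \<alpha> \<rho>}. \<forall>v\<in>N. \<forall>a\<in>PA k.
           cell_actR r (Suc k) \<alpha> v (pa_incl k (Suc k) a) \<in> N) \<and>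
        (\<exists>\<theta>. induces_module_iso (PA k)
               (\<lambda>v a. cell_actR r (Suc k) \<alpha> v (pa_incl k (Suc k) a))
               (cell_filtration_ge k \<alpha> \<rho>) (cell_filtration_gt k \<alpha> \<rho>)
               (cell_actR r k \<rho>) (free_mod (Std k \<rho>)) \<theta> \<and>
             (\<forall>t\<in>Std (Suc k) \<alpha>. t ! k = \<rho> \<longrightarrow> \<theta> (unit_vec t) = unit_vec (take (Suc k) t))))"

definition cells_standard :: "structure_constants \<Rightarrow> nat \<Rightarrow> bool" where
  "cells_standard r k \<longleftrightarrow>
     (\<forall>\<alpha>\<in>Y k. \<exists>\<theta>. induces_module_iso (PA k) (tensor_act k \<alpha>) (tensor_space k \<alpha>) (tensor_rel k \<alpha>)
        (cell_actF r k \<alpha>) (DeltaF k \<alpha>) \<theta>)"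

text \<open>
  The Enyang--Goodman basis enters through its characteristic properties: a cellular basis on every
  level, compatible with restriction along the branching graph, and with the standard labelling of
  the cell modules over \<open>\<rat>(z)\<close>.
\<close>

definition murphy_basis ::
  "(path \<Rightarrow> path \<Rightarrow> diagram \<Rightarrow> int poly) \<Rightarrow> structure_constants \<Rightarrow> bool" where
  "murphy_basis m r \<longleftrightarrow>
     (\<forall>k. cellular_basis m r k \<and> restriction_compatible r k \<and> cells_standard r k)"


section \<open>Idempotents\<close>

abbreviation multF ::
  "nat \<Rightarrow> (diagram \<Rightarrow> int poly fract) \<Rightarrow> (diagram \<Rightarrow> int poly fract) \<Rightarrow> diagram \<Rightarrow> int poly fract" where
  "multF \<equiv> pa_mult (to_fract z)"

definition central_idempotent :: "nat \<Rightarrow> (diagram \<Rightarrow> int poly fract) \<Rightarrow> bool" where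
  "central_idempotent k e \<longleftrightarrow>
     e \<in> PA k \<and> multF k e e = e \<and> (\<forall>x\<in>PA k. multF k e x = multF k x e)"

definition primitive_central_idempotent :: "nat \<Rightarrow> (diagram \<Rightarrow> int poly fract) \<Rightarrow> bool" where
  "primitive_central_idempotent k e \<longleftrightarrow>
     central_idempotent k e \<and> e \<noteq> 0 \<and>
     (\<forall>f. central_idempotent k f \<and> multF k e f = f \<longrightarrow> f = 0 \<or> f = e)"

definition F_cell :: "structure_constants \<Rightarrow> nat \<Rightarrow> partn \<Rightarrow> diagram \<Rightarrow> int poly fract" where
  "F_cell r k \<alpha> =
     (THE e. primitive_central_idempotent k e \<and> (\<forall>v\<in>DeltaF k \<alpha>. cell_actF r k \<alpha> v e = v))"

definition F_path :: "structure_constants \<Rightarrow> nat \<Rightarrow> path \<Rightarrow> diagram \<Rightarrow> int poly fract" where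
  "F_path r k t = foldl (\<lambda>x i. multF k x (pa_incl i k (F_cell r i (t ! i)))) (pa_one k) [0..<Suc k]"

definition F_class :: "structure_constants \<Rightarrow> nat \<Rightarrow> nat \<Rightarrow> path \<Rightarrow> diagram \<Rightarrow> int poly fract" where
  "F_class r n k t = (\<Sum>s\<in>residue_class n k t. F_path r k s)"

definition f_tilde ::
  "structure_constants \<Rightarrow> nat \<Rightarrow> nat \<Rightarrow> partn \<Rightarrow> path \<Rightarrow> path \<Rightarrow> int poly fract" where
  "f_tilde r n k \<alpha> t = cell_actF r k \<alpha> (unit_vec t) (F_class r n k t)"


section \<open>Geometry and permissible paths\<close>

text \<open>
  \<open>phi n \<alpha> k i\<close> is the coordinate \<open>x_i\<close> of the vector attached to \<open>(\<alpha>, k)\<close>. Integers are used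
  throughout, since \<open>n - 1 - |\<alpha>|\<close> may be negative.
\<close>

definition bracket :: "int \<Rightarrow> partn \<Rightarrow> nat \<Rightarrow> int" where
  "bracket n \<alpha> i = (if i = 0 then n - int (sum_list \<alpha>) else int (part \<alpha> i))"

definition phi :: "nat \<Rightarrow> partn \<Rightarrow> nat \<Rightarrow> nat \<Rightarrow> int" where
  "phi n \<alpha> k i = bracket (if even k then int n else int n - 1) \<alpha> i - int i"

definition on_wall :: "nat \<Rightarrow> (nat \<Rightarrow> int) \<Rightarrow> bool" where
  "on_wall j x \<longleftrightarrow> 1 \<le> j \<and> x 0 = x j"

definition in_alcove :: "nat \<Rightarrow> (nat \<Rightarrow> int) \<Rightarrow> bool" where
  "in_alcove j x \<longleftrightarrow>
     (if j = 1 then \<forall>i. x i > x (Suc i)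
      else 1 < j \<and> (\<forall>i. 1 \<le> i \<and> Suc i < j \<longrightarrow> x i > x (Suc i)) \<and>
           x (j - 1) > x 0 \<and> x 0 > x j \<and> (\<forall>i\<ge>j. x i > x (Suc i)))"

definition permissible :: "nat \<Rightarrow> nat \<Rightarrow> partn \<Rightarrow> path \<Rightarrow> bool" where
  "permissible n k \<alpha> t \<longleftrightarrow>
     (\<exists>j. on_wall j (phi n \<alpha> k)) \<or>
     (in_alcove 1 (phi n \<alpha> k) \<and> (\<forall>i\<le>k. in_alcove 1 (phi n (t ! i) i))) \<or>
     (\<exists>j\<ge>2. in_alcove j (phi n \<alpha> k) \<and>
        (let i = (GREATEST i. i \<le> k \<and> \<not> in_alcove j (phi n (t ! i) i))
         in on_wall (j - 1) (phi n (t ! i) i)))"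

definition Std_perm :: "nat \<Rightarrow> nat \<Rightarrow> partn \<Rightarrow> path set" where
  "Std_perm n k \<alpha> = {t \<in> Std k \<alpha>. permissible n k \<alpha> t}"


section \<open>The spans of the non-permissible elements\<close>

definition Delta_loc :: "structure_constants \<Rightarrow> nat \<Rightarrow> nat \<Rightarrow> partn \<Rightarrow> (path \<Rightarrow> int poly fract) set" where
  "Delta_loc r n k \<alpha> = loc_span n {f_tilde r n k \<alpha> t | t. t \<in> Std k \<alpha> - Std_perm n k \<alpha>}"

text \<open>
  The extension of scalars of \<open>Delta_loc\<close> to \<open>\<rat>(z)\<close>, realised inside the cell module over \<open>\<rat>(z)\<close>.
\<close>

definition Delta_sub :: "structure_constants \<Rightarrow> nat \<Rightarrow> nat \<Rightarrow> partn \<Rightarrow> (path \<Rightarrow> int poly fract) set" where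
  "Delta_sub r n k \<alpha> = module.span smul (Delta_loc r n k \<alpha>)"

end

theory Submission
  imports Defs
begin

text \<open>
  A diagram acts on the labellings of its outer vertices by \<open>N\<close> labels, and \<open>x\<^sup>*\<close> acts by the transpose
  matrix when \<open>z = N\<close>. Hence \<open>x\<^sup>* x = 0\<close> forces \<open>x = 0\<close>, also over \<open>\<rat>(z)\<close>. A cellular algebra with such an
  anisotropic involution is split semisimple: each cell ideal has an identity element, and differences
  of these are the primitive central idempotents \<open>F_cell\<close>.

  By the restriction filtration, \<open>m_t F_s\<close> is a multiple of \<open>f_s = m_s F_s\<close> and vanishes unless \<open>s = t\<close>
  or \<open>s\<close> is larger than \<open>t\<close> in a lexicographic order. So the vectors \<open>m_t F_[t]\<close>, with \<open>t\<close> in a union of residue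
  classes, span the same space over \<open>\<rat>(z)\<close> as the \<open>f_t\<close>.

  A step of a path changes one coordinate of \<open>\<phi>\<^sub>n\<close>, and its residue is an injective function of that
  coordinate. As the coordinates are distinct in the first alcove, an \<open>n\<close>-permissible path is alone in
  its residue class, and the other paths form a union of classes. The claim thus reduces to the fact that
  \<open>n\<close>-permissible paths to \<open>\<nu>\<close> are \<open>(n + 1)\<close>-permissible.
\<close>

section \<open>Diagrams as constraints on labellings\<close>

text \<open>\<open>F_cell\<close> is a definite description, so existence and uniqueness of the cell
  idempotents have to be derived from the cellular basis. Positivity is what delivers them: if
  \<open>S\<close> is an integer matrix and the product of its transpose with \<open>S\<close> is
  zero, then the diagonal entries are vanishing sums of squares, so \<open>S\<close> is zero. This
  holds at every large integer \<open>N\<close>, and a polynomial coefficient with infinitely many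
  zeros is zero.

  The same matrices carry the combinatorics of diagrams. Associativity and the compatibility of
  composition with flips and inclusions, including the count of loops, are checked as identities of
  matrices and transferred back by faithfulness, instead of tracing components through stacked
  graphs.

  The vectors \<open>f_tilde\<close> depend on \<open>n\<close> through the residue classes, so the
  spans for \<open>n\<close> and \<open>n + 1\<close> are not given by comparable vectors. The
  vectors \<open>f_t\<close> do not involve \<open>n\<close>; once both spans are written in terms
  of them, only the index sets remain to be compared.\<close>

definition block_const :: "diagram \<Rightarrow> (vertex \<Rightarrow> 'c) \<Rightarrow> bool" where
  "block_const d F \<longleftrightarrow> (\<forall>B\<in>d. \<forall>u\<in>B. \<forall>v\<in>B. F u = F v)"

text \<open>With \<open>f\<close> on the northern and \<open>g\<close> on the southern vertices, the
  truth value of \<open>block_const d (glue f g)\<close> is the \<open>(f, g)\<close> entry of the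
  matrix by which \<open>d\<close> acts on a tensor power of an \<open>N\<close>-dimensional space,
  at parameter \<open>N\<close>.\<close>

fun glue :: "(nat \<Rightarrow> 'c) \<Rightarrow> (nat \<Rightarrow> 'c) \<Rightarrow> vertex \<Rightarrow> 'c" where
  "glue f g (North j) = f j"
| "glue f g (South j) = g j"

fun glue3 :: "(nat \<Rightarrow> 'c) \<Rightarrow> (nat \<Rightarrow> 'c) \<Rightarrow> (nat \<Rightarrow> 'c) \<Rightarrow> vertex3 \<Rightarrow> 'c" where
  "glue3 f g h (Top j) = f j"
| "glue3 f g h (Mid j) = g j"
| "glue3 f g h (Bot j) = h j"

definition verts :: "nat \<Rightarrow> vertex set" where
  "verts r = North ` {1..r} \<union> South ` {1..r}"

definition verts3 :: "nat \<Rightarrow> vertex3 set" where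
  "verts3 r = Top ` {1..r} \<union> Mid ` {1..r} \<union> Bot ` {1..r}"

definition stack :: "diagram \<Rightarrow> diagram \<Rightarrow> vertex3 set set" where
  "stack d d' = (\<lambda>B. upper ` B) ` d \<union> (\<lambda>B. lower ` B) ` d'"

lemma finite_verts: "finite (verts r)"
  by (simp add: verts_def)

lemma glue3_upper: "glue3 f g h (upper u) = glue f g u"
  by (cases u) auto

lemma glue3_lower: "glue3 f g h (lower u) = glue g h u"
  by (cases u) auto

lemma glue3_outer: "glue3 f g h (outer u) = glue f h u"
  by (cases u) auto

lemma Union_stack:
  assumes "partition_on (verts r) d" "partition_on (verts r) d'"
  shows "\<Union>(stack d d') = verts3 r"
proof -
  have "\<Union>(stack d d') = upper ` \<Union>d \<union> lower ` \<Union>d'"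
    by (auto simp: stack_def)
  also have "\<dots> = upper ` verts r \<union> lower ` verts r"
    using assms by (simp add: partition_on_def)
  also have "\<dots> = verts3 r"
    by (auto simp: verts_def verts3_def image_Un image_image)
  finally show ?thesis .
qed

lemma components_eq:
  assumes "partition_on (verts r) d" "partition_on (verts r) d'"
  shows "components d d' = verts3 r // {(u, v). \<exists>B\<in>stack d d'. u \<in> B \<and> v \<in> B}\<^sup>+"
  unfolding Union_stack[OF assms, symmetric] by (simp add: components_def stack_def Let_def)

lemma equiv_stack:
  assumes "partition_on (verts r) d" "partition_on (verts r) d'"
  shows "equiv (verts3 r) ({(u, v). \<exists>B\<in>stack d d'. u \<in> B \<and> v \<in> B}\<^sup>+)"
proof (rule equivI)
  let ?R = "{(u, v). \<exists>B\<in>stack d d'. u \<in> B \<and> v \<in> B}"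
  have sub: "?R \<subseteq> verts3 r \<times> verts3 r"
    using Union_stack[OF assms] by auto
  show "?R\<^sup>+ \<subseteq> verts3 r \<times> verts3 r"
    using trancl_subset_Sigma[OF sub] .
  \<comment> \<open>Each vertex shares a block with itself, so the transitive closure is already
    reflexive on the vertices.\<close>
  show "refl_on (verts3 r) (?R\<^sup>+)"
    unfolding refl_on_def using Union_stack[OF assms] by blast
  have "sym ?R" by (auto simp: sym_def)
  then show "sym (?R\<^sup>+)" by (rule sym_trancl)
  show "trans (?R\<^sup>+)" by (rule trans_trancl)
qed

lemma partition_on_components:
  assumes "partition_on (verts r) d" "partition_on (verts r) d'"
  shows "partition_on (verts3 r) (components d d')"
  unfolding components_eq[OF assms] by (rule partition_on_quotient[OF equiv_stack[OF assms]])

lemma partition_on_compose: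
  assumes "partition_on (verts r) d" "partition_on (verts r) d'"
  shows "partition_on (verts r) (compose d d')"
proof -
  have "outer -` verts3 r = verts r"
  proof (intro equalityI subsetI)
    show "u \<in> verts r" if "u \<in> outer -` verts3 r" for u
      using that by (cases u) (auto simp: verts_def verts3_def)
    show "u \<in> outer -` verts3 r" if "u \<in> verts r" for u
      using that by (cases u) (auto simp: verts_def verts3_def)
  qed
  \<comment> \<open>Only components inside the middle row have empty preimage under
    \<open>outer\<close>; these are the ones counted by \<open>loops\<close>.\<close>
  moreover have "compose d d' = (-`) outer ` components d d' - {{}}"
    by (auto simp: compose_def)
  ultimately show ?thesis
    using partition_on_vimage[OF partition_on_components[OF assms], of outer] by simp
qed

lemma stack_in_component:
  assumes "partition_on (verts r) d" "partition_on (verts r) d'" "B \<in> stack d d'" "B \<noteq> {}"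
  shows "\<exists>C\<in>components d d'. B \<subseteq> C"
proof -
  let ?R = "{(u, v). \<exists>B\<in>stack d d'. u \<in> B \<and> v \<in> B}"
  obtain u where u: "u \<in> B" using assms(4) by auto
  have "B \<subseteq> ?R\<^sup>+ `` {u}" using u assms(3) by blast
  moreover have "u \<in> verts3 r" using u assms(3) Union_stack[OF assms(1,2)] by blast
  ultimately show ?thesis
    unfolding components_eq[OF assms(1,2)] by (meson quotientI)
qed

lemma constant_on_components_iff:
  assumes "partition_on (verts r) d" "partition_on (verts r) d'"
  shows "(\<forall>C\<in>components d d'. \<forall>u\<in>C. \<forall>v\<in>C. H u = H v) \<longleftrightarrow>
    (\<forall>B\<in>stack d d'. \<forall>u\<in>B. \<forall>v\<in>B. H u = H v)" (is "?L \<longleftrightarrow> ?S")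
proof
  assume ?L
  show ?S
  proof (intro ballI)
    fix B u v assume "B \<in> stack d d'" "u \<in> B" "v \<in> B"
    moreover from this obtain C where "C \<in> components d d'" "B \<subseteq> C"
      using stack_in_component[OF assms] by blast
    ultimately show "H u = H v" using \<open>?L\<close> by blast
  qed
next
  let ?R = "{(u, v). \<exists>B\<in>stack d d'. u \<in> B \<and> v \<in> B}"
  assume S: ?S
  have eq: "H u = H v" if "(u, v) \<in> ?R\<^sup>+" for u v
    using that by induction (use S in \<open>auto\<close>)
  show ?L
    unfolding components_eq[OF assms] quotient_def using eq
    by clarsimp (metis (no_types, lifting))
qed

lemma block_const_compose_iff:
  "block_const (compose d d') F \<longleftrightarrow>
    (\<forall>C\<in>components d d'. \<forall>u v. outer u \<in> C \<longrightarrow> outer v \<in> C \<longrightarrow> F u = F v)"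
  unfolding block_const_def compose_def by blast

lemma block_const_stack_iff:
  "(\<forall>B\<in>stack d d'. \<forall>u\<in>B. \<forall>v\<in>B. glue3 f g h u = glue3 f g h v) \<longleftrightarrow>
    block_const d (glue f g) \<and> block_const d' (glue g h)"
  by (auto simp: stack_def block_const_def glue3_upper glue3_lower ball_Un)

text \<open>
  The middle labels of a component that meets the outer boundary are forced by the outer labels,
  and each component inside the middle row can be given any label.
\<close>

lemma count_labellings:
  fixes f h :: "nat \<Rightarrow> nat"
  assumes d: "partition_on (verts r) d" and d': "partition_on (verts r) d'"
    and f: "\<And>j. j \<in> {1..r} \<Longrightarrow> f j < N" and h: "\<And>j. j \<in> {1..r} \<Longrightarrow> h j < N"
  shows "(\<Sum>g\<in>{1..r} \<rightarrow>\<^sub>E {..<N}. of_bool (block_const d (glue f g)) * of_bool (block_const d' (glue g h)))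
    = (N ^ loops d d' * of_bool (block_const (compose d d') (glue f h)) :: nat)"
proof -
  let ?P = "components d d'" and ?G = "{1..r} \<rightarrow>\<^sub>E {..<N}"
  define L where "L = {C \<in> ?P. C \<subseteq> range Mid}"
  note P = partition_on_components[OF d d']
  define ok where "ok g \<longleftrightarrow> (\<forall>C\<in>?P. \<forall>u\<in>C. \<forall>v\<in>C. glue3 f g h u = glue3 f g h v)" for g
  have ok: "ok g \<longleftrightarrow> block_const d (glue f g) \<and> block_const d' (glue g h)" for g
    unfolding ok_def constant_on_components_iff[OF d d'] block_const_stack_iff ..
  have "finite ?G" by (intro finite_PiE) auto
  have "(\<Sum>g\<in>?G. of_bool (block_const d (glue f g)) * of_bool (block_const d' (glue g h))) =
      (\<Sum>g\<in>?G. of_bool (ok g) :: nat)"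
    by (intro sum.cong refl) (simp add: ok)
  also have "\<dots> = card {g \<in> ?G. ok g}"
    using \<open>finite ?G\<close> by (simp add: of_bool_def sum.If_cases Int_def)
  also have "\<dots> = N ^ loops d d' * of_bool (block_const (compose d d') (glue f h))"
  proof (cases "block_const (compose d d') (glue f h)")
    case False
    have "\<not> ok g" for g
    proof
      assume g: "ok g"
      have "glue f h u = glue f h v" if "C \<in> ?P" "outer u \<in> C" "outer v \<in> C" for C u v
        using g that unfolding ok_def by (metis glue3_outer)
      then show False using False unfolding block_const_compose_iff by blast
    qed
    then show ?thesis using False by simp
  next
    case True
    define K where "K u = (THE C. C \<in> ?P \<and> u \<in> C)" for u
    have K1: "K u = C" if "C \<in> ?P" "u \<in> C" for u C
    proof -
      have "C' = C" if "C' \<in> ?P \<and> u \<in> C'" for C'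
        using disjointD[OF partition_onD2[OF P], of C' C] that \<open>C \<in> ?P\<close> \<open>u \<in> C\<close> by blast
      with that show ?thesis unfolding K_def by (intro the_equality conjI)
    qed
    have K2: "K u \<in> ?P" "u \<in> K u" if u: "u \<in> verts3 r" for u
    proof -
      obtain C where "C \<in> ?P" "u \<in> C" using u partition_onD1[OF P] by blast
      moreover from this have "K u = C" by (rule K1)
      ultimately show "K u \<in> ?P" "u \<in> K u" by simp_all
    qed
    have sub: "C \<subseteq> verts3 r" if "C \<in> ?P" for C
      using that partition_onD1[OF P] by blast
    have ne: "C \<noteq> {}" if "C \<in> ?P" for C
      using that partition_onD3[OF P] by blast
    \<comment> \<open>Here \<open>\<phi>\<close> labels the components inside the middle row, and
      any other middle vertex copies an outer vertex of its component. The choice of that vertex is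
      harmless because \<open>glue f h\<close> is constant on the blocks of the composite.\<close>
    define ext where "ext \<phi> = (\<lambda>j\<in>{1..r}. if K (Mid j) \<in> L then \<phi> (K (Mid j))
      else glue f h (SOME u. outer u \<in> K (Mid j)))" for \<phi>
    define rep where "rep C = (SOME j. Mid j \<in> C)" for C
    have rep: "Mid (rep C) \<in> C" if C: "C \<in> L" for C
    proof -
      obtain j where "Mid j \<in> C" using C ne[of C] by (auto simp: L_def)
      then show ?thesis unfolding rep_def by (rule someI)
    qed
    have rep_in: "rep C \<in> {1..r}" if "C \<in> L" for C
      using rep[OF that] sub[of C] that by (auto simp: verts3_def L_def)
    have outer_ex: "\<exists>u. outer u \<in> C" if C: "C \<in> ?P" "C \<notin> L" for C
    proof -
      obtain x where "x \<in> C" "x \<notin> range Mid" using C by (auto simp: L_def)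
      then show ?thesis by (cases x) (metis outer.simps rangeI)+
    qed
    have lab: "glue f h u < N" if "outer u \<in> verts3 r" for u
      using that f h by (cases u) (auto simp: verts3_def)
    have ext_outer: "glue3 f (ext \<phi>) h x = glue f h u"
      if C: "C \<in> ?P" "x \<in> C" "outer u \<in> C" for \<phi> C x u
    proof -
      have C_eq: "glue f h v = glue f h u" if "outer v \<in> C" for v
        using True C that unfolding block_const_compose_iff by blast
      show ?thesis
      proof (cases x)
        case (Mid j)
        have KC: "K (Mid j) = C" using K1[OF C(1)] C(2) Mid by simp
        have "C \<notin> L" using C(3) by (cases u) (auto simp: L_def)
        moreover have "j \<in> {1..r}" using sub[OF C(1)] C(2) Mid by (auto simp: verts3_def)
        moreover have "outer (SOME u. outer u \<in> C) \<in> C"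
          using C(3) by (rule someI)
        ultimately show ?thesis using C_eq Mid by (simp add: ext_def KC)
      next
        case (Top j)
        then show ?thesis using C_eq[of "North j"] C(2) by simp
      next
        case (Bot j)
        then show ?thesis using C_eq[of "South j"] C(2) by simp
      qed
    qed
    have ext_loop: "glue3 f (ext \<phi>) h x = \<phi> C" if C: "C \<in> L" "x \<in> C" for \<phi> C x
    proof -
      obtain j where j: "x = Mid j" using C by (auto simp: L_def)
      then have "K (Mid j) = C" "j \<in> {1..r}"
        using K1[of C "Mid j"] C sub[of C] by (auto simp: verts3_def L_def)
      then show ?thesis using C j by (simp add: ext_def)
    qed
    have "bij_betw ext (L \<rightarrow>\<^sub>E {..<N}) {g \<in> ?G. ok g}"
    proof (rule bij_betw_byWitness[where f' = "\<lambda>g. \<lambda>C\<in>L. g (rep C)"])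
      show "\<forall>\<phi>\<in>L \<rightarrow>\<^sub>E {..<N}. (\<lambda>C\<in>L. ext \<phi> (rep C)) = \<phi>"
      proof
        fix \<phi> assume \<phi>: "\<phi> \<in> L \<rightarrow>\<^sub>E {..<N}"
        show "(\<lambda>C\<in>L. ext \<phi> (rep C)) = \<phi>"
        proof
          fix C
          show "(\<lambda>C\<in>L. ext \<phi> (rep C)) C = \<phi> C"
          proof (cases "C \<in> L")
            case True
            have "ext \<phi> (rep C) = \<phi> C" using ext_loop[OF True rep[OF True], of \<phi>] by simp
            then show ?thesis using True by simp
          next
            case False
            then show ?thesis using PiE_arb[OF \<phi> False] by simp
          qed
        qed
      qed
      show "\<forall>g\<in>{g \<in> ?G. ok g}. ext (\<lambda>C\<in>L. g (rep C)) = g"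
      proof
        fix g assume g: "g \<in> {g \<in> ?G. ok g}"
        show "ext (\<lambda>C\<in>L. g (rep C)) = g"
        proof
          fix j
          show "ext (\<lambda>C\<in>L. g (rep C)) j = g j"
          proof (cases "j \<in> {1..r}")
            case True
            then have M: "Mid j \<in> verts3 r" by (simp add: verts3_def)
            have gC: "glue3 f g h x = g j" if "x \<in> K (Mid j)" for x
              using g K2[OF M] that unfolding ok_def by force
            show ?thesis
            proof (cases "K (Mid j) \<in> L")
              case L: True
              have "g (rep (K (Mid j))) = g j" using gC[OF rep[OF L]] by simp
              then show ?thesis using True L by (simp add: ext_def)
            next
              case L: False
              have "outer (SOME u. outer u \<in> K (Mid j)) \<in> K (Mid j)"
                using outer_ex[OF K2(1)[OF M] L] by (rule someI_ex)
              from gC[OF this] show ?thesis using True L by (simp add: ext_def glue3_outer)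
            qed
          next
            case False
            then have "g j = undefined" using g by (auto simp: PiE_def extensional_def)
            then show ?thesis using False by (auto simp: ext_def)
          qed
        qed
      qed
      show "ext ` (L \<rightarrow>\<^sub>E {..<N}) \<subseteq> {g \<in> ?G. ok g}"
      proof (intro image_subsetI CollectI conjI)
        fix \<phi> assume \<phi>: "\<phi> \<in> L \<rightarrow>\<^sub>E {..<N}"
        show "ext \<phi> \<in> ?G"
        proof
          fix j assume j: "j \<in> {1..r}"
          then have M: "Mid j \<in> verts3 r" by (simp add: verts3_def)
          show "ext \<phi> j \<in> {..<N}"
          proof (cases "K (Mid j) \<in> L")
            case True
            then show ?thesis using ext_loop[OF True K2(2)[OF M], of \<phi>] \<phi> by (auto simp: PiE_iff)
          next
            case False
            then obtain u where u: "outer u \<in> K (Mid j)" using outer_ex K2(1)[OF M] by blast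
            with sub[OF K2(1)[OF M]] have "glue f h u < N" using lab by blast
            then show ?thesis using ext_outer[OF K2(1)[OF M] K2(2)[OF M] u, of \<phi>] by simp
          qed
        next
          fix j assume "j \<notin> {1..r}"
          then show "ext \<phi> j = undefined" by (auto simp: ext_def)
        qed
        show "ok (ext \<phi>)"
          unfolding ok_def
        proof (intro ballI)
          fix C x y assume C: "C \<in> ?P" "x \<in> C" "y \<in> C"
          show "glue3 f (ext \<phi>) h x = glue3 f (ext \<phi>) h y"
          proof (cases "C \<in> L")
            case True
            then show ?thesis using ext_loop C by simp
          next
            case False
            then obtain u where "outer u \<in> C" using outer_ex C(1) by blast
            then show ?thesis using ext_outer C by simp
          qed
        qed
      qed
      show "(\<lambda>g. \<lambda>C\<in>L. g (rep C)) ` {g \<in> ?G. ok g} \<subseteq> L \<rightarrow>\<^sub>E {..<N}"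
        using rep_in by (auto simp: PiE_iff)
    qed
    then have "card {g \<in> ?G. ok g} = card (L \<rightarrow>\<^sub>E {..<N})"
      by (simp add: bij_betw_same_card)
    also have "\<dots> = N ^ card L"
    proof -
      have "finite ?P" using P by (rule finite_elements[rotated]) (simp add: verts3_def)
      then show ?thesis by (simp add: card_PiE L_def)
    qed
    finally show ?thesis using True by (simp add: loops_def L_def)
  qed
  finally show ?thesis .
qed


section \<open>Composition of diagrams\<close>

lemma finite_diagrams: "finite (diagrams k)"
proof -
  have "diagrams k \<subseteq> {d. partition_on (verts (half k)) d}"
    by (auto simp: diagrams_def verts_def)
  then show ?thesis
    using finitely_many_partition_on[OF finite_verts] finite_subset by blast
qed

lemma diagrams_partition_on: "d \<in> diagrams k \<Longrightarrow> partition_on (verts (half k)) d"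
  by (simp add: diagrams_def verts_def)

text \<open>For odd \<open>k\<close>, the blocks through the last strand of the two diagrams meet in
  the last middle vertex, so they lie in one component, which joins the two outer ends.\<close>

lemma compose_in_diagrams:
  assumes d: "d \<in> diagrams k" and d': "d' \<in> diagrams k"
  shows "compose d d' \<in> diagrams k"
proof -
  note P = diagrams_partition_on[OF d] diagrams_partition_on[OF d']
  let ?r = "half k"
  have "\<exists>B\<in>compose d d'. North ?r \<in> B \<and> South ?r \<in> B" if "odd k"
  proof -
    obtain B where B: "B \<in> d" "North ?r \<in> B" "South ?r \<in> B"
      using d \<open>odd k\<close> by (auto simp: diagrams_def)
    obtain B' where B': "B' \<in> d'" "North ?r \<in> B'" "South ?r \<in> B'"
      using d' \<open>odd k\<close> by (auto simp: diagrams_def)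
    have "upper ` B \<in> stack d d'" "lower ` B' \<in> stack d d'"
      using B B' by (auto simp: stack_def)
    with stack_in_component[OF P] B B' obtain C C' where
      C: "C \<in> components d d'" "C' \<in> components d d'" "upper ` B \<subseteq> C" "lower ` B' \<subseteq> C'"
      by (metis empty_iff image_is_empty)
    have "upper (North ?r) \<in> C" "upper (South ?r) \<in> C" "lower (North ?r) \<in> C'" "lower (South ?r) \<in> C'"
      using C B B' by blast+
    then have CC: "Top ?r \<in> C" "Mid ?r \<in> C" "Mid ?r \<in> C'" "Bot ?r \<in> C'"
      by simp_all
    then have "C = C'"
      using disjointD[OF partition_onD2[OF partition_on_components[OF P]], of C C'] C by blast
    then have "North ?r \<in> outer -` C \<and> South ?r \<in> outer -` C"
      using CC by simp
    then show ?thesis using C(1) unfolding compose_def by blast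
  qed
  then show ?thesis
    using partition_on_compose[OF P] by (simp add: diagrams_def verts_def)
qed

text \<open>
  Labelling each block of \<open>d\<close> by its own label picks out the diagrams refining \<open>d\<close>. Hence the
  indicator functions of the block-constant labellings are triangular for refinement.
\<close>

lemma block_const_independent:
  fixes c :: "diagram \<Rightarrow> int"
  assumes D: "finite D" "\<And>d. d \<in> D \<Longrightarrow> partition_on V d" and V: "finite V" "card V \<le> N"
    and zero: "\<And>F. F \<in> V \<rightarrow> {..<N} \<Longrightarrow> (\<Sum>d\<in>D. c d * of_bool (block_const d F)) = 0"
    and "d \<in> D"
  shows "c d = 0"
proof (rule ccontr)
  define E where "E d = {(x, y). \<exists>B\<in>d. x \<in> B \<and> y \<in> B}" for d :: diagram
  have E_sub: "E d \<subseteq> V \<times> V" if "d \<in> D" for d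
    using partition_onD1[OF D(2)[OF that]] by (auto simp: E_def)
  have E_inj: "d = d'" if "d \<in> D" "d' \<in> D" "E d = E d'" for d d'
    using partition_on_eq_quotient[OF D(2)[OF that(1)]] partition_on_eq_quotient[OF D(2)[OF that(2)]]
      that(3) unfolding E_def by metis
  assume "c d \<noteq> 0"
  \<comment> \<open>A diagram with the fewest related pairs in the support of \<open>c\<close>. A
    proper refinement would have fewer, so labelling \<open>d0\<close> by its blocks leaves
    \<open>d0\<close> as the only contributing term.\<close>
  then obtain d0 where d0: "d0 \<in> D" "c d0 \<noteq> 0"
      and min: "\<And>d. d \<in> D \<Longrightarrow> c d \<noteq> 0 \<Longrightarrow> card (E d0) \<le> card (E d)"
    using \<open>d \<in> D\<close> ex_has_least_nat[of "\<lambda>d. d \<in> D \<and> c d \<noteq> 0" d "\<lambda>d. card (E d)"] by blast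
  have P: "partition_on V d0" by (rule D(2)[OF d0(1)])
  define K where "K v = (THE B. B \<in> d0 \<and> v \<in> B)" for v
  have K1: "K v = B" if "B \<in> d0" "v \<in> B" for v B
  proof -
    have "B' = B" if "B' \<in> d0 \<and> v \<in> B'" for B'
      using disjointD[OF partition_onD2[OF P], of B' B] that \<open>B \<in> d0\<close> \<open>v \<in> B\<close> by blast
    with that show ?thesis unfolding K_def by (intro the_equality conjI)
  qed
  have K2: "K v \<in> d0" "v \<in> K v" if v: "v \<in> V" for v
  proof -
    obtain B where "B \<in> d0" "v \<in> B" using v partition_onD1[OF P] by blast
    moreover from this have "K v = B" by (rule K1)
    ultimately show "K v \<in> d0" "v \<in> K v" by simp_all
  qed
  have fin: "finite d0" by (rule finite_elements[OF V(1) P])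
  have "card d0 \<le> N"
  proof -
    have "d0 \<subseteq> K ` V"
    proof
      fix B assume B: "B \<in> d0"
      then obtain v where "v \<in> B" "v \<in> V"
        using partition_onD1[OF P] partition_onD3[OF P] by (metis UnionI ex_in_conv)
      then show "B \<in> K ` V" using K1[OF B] by blast
    qed
    then have "card d0 \<le> card V" by (meson V(1) card_image_le card_mono finite_imageI le_trans)
    then show ?thesis using V(2) by simp
  qed
  then obtain \<iota> where \<iota>: "inj_on \<iota> d0" "\<iota> ` d0 \<subseteq> {..<N}"
    using card_le_inj[OF fin, of "{..<N}"] by auto
  define F where "F v = \<iota> (K v)" for v
  have F_eq: "F x = F y \<longleftrightarrow> (x, y) \<in> E d0" if "x \<in> V" "y \<in> V" for x y
  proof -
    have "F x = F y \<longleftrightarrow> K x = K y"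
      using K2 that \<iota>(1) unfolding F_def by (auto dest: inj_onD)
    also have "\<dots> \<longleftrightarrow> (x, y) \<in> E d0"
    proof
      assume "K x = K y"
      then show "(x, y) \<in> E d0" using K2[OF that(1)] K2[OF that(2)] unfolding E_def by auto
    next
      assume "(x, y) \<in> E d0"
      then obtain B where "B \<in> d0" "x \<in> B" "y \<in> B" unfolding E_def by auto
      then show "K x = K y" using K1[of B x] K1[of B y] by simp
    qed
    finally show ?thesis .
  qed
  have iff: "block_const d' F \<longleftrightarrow> E d' \<subseteq> E d0" if "d' \<in> D" for d'
  proof -
    have "block_const d' F \<longleftrightarrow> (\<forall>(x, y)\<in>E d'. F x = F y)"
      unfolding block_const_def E_def by blast
    also have "\<dots> \<longleftrightarrow> E d' \<subseteq> E d0"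
      using E_sub[OF that] F_eq by blast
    finally show ?thesis .
  qed
  have "c d' * of_bool (block_const d' F) = (if d' = d0 then c d0 else 0)" if "d' \<in> D" for d'
  proof (cases "d' = d0 \<or> c d' = 0")
    case True
    then show ?thesis using iff[OF that] by auto
  next
    case False
    have "\<not> E d' \<subseteq> E d0"
    proof
      assume "E d' \<subseteq> E d0"
      moreover have "E d' \<noteq> E d0" using E_inj[OF that d0(1)] False by blast
      moreover have "finite (E d0)" using E_sub[OF d0(1)] V(1) by (meson finite_SigmaI finite_subset)
      ultimately have "card (E d') < card (E d0)" by (simp add: psubset_card_mono psubset_eq)
      then show False using min[OF that] False by simp
    qed
    then show ?thesis using iff[OF that] False by simp
  qed
  then have "(\<Sum>d\<in>D. c d * of_bool (block_const d F)) = (\<Sum>d\<in>D. if d = d0 then c d0 else 0)"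
    by (intro sum.cong) auto
  moreover have "F \<in> V \<rightarrow> {..<N}" using K2(1) \<iota>(2) by (auto simp: F_def image_subset_iff)
  ultimately show False using zero[of F] d0 D(1) by simp
qed

text \<open>The constant labelling is compatible with every diagram and compares the scalars.
  Independence, applied to the difference of the two diagrams, then shows that they
  coincide.\<close>

lemma block_const_glue_faithful:
  fixes c c' :: nat
  assumes d: "partition_on (verts r) d" and d': "partition_on (verts r) d'"
    and c: "c \<noteq> 0" and N: "card (verts r) \<le> N" "N \<noteq> 0"
    and eq: "\<And>f g. f \<in> {1..r} \<rightarrow> {..<N} \<Longrightarrow> g \<in> {1..r} \<rightarrow> {..<N} \<Longrightarrow>
      c * of_bool (block_const d (glue f g)) = c' * of_bool (block_const d' (glue f g))"
  shows "d = d' \<and> c = c'"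
proof -
  have "glue (\<lambda>_. 0 :: nat) (\<lambda>_. 0) u = 0" for u
    by (cases u) auto
  then have "block_const e (glue (\<lambda>_. 0 :: nat) (\<lambda>_. 0))" for e
    by (auto simp: block_const_def)
  then have cc': "c = c'"
    using eq[of "\<lambda>_. 0" "\<lambda>_. 0"] N by simp
  have "d = d'"
  proof (rule ccontr)
    assume ne: "d \<noteq> d'"
    let ?c = "\<lambda>e. if e = d then int c else - int c"
    have "?c d = 0"
    proof (rule block_const_independent[where c = ?c and d = d and D = "{d, d'}" and V = "verts r" and N = N])
      fix F :: "vertex \<Rightarrow> nat" assume F: "F \<in> verts r \<rightarrow> {..<N}"
      have "glue (F \<circ> North) (F \<circ> South) u = F u" for u
        by (cases u) auto
      then have "glue (F \<circ> North) (F \<circ> South) = F" by blast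
      moreover have "F \<circ> North \<in> {1..r} \<rightarrow> {..<N}" "F \<circ> South \<in> {1..r} \<rightarrow> {..<N}"
        using F by (auto simp: verts_def)
      ultimately have "of_bool (block_const d F) = (of_bool (block_const d' F) :: nat)"
        using eq[of "F \<circ> North" "F \<circ> South"] c cc' by simp
      then have "block_const d F \<longleftrightarrow> block_const d' F" by (simp add: of_bool_eq_iff)
      then show "(\<Sum>e\<in>{d, d'}. ?c e * of_bool (block_const e F)) = 0"
        using ne by (simp del: sum_mult_of_bool_eq)
    qed (use d d' N finite_verts in auto)
    then show False using c by simp
  qed
  then show ?thesis using cc' by simp
qed

lemma count_labellings_diagrams:
  assumes "d \<in> diagrams k" "d' \<in> diagrams k"
    "f \<in> {1..half k} \<rightarrow> {..<N}" "h \<in> {1..half k} \<rightarrow> {..<N}"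
  shows "(\<Sum>g\<in>{1..half k} \<rightarrow>\<^sub>E {..<N}.
      of_bool (block_const d (glue f g)) * of_bool (block_const d' (glue g h)))
    = (N ^ loops d d' * of_bool (block_const (compose d d') (glue f h)) :: nat)"
  using assms by (intro count_labellings diagrams_partition_on) auto

text \<open>Reduces identities between diagrams weighted by powers of the parameter to identities of
  matrices over the natural numbers. As \<open>N\<close> is at least 2, the power determines its
  exponent, so the numbers of loops are compared at the same time.\<close>

lemma diagram_eqI:
  assumes "d \<in> diagrams k" "d' \<in> diagrams k"
    and eq: "\<And>N f g. 2 \<le> N \<Longrightarrow> f \<in> {1..half k} \<rightarrow> {..<N} \<Longrightarrow> g \<in> {1..half k} \<rightarrow> {..<N} \<Longrightarrow>
      N ^ a * of_bool (block_const d (glue f g)) = (N ^ b * of_bool (block_const d' (glue f g)) :: nat)"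
  shows "d = d' \<and> a = b"
proof -
  let ?N = "card (verts (half k)) + 2"
  have "d = d' \<and> ?N ^ a = ?N ^ b"
    by (rule block_const_glue_faithful[where r = "half k" and N = ?N])
      (use assms diagrams_partition_on in auto)
  then show ?thesis by (auto simp: power_inject_exp)
qed

text \<open>Both sides describe the product of three matrices, so this is associativity of the
  matrix product, that is, an exchange of two sums.\<close>

lemma compose_assoc:
  assumes a: "a \<in> diagrams k" and b: "b \<in> diagrams k" and c: "c \<in> diagrams k"
  shows "compose (compose a b) c = compose a (compose b c) \<and>
    loops a b + loops (compose a b) c = loops b c + loops a (compose b c)"
proof (rule diagram_eqI)
  fix N :: nat and f h
  assume fh: "f \<in> {1..half k} \<rightarrow> {..<N}" "h \<in> {1..half k} \<rightarrow> {..<N}"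
  let ?G = "{1..half k} \<rightarrow>\<^sub>E {..<N}"
  let ?M = "\<lambda>d f g. of_bool (block_const d (glue f g)) :: nat"
  have G: "g \<in> {1..half k} \<rightarrow> {..<N}" if "g \<in> ?G" for g
    using that by auto
  have ab: "compose a b \<in> diagrams k" "compose b c \<in> diagrams k"
    using a b c compose_in_diagrams by auto
  have "N ^ (loops a b + loops (compose a b) c) * ?M (compose (compose a b) c) f h
      = N ^ loops a b * (\<Sum>g\<in>?G. ?M (compose a b) f g * ?M c g h)"
    by (simp only: count_labellings_diagrams[OF ab(1) c fh] power_add mult.assoc)
  also have "\<dots> = (\<Sum>g\<in>?G. (N ^ loops a b * ?M (compose a b) f g) * ?M c g h)"
    by (simp only: sum_distrib_left mult.assoc)
  also have "\<dots> = (\<Sum>g\<in>?G. (\<Sum>g'\<in>?G. ?M a f g' * ?M b g' g) * ?M c g h)"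
    by (intro sum.cong refl) (simp only: count_labellings_diagrams[OF a b fh(1) G])
  also have "\<dots> = (\<Sum>g'\<in>?G. ?M a f g' * (\<Sum>g\<in>?G. ?M b g' g * ?M c g h))"
    by (simp only: sum_distrib_left sum_distrib_right mult.assoc) (rule sum.swap)
  also have "\<dots> = (\<Sum>g'\<in>?G. ?M a f g' * (N ^ loops b c * ?M (compose b c) g' h))"
    by (intro sum.cong refl) (simp only: count_labellings_diagrams[OF b c G fh(2)])
  also have "\<dots> = N ^ loops b c * (\<Sum>g'\<in>?G. ?M a f g' * ?M (compose b c) g' h)"
    by (simp only: sum_distrib_left mult.left_commute)
  also have "\<dots> = N ^ (loops b c + loops a (compose b c)) * ?M (compose a (compose b c)) f h"
    by (simp only: count_labellings_diagrams[OF a ab(2) fh] power_add mult.assoc)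
  finally show "N ^ (loops a b + loops (compose a b) c) * ?M (compose (compose a b) c) f h
      = N ^ (loops b c + loops a (compose b c)) * ?M (compose a (compose b c)) f h" .
qed (use a b c compose_in_diagrams in auto)

section \<open>Flip and identity diagrams\<close>

definition flip_diagram :: "diagram \<Rightarrow> diagram" where
  "flip_diagram d = (\<lambda>B. flip_vertex ` B) ` d"

lemma flip_vertex_flip_vertex [simp]: "flip_vertex (flip_vertex v) = v"
  by (cases v) auto

lemma inj_flip_vertex: "inj flip_vertex"
  by (metis injI flip_vertex_flip_vertex)

lemma flip_diagram_flip_diagram [simp]: "flip_diagram (flip_diagram d) = d"
  by (simp add: flip_diagram_def image_image)

lemma flip_in_diagrams:
  assumes "d \<in> diagrams k"
  shows "flip_diagram d \<in> diagrams k"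
proof -
  note P = diagrams_partition_on[OF assms]
  have "flip_vertex ` verts (half k) = verts (half k)"
    by (auto simp: verts_def image_Un image_image)
  moreover have "{} \<notin> flip_diagram d"
    using partition_onD3[OF P] by (auto simp: flip_diagram_def)
  ultimately have "partition_on (verts (half k)) (flip_diagram d)"
    using partition_on_inj_image[OF P inj_on_subset[OF inj_flip_vertex subset_UNIV]]
    by (simp add: flip_diagram_def)
  moreover have "\<exists>B\<in>flip_diagram d. North (half k) \<in> B \<and> South (half k) \<in> B" if "odd k"
  proof -
    obtain B where B: "B \<in> d" "North (half k) \<in> B" "South (half k) \<in> B"
      using assms \<open>odd k\<close> by (auto simp: diagrams_def)
    then have "flip_vertex (South (half k)) \<in> flip_vertex ` B"
      "flip_vertex (North (half k)) \<in> flip_vertex ` B" by blast+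
    then show ?thesis using B(1) by (auto simp: flip_diagram_def)
  qed
  ultimately show ?thesis by (simp add: diagrams_def verts_def)
qed

lemma block_const_flip: "block_const (flip_diagram d) (glue f g) \<longleftrightarrow> block_const d (glue g f)"
proof -
  have "glue f g (flip_vertex u) = glue g f u" for u
    by (cases u) auto
  then show ?thesis by (simp add: block_const_def flip_diagram_def)
qed

text \<open>The flip transposes the matrix of a diagram, and transposition reverses
  products.\<close>

lemma compose_flip:
  assumes a: "a \<in> diagrams k" and b: "b \<in> diagrams k"
  shows "compose (flip_diagram b) (flip_diagram a) = flip_diagram (compose a b) \<and>
    loops (flip_diagram b) (flip_diagram a) = loops a b"
proof (rule diagram_eqI)
  fix N :: nat and f h
  assume fh: "f \<in> {1..half k} \<rightarrow> {..<N}" "h \<in> {1..half k} \<rightarrow> {..<N}"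
  have "N ^ loops (flip_diagram b) (flip_diagram a) *
        of_bool (block_const (compose (flip_diagram b) (flip_diagram a)) (glue f h)) =
      (\<Sum>g\<in>{1..half k} \<rightarrow>\<^sub>E {..<N}. of_bool (block_const a (glue h g)) *
        of_bool (block_const b (glue g f)) :: nat)"
    by (simp only: count_labellings_diagrams[OF flip_in_diagrams[OF b] flip_in_diagrams[OF a] fh,
          symmetric] block_const_flip mult.commute)
  also have "\<dots> = N ^ loops a b * of_bool (block_const (flip_diagram (compose a b)) (glue f h))"
    by (simp only: count_labellings_diagrams[OF a b fh(2,1)] block_const_flip)
  finally show "N ^ loops (flip_diagram b) (flip_diagram a) *
        of_bool (block_const (compose (flip_diagram b) (flip_diagram a)) (glue f h)) =
      (N ^ loops a b * of_bool (block_const (flip_diagram (compose a b)) (glue f h)) :: nat)" .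
qed (use a b compose_in_diagrams flip_in_diagrams in auto)

definition id_diagram :: "nat \<Rightarrow> diagram" where
  "id_diagram k = (\<lambda>j. {North j, South j}) ` {1..half k}"

lemma id_in_diagrams: "id_diagram k \<in> diagrams k"
proof -
  have "partition_on (verts (half k)) (id_diagram k)"
  proof (rule partition_onI)
    show "\<Union>(id_diagram k) = verts (half k)"
      by (auto simp: id_diagram_def verts_def)
  qed (auto simp: id_diagram_def disjnt_def)
  moreover have "\<exists>B\<in>id_diagram k. North (half k) \<in> B \<and> South (half k) \<in> B" if "odd k"
  proof -
    have "1 \<le> half k" using that by (auto simp: half_def elim: oddE)
    then have "{North (half k), South (half k)} \<in> id_diagram k" by (auto simp: id_diagram_def)
    then show ?thesis by blast
  qed
  ultimately show ?thesis by (simp add: diagrams_def verts_def)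
qed

lemma block_const_cong:
  assumes "partition_on (verts r) d" "\<And>j. j \<in> {1..r} \<Longrightarrow> f j = f' j" "\<And>j. j \<in> {1..r} \<Longrightarrow> g j = g' j"
  shows "block_const d (glue f g) = block_const d (glue f' g')"
proof -
  have "glue f g u = glue f' g' u" if "u \<in> verts r" for u
    using that assms(2,3) by (cases u) (auto simp: verts_def)
  then have "glue f g u = glue f' g' u" if "B \<in> d" "u \<in> B" for B u
    using partition_onD1[OF assms(1)] that by blast
  then show ?thesis
    unfolding block_const_def by (intro ball_cong refl) simp
qed

section \<open>Linear algebra over finite index sets\<close>

interpretation fm: module "smul :: 'a::comm_ring_1 \<Rightarrow> ('x \<Rightarrow> 'a) \<Rightarrow> 'x \<Rightarrow> 'a"
  by (rule module_smul)

interpretation vs: vector_space "smul :: 'a::field \<Rightarrow> ('x \<Rightarrow> 'a) \<Rightarrow> 'x \<Rightarrow> 'a"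
  by unfold_locales (auto simp: smul_def fun_eq_iff algebra_simps)

lemma sum_fun_apply: "(\<Sum>i\<in>I. f i) x = (\<Sum>i\<in>I. f i x)"
  by (induction I rule: infinite_finite_induct) auto

text \<open>The coefficients are indexed by \<open>X\<close> and not by the image, so
  \<open>g\<close> may repeat vectors.\<close>

lemma span_image_iff:
  assumes "finite X"
  shows "v \<in> module.span smul (g ` X) \<longleftrightarrow> (\<exists>c. v = (\<Sum>x\<in>X. smul (c x) (g x)))"
proof
  assume "v \<in> module.span smul (g ` X)"
  then show "\<exists>c. v = (\<Sum>x\<in>X. smul (c x) (g x))"
  proof (induction rule: fm.span_induct_alt)
    case base
    then show ?case by (intro exI[of _ "\<lambda>_. 0"]) simp
  next
    case (step a w y)
    then obtain c x where "y = (\<Sum>x\<in>X. smul (c x) (g x))" "x \<in> X" "w = g x" by auto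
    then have "smul a w + y = (\<Sum>x'\<in>X. smul (c x' + (if x' = x then a else 0)) (g x'))"
      using assms by (simp add: fm.scale_left_distrib sum.distrib if_distrib[of "\<lambda>a. smul a _"] cong: if_cong)
    then show ?case by (intro exI)
  qed
next
  assume "\<exists>c. v = (\<Sum>x\<in>X. smul (c x) (g x))"
  then show "v \<in> module.span smul (g ` X)"
    by (auto intro!: fm.span_sum fm.span_scale intro: fm.span_base)
qed

lemma independent_family:
  assumes "finite X" "inj_on g X" "\<not> module.dependent smul (g ` X)"
    "(\<Sum>x\<in>X. smul (c x) (g x)) = 0" "x \<in> X"
  shows "c x = 0"
proof -
  have "(\<Sum>v\<in>g ` X. smul (c (the_inv_into X g v)) v) = (\<Sum>x\<in>X. smul (c x) (g x))"
    using assms(2) by (simp add: sum.reindex the_inv_into_f_f)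
  then have "\<forall>v\<in>g ` X. c (the_inv_into X g v) = 0"
    using assms fm.dependent_finite[of "g ` X"] by auto
  then show ?thesis using assms(2,5) by (simp add: the_inv_into_f_f)
qed

text \<open>The rows of a square matrix with trivial left kernel are \<open>card X\<close>
  independent vectors in a space of that dimension, so they span it.\<close>

lemma injective_matrix_surjective:
  fixes M :: "'x \<Rightarrow> 'x \<Rightarrow> 'a::field"
  assumes X: "finite X"
    and inj: "\<And>c. (\<And>y. y \<in> X \<Longrightarrow> (\<Sum>x\<in>X. c x * M x y) = 0) \<Longrightarrow> \<forall>x\<in>X. c x = 0"
  shows "\<exists>c. \<forall>y\<in>X. (\<Sum>x\<in>X. c x * M x y) = b y"
proof -
  \<comment> \<open>Cutting off outside \<open>X\<close> places the rows in the span of the unit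
    vectors of \<open>X\<close>, which bounds the size of an independent set.\<close>
  define row where "row f = (\<lambda>y. if y \<in> X then f y else 0 :: 'a)" for f
  have ev: "(\<Sum>x\<in>X. smul (c x) (row (M x))) y = (if y \<in> X then \<Sum>x\<in>X. c x * M x y else 0)" for c y
    by (simp add: sum_fun_apply smul_def row_def)
  have zero: "\<forall>x\<in>X. c x = 0" if "(\<Sum>x\<in>X. smul (c x) (row (M x))) = 0" for c
  proof (rule inj)
    fix y assume "y \<in> X"
    then show "(\<Sum>x\<in>X. c x * M x y) = 0"
      using ev[of c y] that by simp
  qed
  have inj_row: "inj_on (\<lambda>x. row (M x)) X"
  proof (rule inj_onI, rule ccontr)
    fix x x' assume xx: "x \<in> X" "x' \<in> X" "row (M x) = row (M x')" "x \<noteq> x'"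
    \<comment> \<open>Two equal rows would put the difference of two unit vectors into the
      kernel.\<close>
    have "(\<Sum>y\<in>X. smul ((if y = x then 1 else 0) - (if y = x' then 1 else 0)) (row (M y)))
        = row (M x) - row (M x')"
      using X xx by (simp add: fm.scale_left_diff_distrib sum_subtractf if_distrib[of "\<lambda>a. smul a _"]
          cong: if_cong)
    then have "\<forall>y\<in>X. (if y = x then 1 else 0) - (if y = x' then 1 else 0) = (0 :: 'a)"
      using xx(3) by (intro zero) simp
    from bspec[OF this xx(1)] show False using xx(4) by simp
  qed
  let ?R = "(\<lambda>x. row (M x)) ` X"
  have indep: "\<not> module.dependent smul ?R"
  proof
    assume "module.dependent smul ?R"
    then obtain u where u: "\<exists>v\<in>?R. u v \<noteq> 0" "(\<Sum>v\<in>?R. smul (u v) v) = 0"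
      using fm.dependent_finite[of ?R] X by auto
    then have "(\<Sum>x\<in>X. smul (u (row (M x))) (row (M x))) = 0"
      using inj_row by (simp add: sum.reindex)
    from zero[OF this] u(1) show False by auto
  qed
  have in_span: "row f \<in> module.span smul (unit_vec ` X)" for f
  proof -
    have "row f = (\<Sum>x\<in>X. smul (f x) (unit_vec x))"
      using X by (auto simp: fun_eq_iff sum_fun_apply smul_def row_def unit_vec_def
          if_distrib[of "\<lambda>a. _ * a"] cong: if_cong)
    then show ?thesis using span_image_iff[OF X] by blast
  qed
  have "row b \<in> module.span smul ?R"
  proof (rule ccontr)
    assume "row b \<notin> module.span smul ?R"
    then have "\<not> module.dependent smul (insert (row b) ?R)"
      using indep vs.independent_insertI by blast
    then have "card (insert (row b) ?R) \<le> card (unit_vec ` X :: ('x \<Rightarrow> 'a) set)"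
      using vs.independent_span_bound[of "unit_vec ` X" "insert (row b) ?R"] X in_span by auto
    also have "\<dots> \<le> card X" using X by (rule card_image_le)
    also have "\<dots> = card ?R" using inj_row by (simp add: card_image)
    also have "\<dots> < card (insert (row b) ?R)"
      using \<open>row b \<notin> module.span smul ?R\<close> X fm.span_base[of "row b" ?R]
      by (subst card_insert_disjoint) blast+
    finally show False by simp
  qed
  then obtain c where c: "row b = (\<Sum>x\<in>X. smul (c x) (row (M x)))"
    using span_image_iff[OF X, of "row b" "\<lambda>x. row (M x)"] by blast
  have "(\<Sum>x\<in>X. c x * M x y) = b y" if "y \<in> X" for y
    using ev[of c y] that unfolding c[symmetric] by (simp add: row_def)
  then show ?thesis by blast
qed


section \<open>Cellular algebras with an anisotropic involution\<close>

text \<open>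
  \<open>co x (s, t)\<close> is the coefficient of the cellular basis element \<open>m (s, t)\<close> in \<open>x\<close>, where \<open>s\<close> and \<open>t\<close> have
  the same label.
\<close>

locale anisotropic_cellular =
  fixes A :: "('x \<Rightarrow> 'a::field) set"
    and mul :: "('x \<Rightarrow> 'a) \<Rightarrow> ('x \<Rightarrow> 'a) \<Rightarrow> 'x \<Rightarrow> 'a"  (infixl \<open>\<odot>\<close> 70)
    and star :: "('x \<Rightarrow> 'a) \<Rightarrow> 'x \<Rightarrow> 'a"
    and T :: "'t set" and lab :: "'t \<Rightarrow> 'l" and gt :: "'l \<Rightarrow> 'l \<Rightarrow> bool"
    and m :: "'t \<times> 't \<Rightarrow> 'x \<Rightarrow> 'a" and co :: "('x \<Rightarrow> 'a) \<Rightarrow> 't \<times> 't \<Rightarrow> 'a"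
    and r :: "'t \<Rightarrow> 't \<Rightarrow> ('x \<Rightarrow> 'a) \<Rightarrow> 'a"
  assumes A_zero [simp]: "0 \<in> A"
    and A_add: "x \<in> A \<Longrightarrow> y \<in> A \<Longrightarrow> x + y \<in> A"
    and A_smul: "x \<in> A \<Longrightarrow> smul c x \<in> A"
    and A_mul: "x \<in> A \<Longrightarrow> y \<in> A \<Longrightarrow> x \<odot> y \<in> A"
    and A_star: "x \<in> A \<Longrightarrow> star x \<in> A"
    and mul_add_left: "(x + y) \<odot> w = x \<odot> w + y \<odot> w"
    and mul_add_right: "w \<odot> (x + y) = w \<odot> x + w \<odot> y"
    and mul_smul_left: "smul c x \<odot> w = smul c (x \<odot> w)"
    and mul_smul_right: "w \<odot> smul c x = smul c (w \<odot> x)"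
    and mul_assoc: "x \<in> A \<Longrightarrow> y \<in> A \<Longrightarrow> w \<in> A \<Longrightarrow> x \<odot> y \<odot> w = x \<odot> (y \<odot> w)"
    and star_add: "star (x + y) = star x + star y"
    and star_smul: "star (smul c x) = smul c (star x)"
    and star_star: "x \<in> A \<Longrightarrow> star (star x) = x"
    and star_mul: "x \<in> A \<Longrightarrow> y \<in> A \<Longrightarrow> star (x \<odot> y) = star y \<odot> star x"
    and anisotropic: "x \<in> A \<Longrightarrow> star x \<odot> x = 0 \<Longrightarrow> x = 0"
    and finite_T: "finite T"
    and gt_irrefl: "l \<in> lab ` T \<Longrightarrow> \<not> gt l l"
    and gt_trans: "l \<in> lab ` T \<Longrightarrow> l' \<in> lab ` T \<Longrightarrow> l'' \<in> lab ` T \<Longrightarrow> gt l l' \<Longrightarrow> gt l' l'' \<Longrightarrow> gt l l''"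
    and m_in: "s \<in> T \<Longrightarrow> t \<in> T \<Longrightarrow> lab s = lab t \<Longrightarrow> m (s, t) \<in> A"
    and star_m: "s \<in> T \<Longrightarrow> t \<in> T \<Longrightarrow> lab s = lab t \<Longrightarrow> star (m (s, t)) = m (t, s)"
    and co_add: "x \<in> A \<Longrightarrow> y \<in> A \<Longrightarrow> co (x + y) i = co x i + co y i"
    and co_smul: "x \<in> A \<Longrightarrow> co (smul c x) i = c * co x i"
    and co_m: "s \<in> T \<Longrightarrow> t \<in> T \<Longrightarrow> lab s = lab t \<Longrightarrow>
      co (m (s, t)) i = (if i = (s, t) then 1 else 0)"
    and expand: "x \<in> A \<Longrightarrow> x = (\<Sum>i | fst i \<in> T \<and> snd i \<in> T \<and> lab (fst i) = lab (snd i). smul (co x i) (m i))"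
    and cell_mul: "s \<in> T \<Longrightarrow> t \<in> T \<Longrightarrow> lab s = lab t \<Longrightarrow> a \<in> A \<Longrightarrow> p \<in> T \<Longrightarrow> q \<in> T \<Longrightarrow>
      lab p = lab q \<Longrightarrow> \<not> gt (lab p) (lab s) \<Longrightarrow>
      co (m (s, t) \<odot> a) (p, q) = (if p = s then r t q a else 0)"
begin

section \<open>Coordinates and the ideals of upward closed sets of labels\<close>

definition index :: "('t \<times> 't) set" where
  "index = {i. fst i \<in> T \<and> snd i \<in> T \<and> lab (fst i) = lab (snd i)}"

definition ideal :: "'l set \<Rightarrow> ('x \<Rightarrow> 'a) set" where
  "ideal \<Gamma> = {x \<in> A. \<forall>i\<in>index. lab (fst i) \<notin> \<Gamma> \<longrightarrow> co x i = 0}"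

text \<open>Multiplying \<open>m (s, t)\<close> creates error terms with larger labels only, so
  upward closure is the condition under which \<open>ideal \<Gamma>\<close> is a two-sided
  ideal.\<close>

definition upper_set :: "'l set \<Rightarrow> bool" where
  "upper_set \<Gamma> \<longleftrightarrow> \<Gamma> \<subseteq> lab ` T \<and> (\<forall>l\<in>\<Gamma>. \<forall>l'\<in>lab ` T. gt l' l \<longrightarrow> l' \<in> \<Gamma>)"

lemma finite_index: "finite index"
  by (rule finite_subset[of _ "T \<times> T"]) (auto simp: index_def finite_T)

lemma index_iff: "(s, t) \<in> index \<longleftrightarrow> s \<in> T \<and> t \<in> T \<and> lab s = lab t"
  by (simp add: index_def)

lemma A_diff: "x \<in> A \<Longrightarrow> y \<in> A \<Longrightarrow> x - y \<in> A"
  using A_add[of x "smul (-1) y"] A_smul[of y "-1"] by (simp add: fm.scale_minus_left)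

lemma A_sum: "(\<And>i. i \<in> I \<Longrightarrow> f i \<in> A) \<Longrightarrow> sum f I \<in> A"
  by (induction I rule: infinite_finite_induct) (auto intro: A_add)

lemma mul_zero_left [simp]: "0 \<odot> x = 0"
  using mul_smul_left[of 0 0 x] by simp

lemma mul_zero_right [simp]: "x \<odot> 0 = 0"
  using mul_smul_right[of x 0 0] by simp

lemma mul_diff_left: "(x - y) \<odot> w = x \<odot> w - y \<odot> w"
  using mul_add_left[of "x - y" y w] by (simp add: algebra_simps)

lemma mul_diff_right: "w \<odot> (x - y) = w \<odot> x - w \<odot> y"
  using mul_add_right[of w "x - y" y] by (simp add: algebra_simps)

lemma mul_sum_left: "sum f I \<odot> w = (\<Sum>i\<in>I. f i \<odot> w)"
  using sum_comp_morphism[of "\<lambda>x. x \<odot> w" f I] by (simp add: mul_add_left o_def)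

lemma mul_sum_right: "w \<odot> sum f I = (\<Sum>i\<in>I. w \<odot> f i)"
  using sum_comp_morphism[of "\<lambda>x. w \<odot> x" f I] by (simp add: mul_add_right o_def)

lemma star_zero [simp]: "star 0 = 0"
  using star_smul[of 0 0] by simp

lemma star_sum: "star (sum f I) = (\<Sum>i\<in>I. star (f i))"
  using sum_comp_morphism[of star f I] by (simp add: star_add o_def)

lemma co_zero [simp]: "co 0 i = 0"
  using co_smul[of 0 0 i] by simp

lemma co_diff: "x \<in> A \<Longrightarrow> y \<in> A \<Longrightarrow> co (x - y) i = co x i - co y i"
  using co_add[of "x - y" y i] by (simp add: A_diff)

lemma co_sum: "(\<And>j. j \<in> J \<Longrightarrow> f j \<in> A) \<Longrightarrow> co (sum f J) i = (\<Sum>j\<in>J. co (f j) i)"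
  by (induction J rule: infinite_finite_induct) (auto simp: co_add A_sum)

lemma m_in_A: "i \<in> index \<Longrightarrow> m i \<in> A"
  by (cases i) (auto simp: index_iff m_in)

lemma co_m': "j \<in> index \<Longrightarrow> co (m j) i = (if i = j then 1 else 0)"
  by (cases j) (auto simp: index_iff co_m)

lemma expand_index: "x \<in> A \<Longrightarrow> x = (\<Sum>i\<in>index. smul (co x i) (m i))"
  unfolding index_def by (rule expand)

lemma co_combination:
  assumes "X \<subseteq> index"
  shows "co (\<Sum>j\<in>X. smul (c j) (m j)) i = (if i \<in> X then c i else 0)"
proof -
  have "co (\<Sum>j\<in>X. smul (c j) (m j)) i = (\<Sum>j\<in>X. c j * (if i = j then 1 else 0))"
    using assms by (subst co_sum) (auto simp: co_smul m_in_A A_smul co_m' subset_iff intro!: sum.cong)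
  also have "\<dots> = (if i \<in> X then c i else 0)"
    using finite_subset[OF assms finite_index] by (simp add: if_distrib[of "\<lambda>a. _ * a"] cong: if_cong)
  finally show ?thesis .
qed

lemma co_outside: "x \<in> A \<Longrightarrow> i \<notin> index \<Longrightarrow> co x i = 0"
  using co_combination[of index "co x" i] expand_index[of x] by simp

lemma A_eqI:
  assumes "x \<in> A" "y \<in> A" "\<And>i. i \<in> index \<Longrightarrow> co x i = co y i"
  shows "x = y"
proof -
  have "x = (\<Sum>i\<in>index. smul (co x i) (m i))" by (rule expand_index[OF assms(1)])
  also have "\<dots> = (\<Sum>i\<in>index. smul (co y i) (m i))" by (simp add: assms(3) cong: sum.cong)
  also have "\<dots> = y" by (rule expand_index[OF assms(2), symmetric])
  finally show ?thesis .
qed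

lemma co_star:
  assumes "x \<in> A"
  shows "co (star x) (s, t) = co x (t, s)"
proof -
  have "star x = (\<Sum>i\<in>index. smul (co x i) (star (m i)))"
    by (subst expand_index[OF assms]) (simp add: star_sum star_smul)
  also have "\<dots> = (\<Sum>i\<in>index. smul (co x i) (m (snd i, fst i)))"
    by (intro sum.cong refl) (auto simp: index_def star_m split_beta[symmetric])
  also have "\<dots> = (\<Sum>i\<in>index. smul (co x (snd i, fst i)) (m i))"
    by (rule sum.reindex_bij_witness[of _ "\<lambda>(s, t). (t, s)" "\<lambda>(s, t). (t, s)"])
      (auto simp: index_def)
  finally have "co (star x) (s, t) = (if (s, t) \<in> index then co x (t, s) else 0)"
    by (simp add: co_combination)
  then show ?thesis
    using co_outside[OF assms, of "(t, s)"] by (auto simp: index_iff)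
qed

lemma ideal_A: "x \<in> ideal \<Gamma> \<Longrightarrow> x \<in> A"
  by (auto simp: ideal_def)

lemma ideal_add: "x \<in> ideal \<Gamma> \<Longrightarrow> y \<in> ideal \<Gamma> \<Longrightarrow> x + y \<in> ideal \<Gamma>"
  by (auto simp: ideal_def A_add co_add)

lemma ideal_diff: "x \<in> ideal \<Gamma> \<Longrightarrow> y \<in> ideal \<Gamma> \<Longrightarrow> x - y \<in> ideal \<Gamma>"
  by (auto simp: ideal_def A_diff co_diff)

lemma ideal_mono: "\<Gamma> \<subseteq> \<Gamma>' \<Longrightarrow> ideal \<Gamma> \<subseteq> ideal \<Gamma>'"
  by (auto simp: ideal_def)

lemma ideal_star: "x \<in> ideal \<Gamma> \<Longrightarrow> star x \<in> ideal \<Gamma>"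
  by (auto simp: ideal_def A_star co_star index_def)

lemma ideal_empty: "x \<in> ideal {} \<Longrightarrow> x = 0"
  by (rule A_eqI) (auto simp: ideal_def)

lemma m_in_ideal: "s \<in> T \<Longrightarrow> t \<in> T \<Longrightarrow> lab s = lab t \<Longrightarrow> lab s \<in> \<Gamma> \<Longrightarrow> m (s, t) \<in> ideal \<Gamma>"
  by (auto simp: ideal_def m_in co_m)

lemma co_mul:
  assumes "x \<in> A" "a \<in> A"
  shows "co (x \<odot> a) i = (\<Sum>j\<in>index. co x j * co (m j \<odot> a) i)"
proof -
  have "x \<odot> a = (\<Sum>j\<in>index. smul (co x j) (m j \<odot> a))"
    by (subst expand_index[OF assms(1)]) (simp add: mul_sum_left mul_smul_left)
  then show ?thesis
    using assms by (simp add: co_sum co_smul A_smul A_mul m_in_A)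
qed

text \<open>A label outside \<open>\<Gamma>\<close> is neither equal to nor larger than a label in
  \<open>\<Gamma>\<close>, so \<open>cell_mul\<close> applies to its coordinates and gives
  zero.\<close>

lemma ideal_mul_right:
  assumes \<Gamma>: "upper_set \<Gamma>" and x: "x \<in> ideal \<Gamma>" and a: "a \<in> A"
  shows "x \<odot> a \<in> ideal \<Gamma>"
proof -
  have "co (x \<odot> a) i = 0" if i: "i \<in> index" "lab (fst i) \<notin> \<Gamma>" for i
  proof -
    have "co x j * co (m j \<odot> a) i = 0" if j: "j \<in> index" for j
    proof (cases "lab (fst j) \<in> \<Gamma>")
      case True
      obtain s t p q where st: "j = (s, t)" "i = (p, q)" by (metis surj_pair)
      have "\<not> gt (lab p) (lab s)" "p \<noteq> s"
        using \<Gamma> True i st j unfolding upper_set_def index_def by auto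
      then show ?thesis using cell_mul[of s t a p q] a st i j by (simp add: index_iff)
    next
      case False
      then show ?thesis using x j by (simp add: ideal_def)
    qed
    then show ?thesis using ideal_A[OF x] a by (simp add: co_mul sum.neutral)
  qed
  then show ?thesis using ideal_A[OF x] a by (auto simp: ideal_def A_mul)
qed

lemma ideal_mul_left:
  assumes \<Gamma>: "upper_set \<Gamma>" and x: "x \<in> ideal \<Gamma>" and a: "a \<in> A"
  shows "a \<odot> x \<in> ideal \<Gamma>"
proof -
  have "star (star x \<odot> star a) \<in> ideal \<Gamma>"
    using assms by (intro ideal_star ideal_mul_right A_star)
  then show ?thesis
    using ideal_A[OF x] a by (simp add: star_mul star_star A_star)
qed

text \<open>Upward closure of \<open>\<Gamma> - {l}\<close> means that \<open>l\<close> is not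
  larger than any label of \<open>\<Gamma>\<close>. Hence no error term reaches the coordinates at
  \<open>l\<close>, and they are multiplied by the matrix of \<open>a\<close> on the cell module of
  \<open>l\<close>.\<close>

lemma co_mul_minimal:
  assumes \<Gamma>: "upper_set (\<Gamma> - {l})" and x: "x \<in> ideal \<Gamma>" and a: "a \<in> A"
    and p: "p \<in> T" "q \<in> T" "lab p = l" "lab q = l"
  shows "co (x \<odot> a) (p, q) = (\<Sum>t | t \<in> T \<and> lab t = l. co x (p, t) * r t q a)"
proof -
  have "co x j * co (m j \<odot> a) (p, q) = (if fst j = p then co x j * r (snd j) q a else 0)"
    if j: "j \<in> index" for j
  proof (cases "lab (fst j) \<in> \<Gamma>")
    case True
    obtain s t where st: "j = (s, t)" by (metis surj_pair)
    have "\<not> gt (lab p) (lab s)"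
    proof
      assume gt: "gt (lab p) (lab s)"
      have "lab p \<in> lab ` T" using p by auto
      show False
      proof (cases "lab s = l")
        case True
        then show False using gt gt_irrefl[OF \<open>lab p \<in> lab ` T\<close>] p by simp
      next
        case False
        then have "lab s \<in> \<Gamma> - {l}" using \<open>lab (fst j) \<in> \<Gamma>\<close> st by simp
        then have "lab p \<in> \<Gamma> - {l}" using \<Gamma> gt \<open>lab p \<in> lab ` T\<close> unfolding upper_set_def by blast
        then show False using p by simp
      qed
    qed
    then show ?thesis using cell_mul[of s t a p q] a st p j by (simp add: index_iff)
  next
    case False
    then have "co x j = 0" using x j by (auto simp: ideal_def)
    then show ?thesis by simp
  qed
  then have "co (x \<odot> a) (p, q) = (\<Sum>j\<in>index. if fst j = p then co x j * r (snd j) q a else 0)"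
    using ideal_A[OF x] a by (simp add: co_mul cong: sum.cong)
  also have "\<dots> = (\<Sum>j\<in>{j \<in> index. fst j = p}. co x j * r (snd j) q a)"
    using finite_index by (simp add: sum.If_cases Int_def)
  also have "\<dots> = (\<Sum>t | t \<in> T \<and> lab t = l. co x (p, t) * r t q a)"
    by (rule sum.reindex_bij_witness[of _ "\<lambda>t. (p, t)" snd]) (use p in \<open>auto simp: index_def\<close>)
  finally show ?thesis .
qed

section \<open>The matrices of the cell modules\<close>

definition above :: "'l \<Rightarrow> 'l set" where
  "above l = {l' \<in> lab ` T. gt l' l}"

lemma upper_set_above:
  assumes "l \<in> lab ` T"
  shows "upper_set (above l)" "upper_set (insert l (above l))" "l \<notin> above l"
proof -
  have "gt l'' l" if "l' \<in> lab ` T" "l'' \<in> lab ` T" "gt l' l" "gt l'' l'" for l' l''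
    using gt_trans[OF that(2,1) assms that(4,3)] .
  then show "upper_set (above l)" "upper_set (insert l (above l))"
    using assms unfolding upper_set_def above_def by blast+
  show "l \<notin> above l" using gt_irrefl[OF assms] by (simp add: above_def)
qed

text \<open>The locale constrains \<open>r\<close> through \<open>cell_mul\<close> only. Reading it
  off as a coordinate of a product makes it linear in \<open>a\<close>.\<close>

lemma r_eq:
  assumes "t \<in> T" "q \<in> T" "lab t = lab q" "a \<in> A"
  shows "r t q a = co (m (t, t) \<odot> a) (t, q)"
  using assms cell_mul[of t t a t q] gt_irrefl[of "lab t"] by simp

lemma r_smul:
  "t \<in> T \<Longrightarrow> q \<in> T \<Longrightarrow> lab t = lab q \<Longrightarrow> a \<in> A \<Longrightarrow> r t q (smul c a) = c * r t q a"
  by (simp add: r_eq A_smul mul_smul_right co_smul A_mul m_in)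

lemma r_diff:
  "t \<in> T \<Longrightarrow> q \<in> T \<Longrightarrow> lab t = lab q \<Longrightarrow> a \<in> A \<Longrightarrow> b \<in> A \<Longrightarrow> r t q (a - b) = r t q a - r t q b"
  by (simp add: r_eq A_diff mul_diff_right co_diff A_mul m_in)

lemma r_sum:
  assumes "t \<in> T" "q \<in> T" "lab t = lab q" "\<And>j. j \<in> J \<Longrightarrow> f j \<in> A"
  shows "r t q (sum f J) = (\<Sum>j\<in>J. r t q (f j))"
proof -
  have "r t q (sum f J) = co (\<Sum>j\<in>J. m (t, t) \<odot> f j) (t, q)"
    using assms by (simp add: r_eq A_sum mul_sum_right)
  also have "\<dots> = (\<Sum>j\<in>J. r t q (f j))"
    using assms by (subst co_sum) (auto simp: r_eq A_mul m_in)
  finally show ?thesis .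
qed

text \<open>Associativity read at the coordinate \<open>(t, q)\<close>: the part of
  \<open>m (t, t) \<odot> a\<close> with larger labels does not contribute there, by
  \<open>co_mul_minimal\<close>.\<close>

lemma r_mul:
  assumes t: "t \<in> T" and q: "q \<in> T" "lab t = lab q" and ab: "a \<in> A" "b \<in> A"
  shows "r t q (a \<odot> b) = (\<Sum>w | w \<in> T \<and> lab w = lab t. r t w a * r w q b)"
proof -
  let ?\<Gamma> = "insert (lab t) (above (lab t))"
  have l: "lab t \<in> lab ` T" using t by simp
  note up = upper_set_above[OF l]
  have up': "upper_set (?\<Gamma> - {lab t})" using up by simp
  have x: "m (t, t) \<odot> a \<in> ideal ?\<Gamma>"
    using t ab by (intro ideal_mul_right up m_in_ideal) auto
  have "r t q (a \<odot> b) = co (m (t, t) \<odot> a \<odot> b) (t, q)"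
    using t q ab by (simp add: r_eq A_mul mul_assoc m_in)
  also have "\<dots> = (\<Sum>w | w \<in> T \<and> lab w = lab t. co (m (t, t) \<odot> a) (t, w) * r w q b)"
    using q t by (intro co_mul_minimal[OF up' x ab(2)]) auto
  also have "\<dots> = (\<Sum>w | w \<in> T \<and> lab w = lab t. r t w a * r w q b)"
    using t ab by (intro sum.cong refl) (simp add: r_eq)
  finally show ?thesis .
qed

text \<open>Both products lie in the ideal, and therefore both equal
  \<open>e \<odot> a \<odot> e\<close>.\<close>

lemma identity_central:
  assumes \<Gamma>: "upper_set \<Gamma>" and e: "e \<in> ideal \<Gamma>"
    and id: "\<And>x. x \<in> ideal \<Gamma> \<Longrightarrow> e \<odot> x = x \<and> x \<odot> e = x" and a: "a \<in> A"
  shows "e \<odot> a = a \<odot> e"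
proof -
  have "e \<odot> a = e \<odot> a \<odot> e" using id[OF ideal_mul_right[OF \<Gamma> e a]] by simp
  also have "\<dots> = e \<odot> (a \<odot> e)" using e a ideal_A by (simp add: mul_assoc)
  also have "\<dots> = a \<odot> e" using id[OF ideal_mul_left[OF \<Gamma> e a]] by simp
  finally show ?thesis .
qed

text \<open>
  For a minimal label \<open>l\<close> of \<open>\<Gamma>\<close>, the ideal of \<open>\<Gamma>\<close> modulo that of \<open>\<Gamma> - {l}\<close> acts faithfully on the cell
  module of \<open>l\<close> by anisotropy. Counting dimensions, it acts by all matrices, and an element acting as
  the identity matrix is an identity modulo the ideal of \<open>\<Gamma> - {l}\<close>.
\<close>

lemma ideal_identity:
  assumes "upper_set \<Gamma>"
  shows "\<exists>e\<in>ideal \<Gamma>. \<forall>x\<in>ideal \<Gamma>. e \<odot> x = x \<and> x \<odot> e = x"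
  using assms
proof (induction "card \<Gamma>" arbitrary: \<Gamma> rule: less_induct)
  case less
  note \<Gamma> = \<open>upper_set \<Gamma>\<close>
  have fin: "finite \<Gamma>" using \<Gamma> finite_T unfolding upper_set_def by (meson finite_imageI finite_subset)
  show ?case
  proof (cases "\<Gamma> = {}")
    case True
    have "0 \<in> ideal {}" by (auto simp: ideal_def)
    then show ?thesis using True ideal_empty by (intro bexI[of _ 0]) auto
  next
    case False
    \<comment> \<open>An \<open>R\<close>-minimal label is not larger than any other label of
      \<open>\<Gamma>\<close>, so removing it leaves an upward closed set.\<close>
    define R where "R = {(l', l). l' \<in> \<Gamma> \<and> l \<in> \<Gamma> \<and> gt l l'}"
    have "wf R"
    proof (rule finite_acyclic_wf)
      show "finite R"
        by (rule finite_subset[of _ "\<Gamma> \<times> \<Gamma>"]) (use fin in \<open>auto simp: R_def\<close>)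
      have sub: "\<Gamma> \<subseteq> lab ` T" using \<Gamma> by (simp add: upper_set_def)
      have "gt l l''" if "l \<in> \<Gamma>" "l' \<in> \<Gamma>" "l'' \<in> \<Gamma>" "gt l l'" "gt l' l''" for l l' l''
        using gt_trans[of l l' l''] sub that by blast
      then have "trans R"
        unfolding trans_def R_def by blast
      then show "acyclic R"
        using sub gt_irrefl by (auto simp: acyclic_def R_def)
    qed
    obtain l0 where l0: "l0 \<in> \<Gamma>" using False by auto
    obtain l where "l \<in> \<Gamma>" "\<forall>l'. (l', l) \<in> R \<longrightarrow> l' \<notin> \<Gamma>"
      using wf_eq_minimal[THEN iffD1, OF \<open>wf R\<close>, rule_format, OF l0] by auto
    then have l: "l \<in> \<Gamma>" "\<And>l'. l' \<in> \<Gamma> \<Longrightarrow> \<not> gt l l'"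
      unfolding R_def by blast+
    let ?\<Gamma>' = "\<Gamma> - {l}"
    have \<Gamma>': "upper_set ?\<Gamma>'"
      using \<Gamma> l unfolding upper_set_def by blast
    have sub: "ideal ?\<Gamma>' \<subseteq> ideal \<Gamma>" by (rule ideal_mono) auto
    have "card ?\<Gamma>' < card \<Gamma>" by (rule card_Diff1_less[OF fin l(1)])
    from less.hyps[OF this \<Gamma>'] obtain e where e: "e \<in> ideal ?\<Gamma>'"
      and id: "\<And>x. x \<in> ideal ?\<Gamma>' \<Longrightarrow> e \<odot> x = x \<and> x \<odot> e = x" by blast
    have central: "e \<odot> a = a \<odot> e" if "a \<in> A" for a
      using identity_central[OF \<Gamma>' e] id that by blast
    have eA: "e \<in> A" using e by (rule ideal_A)
    have ideal_top: "x \<in> ideal ?\<Gamma>'"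
      if "x \<in> ideal \<Gamma>" "\<And>p q. p \<in> T \<Longrightarrow> q \<in> T \<Longrightarrow> lab p = l \<Longrightarrow> lab q = l \<Longrightarrow> co x (p, q) = 0" for x
      using that by (auto simp: ideal_def index_def)
    define X where "X = {i \<in> index. lab (fst i) = l}"
    have X: "finite X" "X \<subseteq> index" using finite_index by (auto simp: X_def)
    have comb: "(\<Sum>i\<in>X. smul (c i) (m i)) \<in> ideal \<Gamma>" for c
      unfolding ideal_def
      using X(2) l(1) by (auto simp: co_combination X_def intro!: A_sum A_smul m_in_A)
    have r_comb: "r t q (\<Sum>i\<in>X. smul (c i) (m i)) = (\<Sum>i\<in>X. c i * r t q (m i))"
      if "t \<in> T" "q \<in> T" "lab t = lab q" for t q c
      using that X(2) by (subst r_sum) (auto simp: A_smul m_in_A r_smul intro!: sum.cong)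
    have "\<exists>c. \<forall>j\<in>X. (\<Sum>i\<in>X. c i * r (fst j) (snd j) (m i)) = (if fst j = snd j then 1 else 0)"
    proof (rule injective_matrix_surjective[OF X(1)])
      fix c assume c: "\<And>j. j \<in> X \<Longrightarrow> (\<Sum>i\<in>X. c i * r (fst j) (snd j) (m i)) = 0"
      define x where "x = (\<Sum>i\<in>X. smul (c i) (m i))"
      have x: "x \<in> ideal \<Gamma>" "x \<in> A" unfolding x_def using comb ideal_A by blast+
      have rx: "r t q x = 0" if "t \<in> T" "q \<in> T" "lab t = l" "lab q = l" for t q
        using that c[of "(t, q)"] r_comb[of t q c] by (simp add: x_def X_def index_def)
      have yx: "y \<odot> x \<in> ideal ?\<Gamma>'" if y: "y \<in> ideal \<Gamma>" for y
      proof (rule ideal_top)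
        show "y \<odot> x \<in> ideal \<Gamma>" by (rule ideal_mul_right[OF \<Gamma> y x(2)])
        show "co (y \<odot> x) (p, q) = 0" if "p \<in> T" "q \<in> T" "lab p = l" "lab q = l" for p q
          using that rx by (simp add: co_mul_minimal[OF \<Gamma>' y x(2)])
      qed
      \<comment> \<open>If \<open>x\<close> acts as zero on the cell module, then
        \<open>y \<odot> x\<close> is in the smaller ideal for all \<open>y\<close> in the larger
        one and is fixed by the central \<open>e\<close>. So \<open>y \<odot> x' = 0\<close>, and
        \<open>y = star x'\<close> brings in anisotropy.\<close>
      define x' where "x' = x - e \<odot> x"
      have ex: "e \<odot> x \<in> ideal ?\<Gamma>'" by (rule ideal_mul_right[OF \<Gamma>' e x(2)])
      have x': "x' \<in> ideal \<Gamma>" "x' \<in> A"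
        using x ex sub ideal_diff ideal_A unfolding x'_def by blast+
      let ?y = "star x'"
      have y: "?y \<in> ideal \<Gamma>" "?y \<in> A" using x' ideal_star ideal_A by blast+
      have "?y \<odot> x' = ?y \<odot> x - ?y \<odot> e \<odot> x"
        using x y eA by (simp add: x'_def mul_diff_right mul_assoc)
      also have "?y \<odot> e \<odot> x = e \<odot> (?y \<odot> x)"
        using central[OF y(2)] x y eA by (simp flip: mul_assoc)
      also have "\<dots> = ?y \<odot> x" using id[OF yx[OF y(1)]] by simp
      finally have "?y \<odot> x' = 0" by (simp only: diff_self)
      then have "x' = 0" by (rule anisotropic[OF x'(2)])
      then have "x \<in> ideal ?\<Gamma>'" using ex by (simp add: x'_def)
      then have "co x i = 0" if "i \<in> X" for i
        using that by (auto simp: ideal_def X_def)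
      then show "\<forall>i\<in>X. c i = 0"
        by (simp add: x_def co_combination[OF X(2)])
    qed
    then obtain c where c: "\<And>j. j \<in> X \<Longrightarrow>
        (\<Sum>i\<in>X. c i * r (fst j) (snd j) (m i)) = (if fst j = snd j then 1 else 0)" by blast
    define x where "x = (\<Sum>i\<in>X. smul (c i) (m i))"
    have x: "x \<in> ideal \<Gamma>" "x \<in> A" unfolding x_def using comb ideal_A by blast+
    have rx: "r t q x = (if t = q then 1 else 0)" if "t \<in> T" "q \<in> T" "lab t = l" "lab q = l" for t q
      using that c[of "(t, q)"] r_comb[of t q c] by (simp add: x_def X_def index_def)
    have yx: "y \<odot> x - y \<in> ideal ?\<Gamma>'" if y: "y \<in> ideal \<Gamma>" for y
    proof (rule ideal_top)
      show "y \<odot> x - y \<in> ideal \<Gamma>" using ideal_diff[OF ideal_mul_right[OF \<Gamma> y x(2)] y] .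
      show "co (y \<odot> x - y) (p, q) = 0" if p: "p \<in> T" "q \<in> T" "lab p = l" "lab q = l" for p q
      proof -
        have "co (y \<odot> x) (p, q) = (\<Sum>t | t \<in> T \<and> lab t = l. co y (p, t) * (if t = q then 1 else 0))"
          unfolding co_mul_minimal[OF \<Gamma>' y x(2) p] using p rx by (intro sum.cong refl) auto
        also have "\<dots> = co y (p, q)"
          using finite_T p by (simp add: if_distrib[of "\<lambda>a. _ * a"] cong: if_cong)
        finally show ?thesis using ideal_A[OF y] x(2) by (simp add: co_diff A_mul)
      qed
    qed
    \<comment> \<open>Here \<open>x\<close> is a right identity only modulo the smaller ideal.
      Removing its part \<open>x \<odot> e\<close> and putting \<open>e\<close> in its place makes
      it a true right identity.\<close>
    define E where "E = e + (x - x \<odot> e)"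
    have E: "E \<in> ideal \<Gamma>" "E \<in> A"
      using e x sub ideal_mul_right[OF \<Gamma> x(1) eA] ideal_add ideal_diff ideal_A
      unfolding E_def by blast+
    have yE: "y \<odot> E = y" if y: "y \<in> ideal \<Gamma>" for y
    proof -
      have "(y \<odot> x - y) \<odot> e = y \<odot> x - y" using id[OF yx[OF y]] by simp
      then have "y \<odot> x \<odot> e = y \<odot> e + y \<odot> x - y" by (simp add: mul_diff_left algebra_simps)
      then show ?thesis
        using ideal_A[OF y] x(2) eA
        by (simp add: E_def mul_add_right mul_diff_right mul_assoc algebra_simps)
    qed
    \<comment> \<open>The involution turns the right identity into a left one; a left and a right
      identity in the same ideal coincide.\<close>
    have Ey: "star E \<odot> y = y" if y: "y \<in> ideal \<Gamma>" for y
    proof -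
      have "star (star y \<odot> E) = star (star y)" using yE[OF ideal_star[OF y]] by simp
      then show ?thesis using ideal_A[OF y] E(2) by (simp add: star_mul star_star A_star)
    qed
    have "star E = E" using yE[OF ideal_star[OF E(1)]] Ey[OF E(1)] by simp
    then show ?thesis using E(1) yE Ey by (intro bexI[of _ E]) auto
  qed
qed

section \<open>Identities of the ideals and the cell idempotents\<close>

definition unit :: "'l set \<Rightarrow> 'x \<Rightarrow> 'a" where
  "unit \<Gamma> = (SOME e. e \<in> ideal \<Gamma> \<and> (\<forall>x\<in>ideal \<Gamma>. e \<odot> x = x \<and> x \<odot> e = x))"

lemma unit:
  assumes "upper_set \<Gamma>"
  shows "unit \<Gamma> \<in> ideal \<Gamma>" "unit \<Gamma> \<in> A" "x \<in> ideal \<Gamma> \<Longrightarrow> unit \<Gamma> \<odot> x = x"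
    "x \<in> ideal \<Gamma> \<Longrightarrow> x \<odot> unit \<Gamma> = x"
proof -
  have "\<exists>e. e \<in> ideal \<Gamma> \<and> (\<forall>x\<in>ideal \<Gamma>. e \<odot> x = x \<and> x \<odot> e = x)"
    using ideal_identity[OF assms] by blast
  then have "unit \<Gamma> \<in> ideal \<Gamma> \<and> (\<forall>x\<in>ideal \<Gamma>. unit \<Gamma> \<odot> x = x \<and> x \<odot> unit \<Gamma> = x)"
    unfolding unit_def by (rule someI_ex)
  then show "unit \<Gamma> \<in> ideal \<Gamma>" "unit \<Gamma> \<in> A" "x \<in> ideal \<Gamma> \<Longrightarrow> unit \<Gamma> \<odot> x = x"
    "x \<in> ideal \<Gamma> \<Longrightarrow> x \<odot> unit \<Gamma> = x"
    using ideal_A by auto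
qed

lemma unit_central:
  assumes "upper_set \<Gamma>" "a \<in> A"
  shows "unit \<Gamma> \<odot> a = a \<odot> unit \<Gamma>"
  by (rule identity_central[OF assms(1) unit(1)[OF assms(1)] _ assms(2)])
    (simp add: unit[OF assms(1)])

text \<open>If the label is in \<open>\<Gamma>\<close>, then \<open>unit \<Gamma>\<close> fixes
  \<open>m (t, t)\<close>. Otherwise the product lies in \<open>ideal \<Gamma>\<close>, whose
  elements have no coordinates at this label.\<close>

lemma r_unit:
  assumes \<Gamma>: "upper_set \<Gamma>" and t: "t \<in> T" "q \<in> T" "lab t = lab q"
  shows "r t q (unit \<Gamma>) = (if lab t \<in> \<Gamma> \<and> t = q then 1 else 0)"
proof (cases "lab t \<in> \<Gamma>")
  case True
  then have "m (t, t) \<odot> unit \<Gamma> = m (t, t)" using t by (intro unit[OF \<Gamma>] m_in_ideal) auto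
  then show ?thesis using True t unit[OF \<Gamma>] by (auto simp: r_eq co_m)
next
  case False
  have "m (t, t) \<odot> unit \<Gamma> \<in> ideal \<Gamma>"
    using t by (intro ideal_mul_left[OF \<Gamma>] unit[OF \<Gamma>] m_in) auto
  then show ?thesis using False t unit[OF \<Gamma>] by (auto simp: r_eq ideal_def index_def)
qed

text \<open>The set \<open>insert l (above l)\<close> is the smallest upper set containing
  \<open>l\<close>, so the difference of the two identities cuts out the block of the cell module of
  \<open>l\<close>.\<close>

definition cell_idem :: "'l \<Rightarrow> 'x \<Rightarrow> 'a" where
  "cell_idem l = unit (insert l (above l)) - unit (above l)"

definition central_idem :: "('x \<Rightarrow> 'a) \<Rightarrow> bool" where
  "central_idem e \<longleftrightarrow> e \<in> A \<and> e \<odot> e = e \<and> (\<forall>x\<in>A. e \<odot> x = x \<odot> e)"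

definition primitive_idem :: "('x \<Rightarrow> 'a) \<Rightarrow> bool" where
  "primitive_idem e \<longleftrightarrow> central_idem e \<and> e \<noteq> 0 \<and>
    (\<forall>f. central_idem f \<and> e \<odot> f = f \<longrightarrow> f = 0 \<or> f = e)"

context
  fixes l assumes l: "l \<in> lab ` T"
begin

private abbreviation "e1 \<equiv> unit (insert l (above l))"
private abbreviation "e0 \<equiv> unit (above l)"

private lemmas up = upper_set_above(1,2)[OF l]

private lemma e10: "e1 \<odot> e0 = e0" "e0 \<odot> e1 = e0" "e1 \<odot> e1 = e1" "e0 \<odot> e0 = e0"
  "e1 \<in> A" "e0 \<in> A"
proof -
  have "e0 \<in> ideal (insert l (above l))"
    using unit(1)[OF up(1)] ideal_mono[of "above l" "insert l (above l)"] by blast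
  then show "e1 \<odot> e0 = e0" "e0 \<odot> e1 = e0" "e1 \<odot> e1 = e1" "e0 \<odot> e0 = e0" "e1 \<in> A" "e0 \<in> A"
    using unit[OF up(1)] unit[OF up(2)] by auto
qed

lemma cell_idem_central: "central_idem (cell_idem l)"
  unfolding central_idem_def cell_idem_def
proof (intro conjI ballI)
  show "e1 - e0 \<in> A" by (rule A_diff[OF e10(5,6)])
  show "(e1 - e0) \<odot> (e1 - e0) = e1 - e0"
    by (simp only: mul_diff_left mul_diff_right e10 diff_self diff_zero)
  show "(e1 - e0) \<odot> x = x \<odot> (e1 - e0)" if "x \<in> A" for x
    by (simp only: mul_diff_left mul_diff_right unit_central[OF up(1) that] unit_central[OF up(2) that])
qed

lemma r_cell_idem:
  assumes "t \<in> T" "q \<in> T" "lab t = lab q"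
  shows "r t q (cell_idem l) = (if lab t = l \<and> t = q then 1 else 0)"
  using assms upper_set_above(3)[OF l] e10
  by (auto simp: cell_idem_def r_diff r_unit up)

text \<open>A central element acts on a cell module by a scalar, as in Schur's lemma. A central
  idempotent below \<open>cell_idem l\<close> is therefore \<open>\<kappa>\<close> times it, and
  idempotence leaves \<open>\<kappa> = 0\<close> or \<open>\<kappa> = 1\<close>.\<close>

lemma cell_idem_primitive: "primitive_idem (cell_idem l)"
proof -
  let ?E = "cell_idem l"
  have E: "?E \<in> A" "?E \<odot> ?E = ?E" using cell_idem_central by (auto simp: central_idem_def)
  obtain t where t: "t \<in> T" "lab t = l" using l by auto
  have "r t t 0 = 0" using r_smul[of t t 0 0] t by simp
  then have "?E \<noteq> 0" using r_cell_idem[of t t] t by auto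
  moreover have "f = 0 \<or> f = ?E" if f: "central_idem f" "?E \<odot> f = f" for f
  proof -
    have fA: "f \<in> A" and ff: "f \<odot> f = f" and fc: "\<And>x. x \<in> A \<Longrightarrow> f \<odot> x = x \<odot> f"
      using f by (auto simp: central_idem_def)
    \<comment> \<open>Both sides are the \<open>(p, q)\<close> coordinate of
      \<open>m (u, v) \<odot> f\<close>; the right side moves \<open>f\<close> to the left by
      centrality and reads the product through the involution. Comparing them forces the matrix of
      \<open>f\<close> to be scalar.\<close>
    have r_f: "(if p = u then r v q f else 0) = (if q = v then r u p (star f) else 0)"
      if "u \<in> T" "v \<in> T" "p \<in> T" "q \<in> T" "lab u = l" "lab v = l" "lab p = l" "lab q = l" for u v p q
    proof -
      have "(if p = u then r v q f else 0) = co (m (u, v) \<odot> f) (p, q)"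
        using that fA gt_irrefl[OF l] by (simp add: cell_mul)
      also have "\<dots> = co (star (star (f \<odot> m (u, v)))) (p, q)"
        using that fA by (simp add: fc m_in star_star A_mul)
      also have "\<dots> = co (m (v, u) \<odot> star f) (q, p)"
        using that fA by (subst co_star) (simp_all add: A_star A_mul m_in star_mul star_m)
      also have "\<dots> = (if q = v then r u p (star f) else 0)"
        using that fA gt_irrefl[OF l] by (simp add: cell_mul A_star)
      finally show ?thesis .
    qed
    define \<kappa> where "\<kappa> = r t t f"
    have rf: "r v q f = (if v = q then \<kappa> else 0)"
      if "v \<in> T" "q \<in> T" "lab v = l" "lab q = l" for v q
      using r_f[of t v t q] r_f[of t t t t] that t by (auto simp: \<kappa>_def split: if_splits)
    \<comment> \<open>This \<open>g\<close> acts as zero on the cell module of \<open>l\<close> but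
      stays in the block cut out by \<open>?E\<close>. So it lies in the ideal of
      \<open>above l\<close>, whose identity both fixes and kills it.\<close>
    define g where "g = f - smul \<kappa> ?E"
    have g: "g \<in> A" using fA E by (simp add: g_def A_diff A_smul)
    have rg: "r v q g = 0" if "v \<in> T" "q \<in> T" "lab v = l" "lab q = l" for v q
      using that fA E by (auto simp: g_def r_diff r_smul A_smul rf r_cell_idem)
    have Eg: "?E \<odot> g = g" using E f(2) by (simp add: g_def mul_diff_right mul_smul_right)
    have e1g: "e1 \<odot> g = g" and e0g: "e0 \<odot> g = 0"
    proof -
      have "e1 \<odot> ?E = ?E" "e0 \<odot> ?E = 0" using e10 by (simp_all add: cell_idem_def mul_diff_right)
      moreover have "e1 \<odot> (?E \<odot> g) = (e1 \<odot> ?E) \<odot> g" "e0 \<odot> (?E \<odot> g) = (e0 \<odot> ?E) \<odot> g"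
        using e10 E g by (simp_all add: mul_assoc)
      ultimately show "e1 \<odot> g = g" "e0 \<odot> g = 0" using Eg by simp_all
    qed
    have g1: "g \<in> ideal (insert l (above l))"
      using ideal_mul_right[OF up(2) unit(1)[OF up(2)] g] e1g by simp
    have "co (e1 \<odot> g) (p, q) = 0" if "p \<in> T" "q \<in> T" "lab p = l" "lab q = l" for p q
      using that rg upper_set_above(3)[OF l]
      by (subst co_mul_minimal[where \<Gamma> = "insert l (above l)" and l = l])
        (auto simp: up unit(1)[OF up(2)] g)
    then have "g \<in> ideal (above l)"
      using g1 unfolding e1g by (auto simp: ideal_def index_def)
    then have "g = 0" using unit(3)[OF up(1), of g] e0g by simp
    then have f_eq: "f = smul \<kappa> ?E" by (simp add: g_def)
    then have "smul (\<kappa> * \<kappa>) ?E = smul \<kappa> ?E"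
      using ff E by (simp add: mul_smul_left mul_smul_right)
    then have "\<kappa> * \<kappa> = \<kappa>" using \<open>?E \<noteq> 0\<close> vs.scale_right_imp_eq by blast
    then have "\<kappa> = 0 \<or> \<kappa> = 1" by simp
    then show ?thesis using f_eq by auto
  qed
  ultimately show ?thesis using cell_idem_central by (auto simp: primitive_idem_def)
qed

text \<open>The product of the two idempotents acts as the identity on the cell module of
  \<open>l\<close>, so it is a nonzero central idempotent below both and equals both.\<close>

lemma primitive_idem_unique:
  assumes e: "primitive_idem e" "primitive_idem e'"
    and id: "\<And>t q. t \<in> T \<Longrightarrow> q \<in> T \<Longrightarrow> lab t = l \<Longrightarrow> lab q = l \<Longrightarrow> r t q e = (if t = q then 1 else 0)"
      "\<And>t q. t \<in> T \<Longrightarrow> q \<in> T \<Longrightarrow> lab t = l \<Longrightarrow> lab q = l \<Longrightarrow> r t q e' = (if t = q then 1 else 0)"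
  shows "e = e'"
proof -
  obtain t where t: "t \<in> T" "lab t = l" using l by auto
  have A: "e \<in> A" "e' \<in> A" "e \<odot> e = e" "e' \<odot> e' = e'"
    and c: "\<And>x. x \<in> A \<Longrightarrow> e \<odot> x = x \<odot> e" "\<And>x. x \<in> A \<Longrightarrow> e' \<odot> x = x \<odot> e'"
    using e by (auto simp: primitive_idem_def central_idem_def)
  let ?f = "e \<odot> e'"
  have 1: "e \<odot> ?f = ?f" using A by (simp flip: mul_assoc)
  have 2: "e' \<odot> ?f = ?f"
  proof -
    have "e' \<odot> ?f = e' \<odot> (e' \<odot> e)" by (simp only: c(1)[OF A(2)])
    also have "\<dots> = ?f" using A c(1)[OF A(2)] by (simp flip: mul_assoc)
    finally show ?thesis .
  qed
  have ff: "?f \<odot> ?f = ?f" using A 1 2 by (simp add: mul_assoc A_mul)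
  have fx: "?f \<odot> x = x \<odot> ?f" if x: "x \<in> A" for x
  proof -
    have "?f \<odot> x = e \<odot> (x \<odot> e')" using A x c(2)[OF x] by (simp add: mul_assoc)
    also have "\<dots> = x \<odot> e \<odot> e'" using A x c(1)[OF x] by (simp flip: mul_assoc)
    finally show ?thesis using A x by (simp add: mul_assoc)
  qed
  have f: "central_idem ?f"
    unfolding central_idem_def by (intro conjI ballI A_mul[OF A(1,2)] ff fx)
  have "r t t ?f = (\<Sum>w | w \<in> T \<and> lab w = l. (if w = t then 1 else 0))"
    unfolding r_mul[OF t(1) t(1) refl A(1,2)] t(2) using t id by (intro sum.cong refl) auto
  also have "\<dots> = 1" using t finite_T by simp
  finally have 3: "r t t ?f = 1" .
  have "r t t 0 = 0" using r_smul[of t t 0 0] t by simp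
  then have "?f \<noteq> 0" using 3 by (intro notI) (simp only: zero_neq_one)
  then have "?f = e" "?f = e'"
    using e f 1 2 unfolding primitive_idem_def by metis+
  then show ?thesis by simp
qed

end

end


section \<open>The partition algebra\<close>

text \<open>Pairing a product with a function on diagrams eliminates the sum over the resulting
  diagram. Associativity, the trace of squares and the inclusions are computed in this form.\<close>

lemma pa_mult_sum:
  fixes x y :: "diagram \<Rightarrow> 'a::comm_ring_1"
  shows "(\<Sum>e\<in>diagrams k. pa_mult \<delta> k x y e * h e) =
    (\<Sum>d\<in>diagrams k. \<Sum>d'\<in>diagrams k. x d * y d' * \<delta> ^ loops d d' * h (compose d d'))"
proof -
  let ?D = "diagrams k"
  have "(\<Sum>e\<in>?D. pa_mult \<delta> k x y e * h e) =
      (\<Sum>e\<in>?D. \<Sum>d\<in>?D. \<Sum>d'\<in>?D. x d * y d' * (if compose d d' = e then \<delta> ^ loops d d' else 0) * h e)"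
    by (simp only: pa_mult_def sum_distrib_right)
  also have "\<dots> = (\<Sum>d\<in>?D. \<Sum>e\<in>?D. \<Sum>d'\<in>?D. x d * y d' * (if compose d d' = e then \<delta> ^ loops d d' else 0) * h e)"
    by (rule sum.swap)
  also have "\<dots> = (\<Sum>d\<in>?D. \<Sum>d'\<in>?D. \<Sum>e\<in>?D. x d * y d' * (if compose d d' = e then \<delta> ^ loops d d' else 0) * h e)"
    by (intro sum.cong refl sum.swap)
  also have "\<dots> = (\<Sum>d\<in>?D. \<Sum>d'\<in>?D. x d * y d' * \<delta> ^ loops d d' * h (compose d d'))"
  proof (intro sum.cong refl)
    fix d d' assume "d \<in> ?D" "d' \<in> ?D"
    then have "compose d d' \<in> ?D" by (rule compose_in_diagrams)
    have "(\<Sum>e\<in>?D. x d * y d' * (if compose d d' = e then \<delta> ^ loops d d' else 0) * h e)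
        = (\<Sum>e\<in>?D. if compose d d' = e then x d * y d' * \<delta> ^ loops d d' * h e else 0)"
      by (intro sum.cong refl) simp
    also have "\<dots> = x d * y d' * \<delta> ^ loops d d' * h (compose d d')"
      using \<open>compose d d' \<in> ?D\<close> finite_diagrams by (simp only: sum.delta' if_True)
    finally show "(\<Sum>e\<in>?D. x d * y d' * (if compose d d' = e then \<delta> ^ loops d d' else 0) * h e)
        = x d * y d' * \<delta> ^ loops d d' * h (compose d d')" .
  qed
  finally show ?thesis .
qed

lemma pa_mult_in: "pa_mult \<delta> k x y \<in> PA k"
proof -
  have "pa_mult \<delta> k x y e = 0" if "e \<notin> diagrams k" for e
    unfolding pa_mult_def using that compose_in_diagrams by (intro sum.neutral ballI) auto
  then show ?thesis by (simp add: free_mod_def)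
qed

lemma pa_mult_add_left: "pa_mult \<delta> k (x + y) w = pa_mult \<delta> k x w + pa_mult \<delta> k y w"
  by (rule ext) (simp add: pa_mult_def distrib_right sum.distrib)

lemma pa_mult_add_right: "pa_mult \<delta> k w (x + y) = pa_mult \<delta> k w x + pa_mult \<delta> k w y"
  by (rule ext) (simp add: pa_mult_def distrib_right distrib_left sum.distrib)

lemma pa_mult_smul_left: "pa_mult \<delta> k (smul c x) w = smul c (pa_mult \<delta> k x w)"
  by (rule ext) (simp add: pa_mult_def smul_def sum_distrib_left mult.assoc)

lemma pa_mult_smul_right: "pa_mult \<delta> k w (smul c x) = smul c (pa_mult \<delta> k w x)"
  by (rule ext) (simp add: pa_mult_def smul_def sum_distrib_left mult.assoc mult.left_commute)

lemma pa_mult_assoc: "pa_mult \<delta> k (pa_mult \<delta> k x y) w = pa_mult \<delta> k x (pa_mult \<delta> k y w)"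
proof
  fix e
  let ?D = "diagrams k" and ?I = "\<lambda>c d. if compose c d = e then \<delta> ^ loops c d else 0"
  have "pa_mult \<delta> k (pa_mult \<delta> k x y) w e =
      (\<Sum>c\<in>?D. pa_mult \<delta> k x y c * (\<Sum>d''\<in>?D. w d'' * ?I c d''))"
    by (subst pa_mult_def) (simp only: sum_distrib_left mult.assoc)
  also have "\<dots> = (\<Sum>d\<in>?D. \<Sum>d'\<in>?D. \<Sum>d''\<in>?D.
      x d * y d' * \<delta> ^ loops d d' * (w d'' * ?I (compose d d') d''))"
    by (simp only: pa_mult_sum) (simp only: sum_distrib_left)
  also have "\<dots> = (\<Sum>d\<in>?D. \<Sum>d'\<in>?D. \<Sum>d''\<in>?D.
      x d * (y d' * w d'' * \<delta> ^ loops d' d'' * ?I d (compose d' d'')))"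
  proof (intro sum.cong refl)
    fix d d' d'' assume d: "d \<in> ?D" "d' \<in> ?D" "d'' \<in> ?D"
    have "\<delta> ^ loops d d' * ?I (compose d d') d'' = \<delta> ^ loops d' d'' * ?I d (compose d' d'')"
      using compose_assoc[OF d] by (auto simp flip: power_add)
    then have "x d * y d' * w d'' * (\<delta> ^ loops d d' * ?I (compose d d') d'')
        = x d * y d' * w d'' * (\<delta> ^ loops d' d'' * ?I d (compose d' d''))"
      by (simp only:)
    then show "x d * y d' * \<delta> ^ loops d d' * (w d'' * ?I (compose d d') d'')
        = x d * (y d' * w d'' * \<delta> ^ loops d' d'' * ?I d (compose d' d''))"
      by (simp only: mult.assoc mult.left_commute mult.commute)
  qed
  also have "\<dots> = (\<Sum>d\<in>?D. x d * (\<Sum>c\<in>?D. pa_mult \<delta> k y w c * ?I d c))"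
    by (simp only: pa_mult_sum) (simp only: sum_distrib_left)
  also have "\<dots> = pa_mult \<delta> k x (pa_mult \<delta> k y w) e"
    by (subst (2) pa_mult_def) (simp only: sum_distrib_left mult.assoc)
  finally show "pa_mult \<delta> k (pa_mult \<delta> k x y) w e = pa_mult \<delta> k x (pa_mult \<delta> k y w) e" .
qed

lemma pa_one_eq: "pa_one k = unit_vec (id_diagram k)"
proof -
  have "{{North j, South j} | j. 1 \<le> j \<and> j \<le> half k} = id_diagram k"
    unfolding id_diagram_def by auto
  then show ?thesis by (simp only: pa_one_def)
qed

lemma unit_vec_in: "d \<in> X \<Longrightarrow> unit_vec d \<in> free_mod X"
  by (auto simp: unit_vec_def free_mod_def)

lemma pa_star_apply: "pa_star x d = x (flip_diagram d)"
  by (simp add: pa_star_def flip_diagram_def)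

lemma pa_star_in: "x \<in> PA k \<Longrightarrow> pa_star x \<in> PA k"
  using flip_in_diagrams flip_diagram_flip_diagram by (fastforce simp: free_mod_def pa_star_apply)

lemma sum_flip: "(\<Sum>d\<in>diagrams k. h (flip_diagram d)) = (\<Sum>d\<in>diagrams k. h d)"
  by (rule sum.reindex_bij_witness[of _ flip_diagram flip_diagram]) (auto simp: flip_in_diagrams)

lemma pa_star_mult: "pa_star (pa_mult \<delta> k x y) = pa_mult \<delta> k (pa_star y) (pa_star x)"
proof
  fix e
  let ?D = "diagrams k"
  have "pa_star (pa_mult \<delta> k x y) e = (\<Sum>d\<in>?D. \<Sum>d'\<in>?D.
      x d * y d' * (if compose d d' = flip_diagram e then \<delta> ^ loops d d' else 0))"
    by (simp only: pa_star_apply pa_mult_def)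
  also have "\<dots> = (\<Sum>d\<in>?D. \<Sum>d'\<in>?D. x d * y d' *
      (if compose (flip_diagram d') (flip_diagram d) = e then \<delta> ^ loops (flip_diagram d') (flip_diagram d) else 0))"
  proof (intro sum.cong refl)
    fix d d' assume "d \<in> ?D" "d' \<in> ?D"
    note c = compose_flip[OF this]
    have "compose d d' = flip_diagram e \<longleftrightarrow> compose (flip_diagram d') (flip_diagram d) = e"
      using c flip_diagram_flip_diagram by metis
    then show "x d * y d' * (if compose d d' = flip_diagram e then \<delta> ^ loops d d' else 0) = x d * y d' *
      (if compose (flip_diagram d') (flip_diagram d) = e then \<delta> ^ loops (flip_diagram d') (flip_diagram d) else 0)"
      using c by (simp only:)
  qed
  also have "\<dots> = (\<Sum>d\<in>?D. \<Sum>d'\<in>?D. x (flip_diagram d) * y (flip_diagram d') *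
      (if compose d' d = e then \<delta> ^ loops d' d else 0))"
    by (subst (1 2) sum_flip[symmetric]) (simp only: flip_diagram_flip_diagram)
  also have "\<dots> = (\<Sum>d'\<in>?D. \<Sum>d\<in>?D. pa_star y d' * pa_star x d *
      (if compose d' d = e then \<delta> ^ loops d' d else 0))"
    by (subst sum.swap) (simp only: pa_star_apply mult.commute)
  also have "\<dots> = pa_mult \<delta> k (pa_star y) (pa_star x) e"
    by (simp only: pa_mult_def)
  finally show "pa_star (pa_mult \<delta> k x y) e = pa_mult \<delta> k (pa_star y) (pa_star x) e" .
qed

text \<open>Serves both for evaluating polynomials at an integer and for the embedding
  \<open>to_fract\<close>.\<close>

lemma pa_mult_hom:
  fixes \<phi> :: "'a::comm_ring_1 \<Rightarrow> 'b::comm_ring_1"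
  assumes "\<phi> 0 = 0" "\<phi> 1 = 1" "\<And>a b. \<phi> (a + b) = \<phi> a + \<phi> b" "\<And>a b. \<phi> (a * b) = \<phi> a * \<phi> b"
  shows "\<phi> (pa_mult \<delta> k x y e) = pa_mult (\<phi> \<delta>) k (\<lambda>d. \<phi> (x d)) (\<lambda>d. \<phi> (y d)) e"
proof -
  have s: "\<phi> (sum f A) = (\<Sum>a\<in>A. \<phi> (f a))" for f :: "diagram \<Rightarrow> 'a" and A
    using assms by (induction A rule: infinite_finite_induct) auto
  have p: "\<phi> (\<delta> ^ j) = \<phi> \<delta> ^ j" for j
    using assms by (induction j) auto
  show ?thesis unfolding pa_mult_def s using assms by (intro sum.cong refl) (simp add: p)
qed

subsection \<open>Anisotropy of the involution\<close>

text \<open>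
  At \<open>z = N\<close> the matrix \<open>S\<close> of \<open>x\<close> in the representation on labellings is an integer matrix, and \<open>x\<^sup>* x\<close> is
  mapped to the product of the transpose of \<open>S\<close> with \<open>S\<close>.
\<close>

lemma sum_squares_labellings:
  fixes c :: "diagram \<Rightarrow> int" and k N :: nat
  defines "S \<equiv> \<lambda>f h. \<Sum>d\<in>diagrams k. c d * of_bool (block_const d (glue f h))"
  assumes h: "h \<in> {1..half k} \<rightarrow> {..<N}"
  shows "(\<Sum>f\<in>{1..half k} \<rightarrow>\<^sub>E {..<N}. S f h * S f h) =
    (\<Sum>e\<in>diagrams k. pa_mult (int N) k (pa_star c) c e * of_bool (block_const e (glue h h)))"
proof -
  let ?D = "diagrams k" and ?G = "{1..half k} \<rightarrow>\<^sub>E {..<N}"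
  let ?M = "\<lambda>d f g. of_bool (block_const d (glue f g)) :: int"
  have count: "(\<Sum>f\<in>?G. ?M d h f * ?M d' f h) = int N ^ loops d d' * ?M (compose d d') h h"
    if "d \<in> ?D" "d' \<in> ?D" for d d'
    using arg_cong[OF count_labellings_diagrams[OF that h h], of int]
    by (simp only: of_nat_sum of_nat_mult of_nat_of_bool of_nat_power)
  have "(\<Sum>f\<in>?G. S f h * S f h) = (\<Sum>f\<in>?G. \<Sum>d\<in>?D. \<Sum>d'\<in>?D. c d * ?M d f h * (c d' * ?M d' f h))"
    by (simp only: S_def sum_product)
  also have "\<dots> = (\<Sum>d\<in>?D. \<Sum>f\<in>?G. \<Sum>d'\<in>?D. c d * ?M d f h * (c d' * ?M d' f h))"
    by (rule sum.swap)
  also have "\<dots> = (\<Sum>d\<in>?D. \<Sum>d'\<in>?D. \<Sum>f\<in>?G. c d * ?M d f h * (c d' * ?M d' f h))"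
    by (intro sum.cong refl sum.swap)
  also have "\<dots> = (\<Sum>d\<in>?D. \<Sum>d'\<in>?D. \<Sum>f\<in>?G. c (flip_diagram d) * ?M (flip_diagram d) f h * (c d' * ?M d' f h))"
    by (rule sum_flip[symmetric])
  also have "\<dots> = (\<Sum>d\<in>?D. \<Sum>d'\<in>?D. c (flip_diagram d) * c d' * (\<Sum>f\<in>?G. ?M d h f * ?M d' f h))"
    by (simp only: block_const_flip sum_distrib_left mult.assoc mult.left_commute)
  also have "\<dots> = (\<Sum>d\<in>?D. \<Sum>d'\<in>?D. c (flip_diagram d) * c d' * (int N ^ loops d d' * ?M (compose d d') h h))"
    by (intro sum.cong refl arg_cong[where f = "\<lambda>a. _ * a"] count)
  also have "\<dots> = (\<Sum>e\<in>?D. pa_mult (int N) k (pa_star c) c e * ?M e h h)"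
    by (simp only: pa_mult_sum pa_star_apply mult.assoc)
  finally show ?thesis .
qed

text \<open>Integer squares with sum zero vanish one by one, so the whole matrix is zero. The bound
  on \<open>N\<close> provides enough labels to recover the coefficients from the matrix.\<close>

lemma pa_anisotropic_eval:
  fixes c :: "diagram \<Rightarrow> int"
  assumes zero: "pa_mult (int N) k (pa_star c) c = 0" and N: "card (verts (half k)) \<le> N"
    and "d \<in> diagrams k"
  shows "c d = 0"
proof (rule block_const_independent[OF finite_diagrams diagrams_partition_on finite_verts N _ \<open>d \<in> diagrams k\<close>])
  let ?r = "half k"
  define S where "S f h = (\<Sum>d\<in>diagrams k. c d * of_bool (block_const d (glue f h)))" for f h :: "nat \<Rightarrow> nat"
  fix F :: "vertex \<Rightarrow> nat" assume F: "F \<in> verts ?r \<rightarrow> {..<N}"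
  define f where "f = restrict (F \<circ> North) {1..?r}"
  have f: "f \<in> {1..?r} \<rightarrow>\<^sub>E {..<N}" using F by (auto simp: f_def verts_def)
  have h: "F \<circ> South \<in> {1..?r} \<rightarrow> {..<N}" using F by (auto simp: verts_def)
  have "(\<Sum>f\<in>{1..?r} \<rightarrow>\<^sub>E {..<N}. S f (F \<circ> South) * S f (F \<circ> South)) = 0"
    unfolding S_def sum_squares_labellings[OF h] zero by simp
  moreover have "finite ({1..?r} \<rightarrow>\<^sub>E {..<N})" by (intro finite_PiE) auto
  ultimately have "S f (F \<circ> South) * S f (F \<circ> South) = 0"
    using f by (subst (asm) sum_nonneg_eq_0_iff) auto
  then have "S f (F \<circ> South) = 0" by simp
  moreover have "block_const e (glue f (F \<circ> South)) = block_const e F" if "e \<in> diagrams k" for e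
  proof -
    have "glue (F \<circ> North) (F \<circ> South) u = F u" for u by (cases u) auto
    then have "glue (F \<circ> North) (F \<circ> South) = F" by blast
    moreover have "block_const e (glue f (F \<circ> South)) = block_const e (glue (F \<circ> North) (F \<circ> South))"
      by (rule block_const_cong[OF diagrams_partition_on[OF that]]) (auto simp: f_def)
    ultimately show ?thesis by simp
  qed
  ultimately show "(\<Sum>d\<in>diagrams k. c d * of_bool (block_const d F)) = 0"
    by (simp add: S_def cong: sum.cong)
qed

text \<open>Evaluation at each sufficiently large integer gives zero coefficients, and a nonzero
  polynomial has only finitely many roots.\<close>

lemma pa_anisotropic_poly:
  assumes p: "p \<in> PA k" and zero: "pa_mult z k (pa_star p) p = 0"
  shows "p = 0"
proof
  fix d
  show "p d = (0 :: diagram \<Rightarrow> int poly) d"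
  proof (cases "d \<in> diagrams k")
    case True
    have "poly (p d) (int N) = 0" if "card (verts (half k)) \<le> N" for N
    proof (rule pa_anisotropic_eval[OF _ that True])
      have "pa_mult (int N) k (pa_star (\<lambda>d. poly (p d) (int N))) (\<lambda>d. poly (p d) (int N)) e
          = poly (pa_mult z k (pa_star p) p e) (int N)" for e
        by (subst pa_mult_hom) (auto simp: z_def pa_star_apply[abs_def])
      then show "pa_mult (int N) k (pa_star (\<lambda>d. poly (p d) (int N))) (\<lambda>d. poly (p d) (int N)) = 0"
        by (intro ext) (simp add: zero)
    qed
    then have "int ` {card (verts (half k))..} \<subseteq> {a. poly (p d) a = 0}" by auto
    moreover have "infinite (int ` {card (verts (half k))..})"
      by (simp add: finite_image_iff infinite_Ici)
    ultimately show ?thesis using poly_roots_finite[of "p d"] finite_subset by auto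
  next
    case False
    then show ?thesis using p by (simp add: free_mod_def)
  qed
qed

lemma clear_denominators:
  fixes c :: "'i \<Rightarrow> int poly fract"
  assumes "finite I"
  shows "\<exists>q b. q \<noteq> 0 \<and> (\<forall>i\<in>I. to_fract q * c i = to_fract (b i))"
  using assms
proof (induction I)
  case empty
  then show ?case by (intro exI[of _ 1]) simp
next
  case (insert i I)
  then obtain q b where q: "q \<noteq> 0" "\<And>j. j \<in> I \<Longrightarrow> to_fract q * c j = to_fract (b j)" by blast
  obtain a b' where ab: "c i = Fract a b'" "b' \<noteq> 0" by (cases "c i" rule: Fract_cases) auto
  then have ci: "to_fract b' * c i = to_fract a" by (simp add: Fract_conv_to_fract)
  have "to_fract (q * b') * c j = to_fract ((b(i := 0)) j * b' + (if j = i then q * a else 0))"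
    if "j \<in> insert i I" for j
  proof (cases "j = i")
    case True
    then show ?thesis using ci by (simp add: mult.assoc)
  next
    case False
    then have "to_fract q * c j = to_fract (b j)" using that q(2) by simp
    then show ?thesis using False by (simp add: mult_ac flip: mult.assoc)
  qed
  then show ?case using q(1) ab(2)
    by (intro exI[of _ "q * b'"] exI[of _ "\<lambda>j. (b(i := 0)) j * b' + (if j = i then q * a else 0)"]) auto
qed

lemma pa_anisotropic:
  assumes x: "x \<in> PA k" and zero: "multF k (pa_star x) x = 0"
  shows "x = 0"
proof -
  obtain q b where q: "q \<noteq> 0" and b: "\<And>d. d \<in> diagrams k \<Longrightarrow> to_fract q * x d = to_fract (b d)"
    using clear_denominators[OF finite_diagrams, of k x] by blast
  define p where "p d = (if d \<in> diagrams k then b d else 0)" for d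
  have px: "to_fract (p d) = smul (to_fract q) x d" for d
    using b x by (auto simp: p_def smul_def free_mod_def)
  have "multF k (pa_star (smul (to_fract q) x)) (smul (to_fract q) x) e = 0" for e
  proof -
    have "pa_star (smul (to_fract q) x) = smul (to_fract q) (pa_star x)"
      by (rule ext) (simp add: pa_star_apply smul_def)
    then show ?thesis by (simp only: pa_mult_smul_left pa_mult_smul_right zero) (simp add: smul_def)
  qed
  then have "to_fract (pa_mult z k (pa_star p) p e) = 0" for e
    by (subst pa_mult_hom) (auto simp: pa_star_apply[abs_def] px)
  then have "pa_mult z k (pa_star p) p = 0"
    by (intro ext) simp
  moreover have "p \<in> PA k" by (simp add: p_def free_mod_def)
  ultimately have "p = 0" using pa_anisotropic_poly by blast
  then have "to_fract q * x d = 0" for d using px[of d] by (simp add: smul_def)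
  then show ?thesis using q by (intro ext) simp
qed


section \<open>Partitions and paths\<close>

lemma sum_list_ge_length: "0 \<notin> set xs \<Longrightarrow> length xs \<le> sum_list (xs :: nat list)"
  by (induction xs) auto

lemma finite_Y: "finite (Y k)"
proof (rule finite_subset)
  show "Y k \<subseteq> {xs. set xs \<subseteq> {..k} \<and> length xs \<le> k}"
  proof
    fix xs assume "xs \<in> Y k"
    then have xs: "0 \<notin> set xs" "sum_list xs \<le> k" by (auto simp: Y_def is_partn_def)
    then show "xs \<in> {xs. set xs \<subseteq> {..k} \<and> length xs \<le> k}"
      using sum_list_ge_length[of xs] member_le_sum_list[of _ xs] by fastforce
  qed
  show "finite {xs :: nat list. set xs \<subseteq> {..k} \<and> length xs \<le> k}"
    by (rule finite_lists_length_le) simp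
qed

lemma Y_mono: "i \<le> k \<Longrightarrow> Y i \<subseteq> Y k"
  unfolding Y_def using div_le_mono[of i k 2] by auto

lemma Y_partn: "\<alpha> \<in> Y k \<Longrightarrow> is_partn \<alpha>"
  by (simp add: Y_def)

text \<open>Up to its length a partition has nonzero parts only, so the function \<open>part\<close>
  also determines the length.\<close>

lemma partn_eqI:
  assumes a: "is_partn \<alpha>" and b: "is_partn \<beta>" and eq: "\<And>i. 1 \<le> i \<Longrightarrow> part \<alpha> i = part \<beta> i"
  shows "\<alpha> = \<beta>"
proof -
  have pos: "part \<gamma> i \<noteq> 0 \<longleftrightarrow> i \<le> length \<gamma>" if "is_partn \<gamma>" "1 \<le> i" for \<gamma> i
  proof (cases "i \<le> length \<gamma>")
    case True
    then have "\<gamma> ! (i - 1) \<in> set \<gamma>" using that(2) by (intro nth_mem) auto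
    then have "\<gamma> ! (i - 1) \<noteq> 0" using that(1) unfolding is_partn_def by metis
    then show ?thesis using True that(2) by (simp add: part_def)
  next
    case False
    then show ?thesis by (simp add: part_def)
  qed
  have "i \<le> length \<alpha> \<longleftrightarrow> i \<le> length \<beta>" if "1 \<le> i" for i
    using pos[OF a that] pos[OF b that] eq[OF that] by simp
  then have len: "length \<alpha> = length \<beta>"
    by (metis le_antisym le_refl linorder_not_less not_less_eq_eq One_nat_def le0 Suc_leI)
  then show ?thesis
  proof (rule nth_equalityI)
    show "\<alpha> ! i = \<beta> ! i" if "i < length \<alpha>" for i
      using eq[of "Suc i"] that len by (simp add: part_def)
  qed
qed

lemma dominates_antisym:
  assumes "is_partn \<alpha>" "is_partn \<beta>" "dominates \<alpha> \<beta>" "dominates \<beta> \<alpha>"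
  shows "\<alpha> = \<beta>"
proof (rule partn_eqI[OF assms(1,2)])
  have S: "(\<Sum>j=1..i. part \<alpha> j) = (\<Sum>j=1..i. part \<beta> j)" for i
    using assms(3,4) unfolding dominates_def by (meson le_antisym)
  fix i :: nat assume "1 \<le> i"
  then obtain i' where "i = Suc i'" by (cases i) auto
  then show "part \<alpha> i = part \<beta> i" using S[of i] S[of i'] by simp
qed

lemma order_gt_irrefl: "\<not> \<alpha> \<rhd> \<alpha>"
  by (simp add: order_gt_def)

lemma order_gt_trans:
  assumes "is_partn \<alpha>" "is_partn \<beta>" "\<alpha> \<rhd> \<beta>" "\<beta> \<rhd> \<gamma>"
  shows "\<alpha> \<rhd> \<gamma>"
proof -
  have "dominates \<alpha> \<gamma>" if "dominates \<alpha> \<beta>" "dominates \<beta> \<gamma>"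
    using that unfolding dominates_def by (meson le_trans)
  moreover have "\<alpha> \<noteq> \<gamma>" if "dominates \<alpha> \<beta>" "dominates \<beta> \<gamma>" "\<alpha> \<noteq> \<beta>"
    using that dominates_antisym[OF assms(1,2)] by auto
  ultimately show ?thesis
    using assms(3,4) unfolding order_gt_def by auto
qed

lemma order_gt_asym: "is_partn \<alpha> \<Longrightarrow> is_partn \<beta> \<Longrightarrow> \<alpha> \<rhd> \<beta> \<Longrightarrow> \<not> \<beta> \<rhd> \<alpha>"
  using order_gt_trans order_gt_irrefl by blast

lemma Std_in_Y:
  assumes "t \<in> Std k \<alpha>" "i \<le> k"
  shows "t ! i \<in> Y i"
proof (cases i)
  case 0
  then show ?thesis using assms by (simp add: Std_def Y_def is_partn_def)
next
  case (Suc i')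
  then have "edge i' (t ! i') (t ! Suc i')" using assms by (auto simp: Std_def)
  then show ?thesis using Suc by (simp add: edge_def)
qed

lemma Std_end: "t \<in> Std k \<alpha> \<Longrightarrow> t ! k = \<alpha>"
  by (simp add: Std_def)

lemma Std_label_in_Y: "t \<in> Std k \<alpha> \<Longrightarrow> \<alpha> \<in> Y k"
  using Std_in_Y[of t k \<alpha> k] Std_end by auto

lemma Std_all_iff: "t \<in> Std_all k \<longleftrightarrow> t \<in> Std k (t ! k)"
  using Std_label_in_Y Std_end by (auto simp: Std_all_def)

lemma Std_iff: "t \<in> Std k \<alpha> \<longleftrightarrow> t \<in> Std_all k \<and> t ! k = \<alpha>"
  using Std_all_iff Std_end by auto

lemma finite_Std_all: "finite (Std_all k)"
proof (rule finite_subset)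
  show "Std_all k \<subseteq> {t. set t \<subseteq> Y k \<and> length t \<le> Suc k}"
  proof
    fix t assume "t \<in> Std_all k"
    then obtain \<alpha> where t: "t \<in> Std k \<alpha>" by (auto simp: Std_all_def)
    then have len: "length t = Suc k" by (simp add: Std_def)
    have "t ! i \<in> Y k" if "i < length t" for i
      using Std_in_Y[OF t, of i] Y_mono[of i k] that len by auto
    then have "set t \<subseteq> Y k" by (auto simp: in_set_conv_nth)
    then show "t \<in> {t. set t \<subseteq> Y k \<and> length t \<le> Suc k}" using len by simp
  qed
  show "finite {t. set t \<subseteq> Y k \<and> length t \<le> Suc k}"
    by (rule finite_lists_length_le[OF finite_Y])
qed

lemma finite_Std: "finite (Std k \<alpha>)"
  by (rule finite_subset[OF _ finite_Std_all]) (auto simp: Std_iff)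

lemma take_Std:
  assumes "t \<in> Std (Suc k) \<alpha>"
  shows "take (Suc k) t \<in> Std k (t ! k)" "edge k (t ! k) \<alpha>" "take (Suc k) t @ [\<alpha>] = t"
proof -
  show "take (Suc k) t \<in> Std k (t ! k)" "edge k (t ! k) \<alpha>"
    using assms by (auto simp: Std_def)
  have "length t = Suc (Suc k)" "t ! Suc k = \<alpha>" using assms by (auto simp: Std_def)
  then show "take (Suc k) t @ [\<alpha>] = t"
    using take_Suc_conv_app_nth[of "Suc k" t] by simp
qed

lemma append_Std:
  assumes "u \<in> Std k \<rho>" "edge k \<rho> \<alpha>"
  shows "u @ [\<alpha>] \<in> Std (Suc k) \<alpha>" "(u @ [\<alpha>]) ! k = \<rho>" "take (Suc k) (u @ [\<alpha>]) = u"
  using assms by (auto simp: Std_def nth_append less_Suc_eq)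


section \<open>The cell modules over the field of fractions\<close>

text \<open>The matrix of \<open>a\<close> on a cell module. Only the values of \<open>r\<close> at
  single diagrams enter, so linearity in \<open>a\<close> is built in.\<close>

definition cell_coeff ::
  "structure_constants \<Rightarrow> nat \<Rightarrow> path \<Rightarrow> path \<Rightarrow> (diagram \<Rightarrow> int poly fract) \<Rightarrow> int poly fract" where
  "cell_coeff r k t u a = (\<Sum>d\<in>diagrams k. a d * to_fract (r t u (unit_vec d)))"

lemma cell_actF_apply:
  "cell_actF r k \<alpha> v a u = (if u \<in> Std k \<alpha> then \<Sum>t\<in>Std k \<alpha>. v t * cell_coeff r k t u a else 0)"
  by (simp add: cell_actF_def cell_coeff_def)

lemma cell_index_iff: "(s, t) \<in> cell_index k \<longleftrightarrow> s \<in> Std_all k \<and> t \<in> Std_all k \<and> s ! k = t ! k"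
  unfolding cell_index_def using Std_label_in_Y by (auto simp: Std_iff)

lemma finite_cell_index: "finite (cell_index k)"
  by (rule finite_subset[of _ "Std_all k \<times> Std_all k"]) (auto simp: cell_index_iff finite_Std_all)

lemma free_mod_expand:
  assumes "finite X" "x \<in> free_mod X"
  shows "x = (\<Sum>d\<in>X. smul (x d) (unit_vec d))"
  using assms by (auto simp: fun_eq_iff sum_fun_apply smul_def unit_vec_def free_mod_def
      if_distrib[of "\<lambda>a. _ * a"] cong: if_cong)

lemma to_fract_unit_vec: "to_fract (unit_vec d e) = (unit_vec d e :: int poly fract)"
  by (simp add: unit_vec_def)

lemma pa_mult_sum_right: "pa_mult \<delta> k w (sum f I) = (\<Sum>i\<in>I. pa_mult \<delta> k w (f i))"
  using sum_comp_morphism[of "\<lambda>x. pa_mult \<delta> k w x" f I] pa_mult_smul_right[of \<delta> k w 0 0]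
  by (simp add: pa_mult_add_right o_def)

section \<open>Base change of the cellular basis to the field of fractions\<close>

context
  fixes m :: "path \<Rightarrow> path \<Rightarrow> diagram \<Rightarrow> int poly" and r :: structure_constants and k :: nat
  assumes cell: "cellular_basis m r k"
begin

private definition "mF i = (\<lambda>d. to_fract (m (fst i) (snd i) d))"

private lemma m_in_PA: "i \<in> cell_index k \<Longrightarrow> m (fst i) (snd i) \<in> PA k"
proof -
  assume "i \<in> cell_index k"
  then have "m (fst i) (snd i) \<in> module.span smul ((\<lambda>(s, t). m s t) ` cell_index k)"
    by (intro fm.span_base) (auto simp: split_beta)
  then show ?thesis using cell by (simp add: cellular_basis_def)
qed

private lemma mF_sum:
  "(\<Sum>i\<in>I. smul (to_fract (c i)) (mF i)) = (\<lambda>d. to_fract ((\<Sum>i\<in>I. smul (c i) (m (fst i) (snd i))) d))"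
  by (rule ext) (simp add: sum_fun_apply smul_def mF_def)

text \<open>A relation over the fractions becomes a relation over \<open>\<int>[z]\<close> after
  multiplication by a common denominator.\<close>

private lemma mF_independent:
  assumes "(\<Sum>i\<in>cell_index k. smul (c i) (mF i)) = 0" "i \<in> cell_index k"
  shows "c i = 0"
proof -
  obtain q b where q: "q \<noteq> 0" and b: "\<And>i. i \<in> cell_index k \<Longrightarrow> to_fract q * c i = to_fract (b i)"
    using clear_denominators[OF finite_cell_index, of k c] by blast
  have "(\<Sum>i\<in>cell_index k. smul (to_fract (b i)) (mF i))
      = (\<Sum>i\<in>cell_index k. smul (to_fract q) (smul (c i) (mF i)))"
    using b by (intro sum.cong refl) simp
  also have "\<dots> = smul (to_fract q) 0"
    unfolding assms(1)[symmetric] by (rule fm.scale_sum_right[symmetric])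
  finally have "(\<lambda>d. to_fract ((\<Sum>i\<in>cell_index k. smul (b i) (m (fst i) (snd i))) d)) = 0"
    unfolding mF_sum by simp
  then have "(\<Sum>i\<in>cell_index k. smul (b i) ((\<lambda>(s, t). m s t) i)) = 0"
    by (simp add: fun_eq_iff split_beta)
  then have "b i = 0"
    using cell assms(2) finite_cell_index
    by (intro independent_family[of "cell_index k" "\<lambda>(s, t). m s t" b i]) (auto simp: cellular_basis_def)
  then show ?thesis using b[OF assms(2)] q by simp
qed

text \<open>It suffices to expand single diagrams, and these have expansions with coefficients
  already in \<open>\<int>[z]\<close>.\<close>

private lemma mF_span:
  assumes "x \<in> PA k"
  shows "\<exists>c. x = (\<Sum>i\<in>cell_index k. smul (c i) (mF i))"
proof -
  have "\<exists>c. unit_vec d = (\<Sum>i\<in>cell_index k. smul (c i) (mF i))" if "d \<in> diagrams k" for d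
  proof -
    have "unit_vec d \<in> module.span smul ((\<lambda>(s, t). m s t) ` cell_index k)"
      using unit_vec_in[OF that] cell by (simp add: cellular_basis_def)
    then obtain c where "unit_vec d = (\<Sum>i\<in>cell_index k. smul (c i) ((\<lambda>(s, t). m s t) i))"
      using span_image_iff[OF finite_cell_index] by blast
    then have eq: "(\<Sum>i\<in>cell_index k. smul (c i) (m (fst i) (snd i))) = unit_vec d"
      by (simp add: split_beta)
    have "(\<Sum>i\<in>cell_index k. smul (to_fract (c i)) (mF i)) = unit_vec d"
      unfolding mF_sum eq to_fract_unit_vec ..
    then show ?thesis by (intro exI[of _ "\<lambda>i. to_fract (c i)"]) simp
  qed
  then obtain c where c: "\<And>d. d \<in> diagrams k \<Longrightarrow> unit_vec d = (\<Sum>i\<in>cell_index k. smul (c d i) (mF i))"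
    by metis
  have "x = (\<Sum>d\<in>diagrams k. smul (x d) (unit_vec d))"
    by (rule free_mod_expand[OF finite_diagrams assms])
  also have "\<dots> = (\<Sum>d\<in>diagrams k. \<Sum>i\<in>cell_index k. smul (x d * c d i) (mF i))"
    using c by (intro sum.cong refl) (simp add: fm.scale_sum_right)
  also have "\<dots> = (\<Sum>i\<in>cell_index k. smul (\<Sum>d\<in>diagrams k. x d * c d i) (mF i))"
    by (subst sum.swap) (simp add: fm.scale_sum_left)
  finally show ?thesis by (intro exI)
qed

text \<open>The value 0 outside \<open>cell_index k\<close> makes the coordinates unique at every
  index, as the locale requires.\<close>

private definition "co x = (SOME c. (\<forall>i. i \<notin> cell_index k \<longrightarrow> c i = 0) \<and>
  x = (\<Sum>i\<in>cell_index k. smul (c i) (mF i)))"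

private lemma co:
  assumes "x \<in> PA k"
  shows "i \<notin> cell_index k \<Longrightarrow> co x i = 0" "x = (\<Sum>i\<in>cell_index k. smul (co x i) (mF i))"
proof -
  obtain c where "x = (\<Sum>i\<in>cell_index k. smul (c i) (mF i))" using mF_span[OF assms] by blast
  then have "x = (\<Sum>i\<in>cell_index k. smul (if i \<in> cell_index k then c i else 0) (mF i))"
    by (simp cong: sum.cong)
  then have "\<exists>c. (\<forall>i. i \<notin> cell_index k \<longrightarrow> c i = 0) \<and> x = (\<Sum>i\<in>cell_index k. smul (c i) (mF i))"
    by (intro exI[of _ "\<lambda>i. if i \<in> cell_index k then c i else 0"]) simp
  then have "(\<forall>i. i \<notin> cell_index k \<longrightarrow> co x i = 0) \<and> x = (\<Sum>i\<in>cell_index k. smul (co x i) (mF i))"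
    unfolding co_def by (rule someI_ex)
  then show "i \<notin> cell_index k \<Longrightarrow> co x i = 0" "x = (\<Sum>i\<in>cell_index k. smul (co x i) (mF i))"
    by blast+
qed

private lemma mF_in: "i \<in> cell_index k \<Longrightarrow> mF i \<in> PA k"
  using m_in_PA[of i] by (simp add: mF_def free_mod_def)

private lemma PA_sum_smul: "(\<And>i. i \<in> I \<Longrightarrow> f i \<in> PA k) \<Longrightarrow> (\<Sum>i\<in>I. smul (c i) (f i)) \<in> PA k"
  by (simp add: free_mod_def sum_fun_apply smul_def)

private lemma co_eqI:
  assumes x: "x = (\<Sum>i\<in>cell_index k. smul (c i) (mF i))" and c: "\<And>i. i \<notin> cell_index k \<Longrightarrow> c i = 0"
  shows "co x i = c i"
proof (cases "i \<in> cell_index k")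
  case True
  have "x \<in> PA k" unfolding x using mF_in by (rule PA_sum_smul)
  then have "(\<Sum>i\<in>cell_index k. smul (co x i) (mF i)) = (\<Sum>i\<in>cell_index k. smul (c i) (mF i))"
    using co(2) x by simp
  then have "(\<Sum>i\<in>cell_index k. smul (co x i - c i) (mF i)) = 0"
    by (simp add: fm.scale_left_diff_distrib sum_subtractf)
  from mF_independent[OF this True] show ?thesis by simp
next
  case False
  have "x \<in> PA k" unfolding x using mF_in by (rule PA_sum_smul)
  then show ?thesis using co(1) c False by simp
qed

private lemma co_sum_smul:
  assumes "finite J" "\<And>j. j \<in> J \<Longrightarrow> f j \<in> PA k"
  shows "co (\<Sum>j\<in>J. smul (a j) (f j)) i = (\<Sum>j\<in>J. a j * co (f j) i)"
proof (rule co_eqI)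
  have "(\<Sum>j\<in>J. smul (a j) (f j)) = (\<Sum>j\<in>J. \<Sum>i\<in>cell_index k. smul (a j * co (f j) i) (mF i))"
  proof (intro sum.cong refl)
    fix j assume "j \<in> J"
    have "smul (a j) (f j) = smul (a j) (\<Sum>i\<in>cell_index k. smul (co (f j) i) (mF i))"
      using co(2)[OF assms(2)[OF \<open>j \<in> J\<close>]] by simp
    then show "smul (a j) (f j) = (\<Sum>i\<in>cell_index k. smul (a j * co (f j) i) (mF i))"
      by (simp add: fm.scale_sum_right)
  qed
  then show "(\<Sum>j\<in>J. smul (a j) (f j)) = (\<Sum>i\<in>cell_index k. smul (\<Sum>j\<in>J. a j * co (f j) i) (mF i))"
    by (subst (asm) sum.swap) (simp add: fm.scale_sum_left)
  show "(\<Sum>j\<in>J. a j * co (f j) i) = 0" if "i \<notin> cell_index k" for i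
    using co(1)[OF assms(2) that] by (simp add: sum.neutral)
qed

text \<open>The error of the cellular congruence is a combination of basis elements with larger
  labels, collected in \<open>J\<close>. At all other labels the coordinates are exactly the
  structure constants.\<close>

private lemma cell_mult_unit:
  assumes st: "(s, t) \<in> cell_index k" and d: "d \<in> diagrams k"
  shows "\<exists>c. pa_mult z k (m s t) (unit_vec d) = (\<Sum>i\<in>cell_index k. smul (c i) (m (fst i) (snd i))) \<and>
    (\<forall>p q. (p, q) \<in> cell_index k \<longrightarrow> \<not> p ! k \<rhd> s ! k \<longrightarrow>
      c (p, q) = (if p = s then r t q (unit_vec d) else 0))"
proof -
  define \<alpha> where "\<alpha> = s ! k"
  have \<alpha>: "s \<in> Std k \<alpha>" "t \<in> Std k \<alpha>" "\<alpha> \<in> Y k"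
    using st Std_label_in_Y by (auto simp: cell_index_iff Std_iff \<alpha>_def)
  define J where "J = {i \<in> cell_index k. fst i ! k \<rhd> \<alpha>}"
  have J: "finite J" "J \<subseteq> cell_index k" using finite_cell_index by (auto simp: J_def)
  have "{m p q | p q \<mu>. \<mu> \<in> Y k \<and> \<mu> \<rhd> \<alpha> \<and> p \<in> Std k \<mu> \<and> q \<in> Std k \<mu>} = (\<lambda>i. m (fst i) (snd i)) ` J"
    (is "?L = ?R")
  proof
    show "?L \<subseteq> ?R"
    proof
      fix x assume "x \<in> ?L"
      then obtain p q \<mu> where pq: "x = m p q" "\<mu> \<rhd> \<alpha>" "p \<in> Std k \<mu>" "q \<in> Std k \<mu>" by blast
      then have "(p, q) \<in> J" by (auto simp: J_def cell_index_iff Std_iff)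
      then show "x \<in> ?R" using pq(1) by force
    qed
    show "?R \<subseteq> ?L"
    proof
      fix x assume "x \<in> ?R"
      then obtain p q where pq: "x = m p q" "(p, q) \<in> cell_index k" "p ! k \<rhd> \<alpha>" by (auto simp: J_def)
      then have "p \<in> Std k (p ! k)" "q \<in> Std k (p ! k)" "p ! k \<in> Y k"
        using Std_label_in_Y by (auto simp: cell_index_iff Std_iff)
      then show "x \<in> ?L" using pq by blast
    qed
  qed
  moreover have "pa_mult z k (m s t) (unit_vec d) - (\<Sum>u\<in>Std k \<alpha>. smul (r t u (unit_vec d)) (m s u))
      \<in> module.span smul {m p q | p q \<mu>. \<mu> \<in> Y k \<and> \<mu> \<rhd> \<alpha> \<and> p \<in> Std k \<mu> \<and> q \<in> Std k \<mu>}"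
    using cell \<alpha> unit_vec_in[OF d] unfolding cellular_basis_def by blast
  ultimately obtain c where c: "pa_mult z k (m s t) (unit_vec d)
      - (\<Sum>u\<in>Std k \<alpha>. smul (r t u (unit_vec d)) (m s u)) = (\<Sum>i\<in>J. smul (c i) (m (fst i) (snd i)))"
    using span_image_iff[OF J(1), of _ "\<lambda>i. m (fst i) (snd i)"] by auto
  have 1: "(\<Sum>i\<in>J. smul (c i) (m (fst i) (snd i)))
      = (\<Sum>i\<in>cell_index k. smul (if i \<in> J then c i else 0) (m (fst i) (snd i)))"
    by (rule sum.mono_neutral_cong_left) (use J finite_cell_index in auto)
  have 2: "(\<Sum>u\<in>Std k \<alpha>. smul (r t u (unit_vec d)) (m s u))
      = (\<Sum>i\<in>cell_index k. smul (if fst i = s then r t (snd i) (unit_vec d) else 0) (m (fst i) (snd i)))"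
  proof -
    have "(\<Sum>u\<in>Std k \<alpha>. smul (r t u (unit_vec d)) (m s u)) =
        (\<Sum>i\<in>{i \<in> cell_index k. fst i = s}. smul (r t (snd i) (unit_vec d)) (m (fst i) (snd i)))"
      by (rule sum.reindex_bij_witness[of _ snd "\<lambda>u. (s, u)"])
        (use \<alpha> in \<open>auto simp: cell_index_iff Std_iff\<close>)
    also have "\<dots> = (\<Sum>i\<in>cell_index k. smul (if fst i = s then r t (snd i) (unit_vec d) else 0) (m (fst i) (snd i)))"
      by (rule sum.mono_neutral_cong_left) (use finite_cell_index in auto)
    finally show ?thesis .
  qed
  let ?c = "\<lambda>i. (if i \<in> J then c i else 0) + (if fst i = s then r t (snd i) (unit_vec d) else 0)"
  have "pa_mult z k (m s t) (unit_vec d) = (\<Sum>i\<in>cell_index k. smul (?c i) (m (fst i) (snd i)))"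
    using c unfolding 1 2 by (simp add: fm.scale_left_distrib sum.distrib algebra_simps)
  moreover have "?c (p, q) = (if p = s then r t q (unit_vec d) else 0)" if "\<not> p ! k \<rhd> s ! k" for p q
    using that by (simp add: J_def \<alpha>_def)
  ultimately show ?thesis by (intro exI[of _ ?c]) blast
qed

private lemma co_cell_mult_unit:
  assumes st: "(s, t) \<in> cell_index k" and d: "d \<in> diagrams k"
    and pq: "(p, q) \<in> cell_index k" "\<not> p ! k \<rhd> s ! k"
  shows "co (multF k (mF (s, t)) (unit_vec d)) (p, q) = (if p = s then to_fract (r t q (unit_vec d)) else 0)"
proof -
  obtain c where c: "pa_mult z k (m s t) (unit_vec d) = (\<Sum>i\<in>cell_index k. smul (c i) (m (fst i) (snd i)))"
    "c (p, q) = (if p = s then r t q (unit_vec d) else 0)"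
    using cell_mult_unit[OF st d] pq by blast
  have "multF k (mF (s, t)) (unit_vec d) = (\<lambda>e. to_fract (pa_mult z k (m s t) (unit_vec d) e))"
    by (rule ext, subst pa_mult_hom) (simp_all add: mF_def to_fract_unit_vec cong: if_cong)
  also have "\<dots> = (\<Sum>i\<in>cell_index k. smul (to_fract (c i)) (mF i))"
    unfolding c(1) mF_sum ..
  also have "\<dots> = (\<Sum>i\<in>cell_index k. smul (if i \<in> cell_index k then to_fract (c i) else 0) (mF i))"
    by (simp cong: sum.cong)
  finally have "co (multF k (mF (s, t)) (unit_vec d)) (p, q)
      = (if (p, q) \<in> cell_index k then to_fract (c (p, q)) else 0)"
    by (rule co_eqI) simp
  then show ?thesis using pq(1) c(2) by simp
qed

lemma cellular_base_change:
  "\<exists>mF co. anisotropic_cellular (PA k) (multF k) pa_star (Std_all k) (\<lambda>t. t ! k) (\<rhd>)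
    mF co (cell_coeff r k)"
proof (intro exI[of _ mF] exI[of _ co], unfold_locales)
  show "0 \<in> PA k" by (simp add: free_mod_def)
  show "x + y \<in> PA k" if "x \<in> PA k" "y \<in> PA k" for x y :: "diagram \<Rightarrow> int poly fract"
    using that by (simp add: free_mod_def)
  show "smul c x \<in> PA k" if "x \<in> PA k" for x and c :: "int poly fract"
    using that by (simp add: free_mod_def smul_def)
  show "multF k x y \<in> PA k" for x y by (rule pa_mult_in)
  show "pa_star x \<in> PA k" if "x \<in> PA k" for x :: "diagram \<Rightarrow> int poly fract"
    using that by (rule pa_star_in)
  show "multF k (multF k x y) w = multF k x (multF k y w)" for x y w by (rule pa_mult_assoc)
  show "pa_star (x + y) = pa_star x + pa_star y" for x y :: "diagram \<Rightarrow> int poly fract"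
    by (rule ext) (simp add: pa_star_apply)
  show "pa_star (smul c x) = smul c (pa_star x)" for x and c :: "int poly fract"
    by (rule ext) (simp add: pa_star_apply smul_def)
  show "pa_star (pa_star x) = x" for x :: "diagram \<Rightarrow> int poly fract"
    by (rule ext) (simp add: pa_star_apply)
  show "pa_star (multF k x y) = multF k (pa_star y) (pa_star x)" for x y by (rule pa_star_mult)
  show "x = 0" if "x \<in> PA k" "multF k (pa_star x) x = 0" for x using that by (rule pa_anisotropic)
  show "finite (Std_all k)" by (rule finite_Std_all)
  show "\<not> l \<rhd> l" for l by (rule order_gt_irrefl)
  have lab: "is_partn l" if "l \<in> (\<lambda>t. t ! k) ` Std_all k" for l
    using that Std_in_Y[of _ k _ k] Y_partn by (auto simp: Std_all_def)
  show "l \<rhd> l''" if "l \<in> (\<lambda>t. t ! k) ` Std_all k" "l' \<in> (\<lambda>t. t ! k) ` Std_all k" "l \<rhd> l'" "l' \<rhd> l''"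
    for l l' l''
    using order_gt_trans[OF lab[OF that(1)] lab[OF that(2)] that(3,4)] .
  show "mF (s, t) \<in> PA k" if "s \<in> Std_all k" "t \<in> Std_all k" "s ! k = t ! k" for s t
    using that by (intro mF_in) (simp add: cell_index_iff)
  show "pa_star (mF (s, t)) = mF (t, s)" if "s \<in> Std_all k" "t \<in> Std_all k" "s ! k = t ! k" for s t
  proof -
    have "pa_star (m s t) = m t s" using cell that by (auto simp: cellular_basis_def cell_index_iff)
    then have "pa_star (m s t) d = m t s d" for d by simp
    then show ?thesis by (intro ext) (simp add: mF_def pa_star_apply)
  qed
  show "co (x + y) i = co x i + co y i" if "x \<in> PA k" "y \<in> PA k" for x y i
    using co_sum_smul[of "{True, False}" "\<lambda>b. if b then x else y" "\<lambda>_. 1" i] that by auto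
  show "co (smul c x) i = c * co x i" if "x \<in> PA k" for x c i
    using co_sum_smul[of "{True}" "\<lambda>_. x" "\<lambda>_. c" i] that by auto
  show "co (mF (s, t)) i = (if i = (s, t) then 1 else 0)"
    if "s \<in> Std_all k" "t \<in> Std_all k" "s ! k = t ! k" for s t i
  proof (rule co_eqI)
    show "mF (s, t) = (\<Sum>i\<in>cell_index k. smul (if i = (s, t) then 1 else 0) (mF i))"
      using that finite_cell_index[of k]
      by (simp add: if_distrib[of "\<lambda>a. smul a _"] cell_index_iff cong: if_cong)
  qed (use that in \<open>auto simp: cell_index_iff\<close>)
  show "x = (\<Sum>i | fst i \<in> Std_all k \<and> snd i \<in> Std_all k \<and> fst i ! k = snd i ! k. smul (co x i) (mF i))"
    if "x \<in> PA k" for x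
  proof -
    have "{i. fst i \<in> Std_all k \<and> snd i \<in> Std_all k \<and> fst i ! k = snd i ! k} = cell_index k"
      by (auto simp: cell_index_iff)
    then show ?thesis using co(2)[OF that] by simp
  qed
  show "co (multF k (mF (s, t)) a) (p, q) = (if p = s then cell_coeff r k t q a else 0)"
    if st: "s \<in> Std_all k" "t \<in> Std_all k" "s ! k = t ! k" and a: "a \<in> PA k"
      and pq: "p \<in> Std_all k" "q \<in> Std_all k" "p ! k = q ! k" "\<not> p ! k \<rhd> s ! k" for s t a p q
  proof -
    have "multF k (mF (s, t)) a = multF k (mF (s, t)) (\<Sum>d\<in>diagrams k. smul (a d) (unit_vec d))"
      using free_mod_expand[OF finite_diagrams a] by simp
    also have "\<dots> = (\<Sum>d\<in>diagrams k. smul (a d) (multF k (mF (s, t)) (unit_vec d)))"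
      by (simp only: pa_mult_sum_right pa_mult_smul_right)
    finally have "co (multF k (mF (s, t)) a) (p, q)
        = (\<Sum>d\<in>diagrams k. a d * co (multF k (mF (s, t)) (unit_vec d)) (p, q))"
      by (simp add: co_sum_smul[OF finite_diagrams pa_mult_in])
    also have "\<dots> = (\<Sum>d\<in>diagrams k. a d * (if p = s then to_fract (r t q (unit_vec d)) else 0))"
      using st pq by (intro sum.cong refl arg_cong[where f = "\<lambda>x. _ * x"] co_cell_mult_unit)
        (auto simp: cell_index_iff)
    finally show ?thesis by (simp add: cell_coeff_def)
  qed
qed (simp_all add: pa_mult_add_left pa_mult_add_right pa_mult_smul_left pa_mult_smul_right)

lemma cell_coeff_mult:
  assumes "t \<in> Std_all k" "u \<in> Std_all k" "t ! k = u ! k" "a \<in> PA k" "b \<in> PA k"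
  shows "cell_coeff r k t u (multF k a b) =
    (\<Sum>w\<in>Std k (t ! k). cell_coeff r k t w a * cell_coeff r k w u b)"
proof -
  obtain mF co where "anisotropic_cellular (PA k) (multF k) pa_star (Std_all k)
      (\<lambda>t. t ! k) (\<rhd>) mF co (cell_coeff r k)"
    using cellular_base_change by blast
  then interpret anisotropic_cellular "PA k" "multF k" pa_star "Std_all k"
    "\<lambda>t. t ! k" "(\<rhd>)" mF co "cell_coeff r k" .
  have "{w \<in> Std_all k. w ! k = t ! k} = Std k (t ! k)" by (auto simp: Std_iff)
  then show ?thesis using r_mul[OF assms] by simp
qed

text \<open>The abstract \<open>cell_idem\<close> satisfies the description defining
  \<open>F_cell\<close>, and \<open>primitive_idem_unique\<close> excludes any other candidate. A
  path ending in \<open>\<rho>\<close> is what makes \<open>\<rho>\<close> a label of the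
  locale.\<close>

lemma F_cell:
  assumes \<rho>: "Std k \<rho> \<noteq> {}"
  shows "F_cell r k \<rho> \<in> PA k" "multF k (F_cell r k \<rho>) (F_cell r k \<rho>) = F_cell r k \<rho>"
    "x \<in> PA k \<Longrightarrow> multF k (F_cell r k \<rho>) x = multF k x (F_cell r k \<rho>)"
    "t \<in> Std_all k \<Longrightarrow> u \<in> Std_all k \<Longrightarrow> t ! k = u ! k \<Longrightarrow>
      cell_coeff r k t u (F_cell r k \<rho>) = (if t ! k = \<rho> \<and> t = u then 1 else 0)"
proof -
  obtain mF co where "anisotropic_cellular (PA k) (multF k) pa_star (Std_all k)
      (\<lambda>t. t ! k) (\<rhd>) mF co (cell_coeff r k)"
    using cellular_base_change by blast
  then interpret anisotropic_cellular "PA k" "multF k" pa_star "Std_all k"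
    "\<lambda>t. t ! k" "(\<rhd>)" mF co "cell_coeff r k" .
  have \<rho>': "\<rho> \<in> (\<lambda>t. t ! k) ` Std_all k" using \<rho> by (force simp: Std_iff)
  have prim: "primitive_central_idempotent k e \<longleftrightarrow> primitive_idem e" for e
    unfolding primitive_central_idempotent_def primitive_idem_def central_idempotent_def central_idem_def ..
  \<comment> \<open>Acting as the identity on the module is translated into having the identity
    matrix, the form in which the abstract lemmas speak.\<close>
  have act: "(\<forall>v\<in>DeltaF k \<rho>. cell_actF r k \<rho> v e = v) \<longleftrightarrow>
      (\<forall>t\<in>Std k \<rho>. \<forall>u\<in>Std k \<rho>. cell_coeff r k t u e = (if t = u then 1 else 0))" for e
  proof
    assume act: "\<forall>v\<in>DeltaF k \<rho>. cell_actF r k \<rho> v e = v"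
    show "\<forall>t\<in>Std k \<rho>. \<forall>u\<in>Std k \<rho>. cell_coeff r k t u e = (if t = u then 1 else 0)"
    proof (intro ballI)
      fix t u assume tu: "t \<in> Std k \<rho>" "u \<in> Std k \<rho>"
      have "cell_actF r k \<rho> (unit_vec t) e u = (unit_vec t u :: int poly fract)"
        using act unit_vec_in[OF tu(1)] by metis
      moreover have "cell_actF r k \<rho> (unit_vec t) e u = cell_coeff r k t u e"
        using tu finite_Std[of k \<rho>]
        by (simp add: cell_actF_apply unit_vec_def if_distrib[of "\<lambda>a. a * _"] cong: if_cong)
      ultimately show "cell_coeff r k t u e = (if t = u then 1 else 0)"
        by (auto simp: unit_vec_def)
    qed
  next
    assume c: "\<forall>t\<in>Std k \<rho>. \<forall>u\<in>Std k \<rho>. cell_coeff r k t u e = (if t = u then 1 else 0)"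
    show "\<forall>v\<in>DeltaF k \<rho>. cell_actF r k \<rho> v e = v"
    proof (intro ballI ext)
      fix v :: "path \<Rightarrow> int poly fract" and u assume v: "v \<in> DeltaF k \<rho>"
      have "(\<Sum>t\<in>Std k \<rho>. v t * cell_coeff r k t u e) = v u" if "u \<in> Std k \<rho>"
      proof -
        have "(\<Sum>t\<in>Std k \<rho>. v t * cell_coeff r k t u e) = (\<Sum>t\<in>Std k \<rho>. if t = u then v t else 0)"
          using c that by (intro sum.cong refl) auto
        then show ?thesis using that finite_Std[of k \<rho>] by simp
      qed
      then show "cell_actF r k \<rho> v e u = v u"
        using v by (auto simp: cell_actF_apply free_mod_def)
    qed
  qed
  have "F_cell r k \<rho> = cell_idem \<rho>"
    unfolding F_cell_def prim act
  proof (rule the_equality)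
    show "primitive_idem (cell_idem \<rho>) \<and>
        (\<forall>t\<in>Std k \<rho>. \<forall>u\<in>Std k \<rho>. cell_coeff r k t u (cell_idem \<rho>) = (if t = u then 1 else 0))"
      using cell_idem_primitive[OF \<rho>'] r_cell_idem[OF \<rho>'] by (auto simp: Std_iff)
    fix e assume "primitive_idem e \<and>
        (\<forall>t\<in>Std k \<rho>. \<forall>u\<in>Std k \<rho>. cell_coeff r k t u e = (if t = u then 1 else 0))"
    then show "e = cell_idem \<rho>"
      using cell_idem_primitive[OF \<rho>'] r_cell_idem[OF \<rho>']
      by (intro primitive_idem_unique[OF \<rho>']) (auto simp: Std_iff)
  qed
  then show "F_cell r k \<rho> \<in> PA k" "multF k (F_cell r k \<rho>) (F_cell r k \<rho>) = F_cell r k \<rho>"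
    "x \<in> PA k \<Longrightarrow> multF k (F_cell r k \<rho>) x = multF k x (F_cell r k \<rho>)"
    "t \<in> Std_all k \<Longrightarrow> u \<in> Std_all k \<Longrightarrow> t ! k = u ! k \<Longrightarrow>
      cell_coeff r k t u (F_cell r k \<rho>) = (if t ! k = \<rho> \<and> t = u then 1 else 0)"
    using cell_idem_central[OF \<rho>'] r_cell_idem[OF \<rho>'] by (auto simp: central_idem_def)
qed

end


section \<open>Restriction\<close>

lemma half_Suc: "half (Suc k) = (if even k then Suc (half k) else half k)"
  by (auto simp: half_def elim!: evenE oddE)

lemma half_mono: "i \<le> k \<Longrightarrow> half i \<le> half k"
  by (simp add: half_def div_le_mono)

lemma diag_incl_Suc: "diag_incl k (Suc k) d =
    (if even k then insert {North (Suc (half k)), South (Suc (half k))} d else d)"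
  by (auto simp: diag_incl_def half_Suc)

lemma diag_incl_self: "diag_incl k k d = d"
  by (auto simp: diag_incl_def)

lemma diag_incl_trans:
  assumes "i \<le> k"
  shows "diag_incl k (Suc k) (diag_incl i k d) = diag_incl i (Suc k) d"
proof -
  have image: "{{North j, South j} | j. a < j \<and> j \<le> b} = (\<lambda>j. {North j, South j}) ` {a<..b}" for a b
    by auto
  have "half i \<le> half k" "half k \<le> half (Suc k)" using assms by (simp_all add: half_mono)
  then have "{half i<..half (Suc k)} = {half i<..half k} \<union> {half k<..half (Suc k)}" by auto
  then show ?thesis
    unfolding diag_incl_def image by (simp only: image_Un Un_assoc)
qed

lemma diag_incl_in:
  assumes d: "d \<in> diagrams k"
  shows "diag_incl k (Suc k) d \<in> diagrams (Suc k)"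
proof (cases "even k")
  case True
  let ?B = "{North (Suc (half k)), South (Suc (half k))}"
  have V: "verts (Suc (half k)) = verts (half k) \<union> ?B"
    by (auto simp: verts_def atLeastAtMostSuc_conv)
  have "partition_on (verts (Suc (half k))) (insert ?B d)"
  proof -
    have "verts (Suc (half k)) - ?B = verts (half k)" unfolding V by (auto simp: verts_def)
    moreover have "disjnt ?B (\<Union>d)"
      unfolding partition_onD1[OF diagrams_partition_on[OF d], symmetric]
      by (auto simp: verts_def disjnt_def)
    ultimately show ?thesis
      using diagrams_partition_on[OF d] V by (subst partition_on_insert) auto
  qed
  then show ?thesis
    using True by (simp add: diag_incl_Suc diagrams_def verts_def half_Suc)
next
  case False
  then show ?thesis
    using d by (simp add: diag_incl_Suc diagrams_def half_Suc)
qed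

lemma diag_incl_in':
  assumes "d \<in> diagrams i" "i \<le> k"
  shows "diag_incl i k d \<in> diagrams k"
  using assms(2)
proof (induction k rule: dec_induct)
  case base
  then show ?case using assms(1) by (simp add: diag_incl_self)
next
  case (step n)
  then show ?case using diag_incl_in diag_incl_trans by metis
qed

text \<open>A new vertical strand adds the condition that its two labels agree. In the matrix
  product the new middle label is then forced, so no loop is gained. For odd \<open>k\<close> the
  diagrams do not change.\<close>

lemma compose_incl:
  assumes d: "d \<in> diagrams k" and d': "d' \<in> diagrams k"
  shows "compose (diag_incl k (Suc k) d) (diag_incl k (Suc k) d') = diag_incl k (Suc k) (compose d d') \<and>
    loops (diag_incl k (Suc k) d) (diag_incl k (Suc k) d') = loops d d'"
proof (cases "even k")
  case False
  then show ?thesis by (simp add: diag_incl_Suc)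
next
  case True
  let ?i = "diag_incl k (Suc k)" and ?r = "half k"
  have half: "half (Suc k) = Suc ?r" using True by (simp add: half_Suc)
  have incl: "block_const (?i e) (glue f g) \<longleftrightarrow> block_const e (glue f g) \<and> f (Suc ?r) = g (Suc ?r)"
    for e and f g :: "nat \<Rightarrow> nat"
    using True by (auto simp: diag_incl_Suc block_const_def)
  show ?thesis
  proof (rule diagram_eqI)
    fix N :: nat and f h
    assume "f \<in> {1..half (Suc k)} \<rightarrow> {..<N}" "h \<in> {1..half (Suc k)} \<rightarrow> {..<N}"
    note fh = this
    then have fh': "f \<in> {1..?r} \<rightarrow> {..<N}" "h \<in> {1..?r} \<rightarrow> {..<N}" and fN: "f (Suc ?r) < N"
      by (auto simp: half)
    let ?M = "\<lambda>d f g. of_bool (block_const d (glue f g)) :: nat"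
    let ?G = "{1..?r} \<rightarrow>\<^sub>E {..<N}"
    have "(\<Sum>g\<in>{1..half (Suc k)} \<rightarrow>\<^sub>E {..<N}. ?M (?i d) f g * ?M (?i d') g h)
        = (\<Sum>g\<in>{g \<in> {1..half (Suc k)} \<rightarrow>\<^sub>E {..<N}. f (Suc ?r) = g (Suc ?r)}. ?M (?i d) f g * ?M (?i d') g h)"
      by (rule sum.mono_neutral_right) (auto simp: incl intro!: finite_PiE)
    also have "\<dots> = (\<Sum>g\<in>?G. ?M d f g * ?M d' g h * of_bool (f (Suc ?r) = h (Suc ?r)))"
    \<comment> \<open>The label at \<open>Suc ?r\<close> is determined by \<open>f\<close>;
      resetting it to \<open>undefined\<close> gives an extensional labelling of the first
      \<open>?r\<close> middle vertices.\<close>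
    proof (rule sum.reindex_bij_witness[of _ "\<lambda>g. g(Suc ?r := f (Suc ?r))" "\<lambda>g. g(Suc ?r := undefined)"])
      fix g assume g: "g \<in> {g \<in> {1..half (Suc k)} \<rightarrow>\<^sub>E {..<N}. f (Suc ?r) = g (Suc ?r)}"
      then show "(g(Suc ?r := undefined))(Suc ?r := f (Suc ?r)) = g" by auto
      show "g(Suc ?r := undefined) \<in> ?G"
        using g by (auto simp: half PiE_iff extensional_def)
      have "block_const d (glue f (g(Suc ?r := undefined))) = block_const d (glue f g)"
        by (rule block_const_cong[OF diagrams_partition_on[OF d]]) auto
      moreover have "block_const d' (glue (g(Suc ?r := undefined)) h) = block_const d' (glue g h)"
        by (rule block_const_cong[OF diagrams_partition_on[OF d']]) auto
      ultimately show "?M d f (g(Suc ?r := undefined)) * ?M d' (g(Suc ?r := undefined)) h *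
          of_bool (f (Suc ?r) = h (Suc ?r)) = ?M (?i d) f g * ?M (?i d') g h"
        using g by (simp add: incl)
    next
      fix g assume g: "g \<in> ?G"
      then show "(g(Suc ?r := f (Suc ?r)))(Suc ?r := undefined) = g"
        by (auto simp: PiE_iff extensional_def)
      show "g(Suc ?r := f (Suc ?r)) \<in> {g \<in> {1..half (Suc k)} \<rightarrow>\<^sub>E {..<N}. f (Suc ?r) = g (Suc ?r)}"
        using g fN by (auto simp: half PiE_iff extensional_def le_Suc_eq)
    qed
    also have "\<dots> = (\<Sum>g\<in>?G. ?M d f g * ?M d' g h) * of_bool (f (Suc ?r) = h (Suc ?r))"
      by (simp only: sum_distrib_right)
    also have "\<dots> = N ^ loops d d' * ?M (?i (compose d d')) f h"
      unfolding count_labellings_diagrams[OF d d' fh'] by (simp add: incl)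
    finally show "N ^ loops (?i d) (?i d') * ?M (compose (?i d) (?i d')) f h
        = N ^ loops d d' * ?M (?i (compose d d')) f h"
      unfolding count_labellings_diagrams[OF diag_incl_in[OF d] diag_incl_in[OF d'] fh] .
  qed (use d d' compose_in_diagrams diag_incl_in in auto)
qed

lemma diag_incl_id: "diag_incl k (Suc k) (id_diagram k) = id_diagram (Suc k)"
  by (auto simp: diag_incl_Suc id_diagram_def half_Suc atLeastAtMostSuc_conv)

text \<open>The inclusion in its adjoint form: a pairing on level \<open>k\<close> is pulled back to
  the diagrams of level \<open>i\<close>.\<close>

lemma sum_pa_incl:
  fixes x :: "diagram \<Rightarrow> 'a::comm_ring_1"
  assumes "i \<le> k"
  shows "(\<Sum>e\<in>diagrams k. pa_incl i k x e * h e) = (\<Sum>d\<in>diagrams i. x d * h (diag_incl i k d))"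
proof -
  have "(\<Sum>e\<in>diagrams k. pa_incl i k x e * h e)
      = (\<Sum>e\<in>diagrams k. \<Sum>d\<in>diagrams i. if diag_incl i k d = e then x d * h e else 0)"
    unfolding pa_incl_def sum_distrib_right by (intro sum.cong refl) simp
  also have "\<dots> = (\<Sum>d\<in>diagrams i. \<Sum>e\<in>diagrams k. if diag_incl i k d = e then x d * h e else 0)"
    by (rule sum.swap)
  also have "\<dots> = (\<Sum>d\<in>diagrams i. x d * h (diag_incl i k d))"
    using diag_incl_in'[OF _ assms] finite_diagrams by (intro sum.cong refl) simp
  finally show ?thesis .
qed

lemma pa_incl_apply:
  "pa_incl i k x e = (\<Sum>d\<in>diagrams i. x d * (if diag_incl i k d = e then 1 else 0))"
  unfolding pa_incl_def by (intro sum.cong refl) simp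

lemma pa_incl_in: "i \<le> k \<Longrightarrow> pa_incl i k x \<in> PA k"
  using diag_incl_in' by (force simp: free_mod_def pa_incl_def intro!: sum.neutral)

lemma pa_incl_trans:
  assumes "i \<le> k"
  shows "pa_incl k (Suc k) (pa_incl i k x) = pa_incl i (Suc k) x"
proof
  fix e
  have "pa_incl k (Suc k) (pa_incl i k x) e =
      (\<Sum>d\<in>diagrams k. pa_incl i k x d * (if diag_incl k (Suc k) d = e then 1 else 0))"
    by (rule pa_incl_apply)
  also have "\<dots> = (\<Sum>d\<in>diagrams i. x d * (if diag_incl k (Suc k) (diag_incl i k d) = e then 1 else 0))"
    by (rule sum_pa_incl[OF assms])
  also have "\<dots> = pa_incl i (Suc k) x e"
    by (simp only: diag_incl_trans[OF assms] pa_incl_apply)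
  finally show "pa_incl k (Suc k) (pa_incl i k x) e = pa_incl i (Suc k) x e" .
qed

lemma pa_incl_self:
  assumes "x \<in> PA k"
  shows "pa_incl k k x = x"
  using assms finite_diagrams
  by (intro ext) (auto simp: pa_incl_def diag_incl_self free_mod_def)

lemma pa_incl_unit_vec: "d \<in> diagrams k \<Longrightarrow> pa_incl k k' (unit_vec d) = unit_vec (diag_incl k k' d)"
  using finite_diagrams[of k]
  by (intro ext) (simp add: pa_incl_apply unit_vec_def if_distrib[of "\<lambda>a. a * _"] eq_commute cong: if_cong)

lemma pa_incl_one: "pa_incl k (Suc k) (pa_one k) = pa_one (Suc k)"
  unfolding pa_one_eq by (simp only: pa_incl_unit_vec[OF id_in_diagrams] diag_incl_id)

lemma pa_incl_mult:
  "pa_incl k (Suc k) (pa_mult \<delta> k x y) = pa_mult \<delta> (Suc k) (pa_incl k (Suc k) x) (pa_incl k (Suc k) y)"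
proof
  fix e
  let ?i = "diag_incl k (Suc k)" and ?D = "diagrams k"
  let ?G = "\<lambda>c c'. if compose c c' = e then \<delta> ^ loops c c' else 0"
  have "pa_mult \<delta> (Suc k) (pa_incl k (Suc k) x) (pa_incl k (Suc k) y) e =
      (\<Sum>c\<in>diagrams (Suc k). pa_incl k (Suc k) x c * (\<Sum>c'\<in>diagrams (Suc k). pa_incl k (Suc k) y c' * ?G c c'))"
    by (simp only: pa_mult_def sum_distrib_left mult.assoc)
  also have "\<dots> = (\<Sum>d\<in>?D. x d * (\<Sum>d'\<in>?D. y d' * ?G (?i d) (?i d')))"
    by (simp only: sum_pa_incl[OF le_SucI[OF le_refl]])
  also have "\<dots> = (\<Sum>d\<in>?D. \<Sum>d'\<in>?D. x d * y d' * \<delta> ^ loops d d' * (if ?i (compose d d') = e then 1 else 0))"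
    unfolding sum_distrib_left using compose_incl by (intro sum.cong refl) (auto simp: mult.assoc)
  also have "\<dots> = pa_incl k (Suc k) (pa_mult \<delta> k x y) e"
    by (simp only: pa_incl_apply pa_mult_sum)
  finally show "pa_incl k (Suc k) (pa_mult \<delta> k x y) e =
      pa_mult \<delta> (Suc k) (pa_incl k (Suc k) x) (pa_incl k (Suc k) y) e" ..
qed

lemma span_unit_vec_outside:
  assumes "v \<in> module.span smul {unit_vec t | t. P t}" "\<not> P u"
  shows "v u = 0"
  using assms(1)
proof (induction rule: fm.span_induct_alt)
  case (step c x y)
  then show ?case using assms(2) by (auto simp: smul_def unit_vec_def)
qed simp

text \<open>Modulo the larger labels \<open>P_k\<close> acts as on the cell module of level
  \<open>k\<close>, and that quotient forgets only the coordinates at paths \<open>u\<close> with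
  \<open>u ! k \<rhd> t ! k\<close>. All other coordinates are therefore known exactly.\<close>

lemma restriction_triangular:
  assumes res: "restriction_compatible r k"
    and t: "t \<in> Std (Suc k) \<alpha>" and u: "u \<in> Std (Suc k) \<alpha>" and tu: "\<not> u ! k \<rhd> t ! k"
    and d: "d \<in> diagrams k"
  shows "r t u (unit_vec (diag_incl k (Suc k) d)) =
    (if u ! k = t ! k then r (take (Suc k) t) (take (Suc k) u) (unit_vec d) else 0)"
proof -
  define \<rho> where "\<rho> = t ! k"
  define N where "N = cell_filtration_ge k \<alpha> \<rho>"
  let ?N' = "cell_filtration_gt k \<alpha> \<rho>"
  let ?act = "\<lambda>v a. cell_actR r (Suc k) \<alpha> v (pa_incl k (Suc k) a)"
  have edge: "edge k \<rho> \<alpha>" and t': "take (Suc k) t \<in> Std k \<rho>"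
    using take_Std[OF t] by (auto simp: \<rho>_def)
  have N_sub: "v + w \<in> N" "v - w \<in> N" "smul c v \<in> N" "0 \<in> N" if "v \<in> N" "w \<in> N" for v w c
    using that unfolding N_def cell_filtration_ge_def
    by (auto intro: fm.span_add fm.span_diff fm.span_scale fm.span_zero)
  have stable: "?act v a \<in> N" if "v \<in> N" "a \<in> PA k" for v a
    using res edge that unfolding restriction_compatible_def N_def by blast
  have "\<exists>\<theta>. induces_module_iso (PA k) ?act N ?N' (cell_actR r k \<rho>) (free_mod (Std k \<rho>)) \<theta> \<and>
      (\<forall>t\<in>Std (Suc k) \<alpha>. t ! k = \<rho> \<longrightarrow> \<theta> (unit_vec t) = unit_vec (take (Suc k) t))"
    unfolding N_def
    by (rule res[unfolded restriction_compatible_def, THEN spec, THEN spec, THEN mp, OF edge, THEN conjunct2])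
  then obtain \<theta> where "induces_module_iso (PA k) ?act N ?N' (cell_actR r k \<rho>) (free_mod (Std k \<rho>)) \<theta> \<and>
      (\<forall>t\<in>Std (Suc k) \<alpha>. t ! k = \<rho> \<longrightarrow> \<theta> (unit_vec t) = unit_vec (take (Suc k) t))" ..
  then have iso: "induces_module_iso (PA k) ?act N ?N' (cell_actR r k \<rho>) (free_mod (Std k \<rho>)) \<theta>"
    and \<theta>': "\<forall>t\<in>Std (Suc k) \<alpha>. t ! k = \<rho> \<longrightarrow> \<theta> (unit_vec t) = unit_vec (take (Suc k) t)"
    by blast+
  have \<theta>: "\<theta> (unit_vec t) = unit_vec (take (Suc k) t)" if "t \<in> Std (Suc k) \<alpha>" "t ! k = \<rho>" for t
    using \<theta>' that by blast
  have \<theta>_add: "\<theta> (v + w) = \<theta> v + \<theta> w" if "v \<in> N" "w \<in> N" for v w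
    using iso that unfolding induces_module_iso_def by blast
  have \<theta>_smul: "\<theta> (smul c v) = smul c (\<theta> v)" if "v \<in> N" for v c
    using iso that unfolding induces_module_iso_def by blast
  have \<theta>_act: "\<theta> (?act v a) = cell_actR r k \<rho> (\<theta> v) a" if "v \<in> N" "a \<in> PA k" for v a
    using iso that unfolding induces_module_iso_def by blast
  have kernel: "v \<in> ?N'" if "v \<in> N" "\<theta> v = 0" for v
    using iso that unfolding induces_module_iso_def by blast
  have unit_N: "unit_vec s \<in> N" if "s \<in> Std (Suc k) \<alpha>" "s ! k = \<rho>" for s
    using that unfolding N_def cell_filtration_ge_def by (intro fm.span_base) (auto simp: order_ge_def)
  have tN: "unit_vec t \<in> N" using unit_N[OF t] by (simp add: \<rho>_def)
  have zero_N: "0 \<in> N" using N_sub(4)[OF tN tN] .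
  have \<theta>_zero: "\<theta> 0 = 0" using \<theta>_smul[OF zero_N, of 0] by simp
  let ?c = "\<lambda>u. r (take (Suc k) t) u (unit_vec d)"
  define w where "w = ?act (unit_vec t) (unit_vec d)"
  \<comment> \<open>A lift to \<open>N\<close> of the image of \<open>w\<close> under
    \<open>\<theta>\<close>, obtained by extending each path of level \<open>k\<close> by
    \<open>\<alpha>\<close>. The difference \<open>w - w'\<close> lies in the kernel, so it has no
    coordinates outside the larger labels.\<close>
  define w' where "w' U = (\<Sum>u\<in>U. smul (?c u) (unit_vec (u @ [\<alpha>])) :: path \<Rightarrow> int poly)" for U
  have w: "w \<in> N" unfolding w_def by (rule stable[OF tN unit_vec_in[OF d]])
  have w_apply: "w u = r t u (unit_vec (diag_incl k (Suc k) d))" if "u \<in> Std (Suc k) \<alpha>" for u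
    using that t finite_Std[of "Suc k" \<alpha>]
    by (simp add: w_def cell_actR_def pa_incl_unit_vec[OF d] unit_vec_def[of t]
        if_distrib[of "\<lambda>a. a * _"] cong: if_cong)
  \<comment> \<open>The map \<open>\<theta>\<close> is known to be linear on \<open>N\<close> only,
    so membership in \<open>N\<close> is carried through the induction.\<close>
  have w'_sum: "w' U \<in> N \<and> \<theta> (w' U) = (\<Sum>u\<in>U. smul (?c u) (unit_vec u))" if "finite U" "U \<subseteq> Std k \<rho>" for U
    using that
  proof (induction U)
    case empty
    then show ?case using zero_N \<theta>_zero by (simp add: w'_def flip: zero_fun_def)
  next
    case (insert u U)
    then have u: "u \<in> Std k \<rho>" by simp
    note ua = append_Std[OF u edge]
    have uN: "unit_vec (u @ [\<alpha>]) \<in> N" by (rule unit_N[OF ua(1,2)])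
    have a: "smul (?c u) (unit_vec (u @ [\<alpha>])) \<in> N" by (rule N_sub(3)[OF uN uN])
    have b: "w' U \<in> N" "\<theta> (w' U) = (\<Sum>u\<in>U. smul (?c u) (unit_vec u))"
      using insert.IH insert.prems by auto
    have eq: "w' (insert u U) = smul (?c u) (unit_vec (u @ [\<alpha>])) + w' U"
      using insert by (simp add: w'_def)
    have "\<theta> (smul (?c u) (unit_vec (u @ [\<alpha>]))) = smul (?c u) (unit_vec u)"
      using \<theta>_smul[OF uN] \<theta>[OF ua(1,2)] ua(3) by simp
    then have "\<theta> (w' (insert u U)) = (\<Sum>u\<in>insert u U. smul (?c u) (unit_vec u))"
      unfolding eq \<theta>_add[OF a b(1)] b(2) sum.insert[OF insert.hyps(1,2)] by (rule arg_cong)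
    then show ?case
      unfolding eq using N_sub(1)[OF a b(1)] by blast
  qed
  note w' = w'_sum[OF finite_Std order_refl, THEN conjunct1] w'_sum[OF finite_Std order_refl, THEN conjunct2]
  have "\<theta> w = (\<Sum>u\<in>Std k \<rho>. smul (?c u) (unit_vec u))"
  proof -
    have "\<theta> w = cell_actR r k \<rho> (unit_vec (take (Suc k) t)) (unit_vec d)"
      unfolding w_def using \<theta>_act[OF tN unit_vec_in[OF d]] \<theta>[OF t] by (simp add: \<rho>_def)
    also have "\<dots> = (\<lambda>u. if u \<in> Std k \<rho> then ?c u else 0)"
      using t' finite_Std[of k \<rho>]
      by (intro ext) (simp add: cell_actR_def unit_vec_def[of "take (Suc k) t"] if_distrib[of "\<lambda>a. a * _"] cong: if_cong)
    also have "\<dots> = (\<Sum>u\<in>Std k \<rho>. smul (?c u) (unit_vec u))"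
      using finite_Std[of k \<rho>]
      by (intro ext) (simp add: sum_fun_apply smul_def unit_vec_def[of "_ :: path"] if_distrib[of "\<lambda>a. _ * a"] cong: if_cong)
    finally show ?thesis .
  qed
  moreover have "\<theta> w = \<theta> (w - w' (Std k \<rho>)) + \<theta> (w' (Std k \<rho>))"
    using \<theta>_add[OF N_sub(2)[OF w w'(1)] w'(1)] by simp
  ultimately have "\<theta> (w - w' (Std k \<rho>)) = 0" using w'(2) by simp
  then have "w - w' (Std k \<rho>) \<in> ?N'" using kernel N_sub(2)[OF w w'(1)] by blast
  then have "(w - w' (Std k \<rho>)) u = 0"
    unfolding cell_filtration_gt_def by (rule span_unit_vec_outside) (use tu in \<open>simp add: \<rho>_def\<close>)
  then have "w u = w' (Std k \<rho>) u" by simp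
  also have "\<dots> = (\<Sum>u'\<in>Std k \<rho>. if u' = take (Suc k) u then ?c u' else 0)"
  proof -
    have "u = u' @ [\<alpha>] \<longleftrightarrow> u' = take (Suc k) u" if "u' \<in> Std k \<rho>" for u'
      using append_Std[OF that edge] take_Std[OF u] by metis
    then show ?thesis
      unfolding w'_def sum_fun_apply by (intro sum.cong refl) (simp add: smul_def unit_vec_def)
  qed
  also have "\<dots> = (if take (Suc k) u \<in> Std k \<rho> then ?c (take (Suc k) u) else 0)"
    using finite_Std[of k \<rho>] by simp
  also have "take (Suc k) u \<in> Std k \<rho> \<longleftrightarrow> u ! k = \<rho>"
    using take_Std(1)[OF u] by (auto simp: Std_iff)
  finally show ?thesis using w_apply[OF u] by (simp add: \<rho>_def)
qed

lemma cell_coeff_restrict: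
  assumes res: "restriction_compatible r k"
    and t: "t \<in> Std (Suc k) \<alpha>" and u: "u \<in> Std (Suc k) \<alpha>" and tu: "\<not> u ! k \<rhd> t ! k"
  shows "cell_coeff r (Suc k) t u (pa_incl k (Suc k) a) =
    (if u ! k = t ! k then cell_coeff r k (take (Suc k) t) (take (Suc k) u) a else 0)"
proof -
  have "cell_coeff r (Suc k) t u (pa_incl k (Suc k) a) =
      (\<Sum>d\<in>diagrams k. a d * to_fract (r t u (unit_vec (diag_incl k (Suc k) d))))"
    unfolding cell_coeff_def by (rule sum_pa_incl) simp
  also have "\<dots> = (\<Sum>d\<in>diagrams k. a d * to_fract
      (if u ! k = t ! k then r (take (Suc k) t) (take (Suc k) u) (unit_vec d) else 0))"
    by (intro sum.cong refl) (simp only: restriction_triangular[OF res t u tu])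
  finally show ?thesis by (simp add: cell_coeff_def)
qed


section \<open>Path idempotents\<close>

text \<open>The inclusions are multiplicative and compose, so the product for the truncated path
  becomes the product of all factors but the last.\<close>

lemma F_path_Suc:
  "F_path r (Suc k) s = multF (Suc k) (pa_incl k (Suc k) (F_path r k (take (Suc k) s)))
    (pa_incl (Suc k) (Suc k) (F_cell r (Suc k) (s ! Suc k)))"
proof -
  define fold where "fold k s j =
    foldl (\<lambda>x i. multF k x (pa_incl i k (F_cell r i (s ! i)))) (pa_one k) [0..<j]" for k s j
  have "pa_incl k (Suc k) (fold k (take (Suc k) s) j) = fold (Suc k) s j" if "j \<le> Suc k" for j
    using that
  proof (induction j)
    case 0
    then show ?case by (simp add: fold_def pa_incl_one)
  next
    case (Suc j)
    have "pa_incl k (Suc k) (fold k (take (Suc k) s) (Suc j)) =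
        multF (Suc k) (pa_incl k (Suc k) (fold k (take (Suc k) s) j))
          (pa_incl k (Suc k) (pa_incl j k (F_cell r j (take (Suc k) s ! j))))"
      by (simp add: fold_def pa_incl_mult)
    also have "\<dots> = multF (Suc k) (fold (Suc k) s j) (pa_incl j (Suc k) (F_cell r j (s ! j)))"
      using Suc by (simp add: pa_incl_trans)
    also have "\<dots> = fold (Suc k) s (Suc j)" by (simp add: fold_def)
    finally show ?case .
  qed
  from this[of "Suc k"] show ?thesis by (simp add: F_path_def fold_def)
qed

lemma F_path_in: "F_path r k s \<in> PA k"
  by (simp add: F_path_def pa_mult_in)

text \<open>Larger labels have smaller rank, which permits induction upwards along
  \<open>\<rhd>\<close>.\<close>

definition rank :: "partn \<Rightarrow> nat" where
  "rank \<beta> = card {\<gamma>. is_partn \<gamma> \<and> \<gamma> \<rhd> \<beta>}"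

lemma rank_less:
  assumes "is_partn \<alpha>" "is_partn \<beta>" "\<alpha> \<rhd> \<beta>"
  shows "rank \<alpha> < rank \<beta>"
  unfolding rank_def
proof (rule psubset_card_mono)
  \<comment> \<open>A larger label never has more boxes. As \<open>Y\<close> halves its level, level
    \<open>2 * sum_list \<beta>\<close> contains all of them.\<close>
  show "finite {\<gamma>. is_partn \<gamma> \<and> \<gamma> \<rhd> \<beta>}"
    by (rule finite_subset[OF _ finite_Y[of "2 * sum_list \<beta>"]]) (auto simp: Y_def order_gt_def)
  show "{\<gamma>. is_partn \<gamma> \<and> \<gamma> \<rhd> \<alpha>} \<subset> {\<gamma>. is_partn \<gamma> \<and> \<gamma> \<rhd> \<beta>}"
    using assms order_gt_trans order_gt_irrefl by blast
qed

text \<open>Larger labels are the predecessors, so well-founded induction climbs along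
  \<open>\<rhd>\<close>.\<close>

definition partn_order :: "(partn \<times> partn) set" where
  "partn_order = {(\<alpha>, \<beta>). is_partn \<alpha> \<and> is_partn \<beta> \<and> \<alpha> \<rhd> \<beta>}"

lemma wf_partn_order: "wf partn_order"
  by (rule wf_subset[OF wf_measure[of rank]]) (auto simp: partn_order_def rank_less)

lemma cell_actF_sum:
  "cell_actF r k \<alpha> (\<Sum>i\<in>I. smul (c i) (f i)) a = (\<Sum>i\<in>I. smul (c i) (cell_actF r k \<alpha> (f i) a))"
proof
  fix u
  have "(\<Sum>t\<in>Std k \<alpha>. (\<Sum>i\<in>I. c i * f i t) * cell_coeff r k t u a) =
      (\<Sum>i\<in>I. c i * (\<Sum>t\<in>Std k \<alpha>. f i t * cell_coeff r k t u a))"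
    unfolding sum_distrib_left sum_distrib_right by (subst sum.swap) (simp only: mult.assoc)
  then show "cell_actF r k \<alpha> (\<Sum>i\<in>I. smul (c i) (f i)) a u =
      (\<Sum>i\<in>I. smul (c i) (cell_actF r k \<alpha> (f i) a)) u"
    by (simp add: cell_actF_apply sum_fun_apply smul_def)
qed

lemma cell_actF_add: "cell_actF r k \<alpha> (v + w) a = cell_actF r k \<alpha> v a + cell_actF r k \<alpha> w a"
  by (rule ext) (simp add: cell_actF_apply distrib_right sum.distrib)

lemma cell_actF_smul: "cell_actF r k \<alpha> (smul c v) a = smul c (cell_actF r k \<alpha> v a)"
  by (rule ext) (simp add: cell_actF_apply smul_def sum_distrib_left mult.assoc)

lemma cell_actF_zero [simp]: "cell_actF r k \<alpha> 0 a = 0"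
  by (rule ext) (simp add: cell_actF_apply)

lemma cell_actF_in: "cell_actF r k \<alpha> v a \<in> DeltaF k \<alpha>"
  by (simp add: free_mod_def cell_actF_apply)

lemma cell_actF_unit_apply:
  "t \<in> Std k \<alpha> \<Longrightarrow> cell_actF r k \<alpha> (unit_vec t) a u = (if u \<in> Std k \<alpha> then cell_coeff r k t u a else 0)"
  using finite_Std[of k \<alpha>]
  by (simp add: cell_actF_apply unit_vec_def if_distrib[of "\<lambda>a. a * _"] cong: if_cong)

lemma cell_actF_unit:
  assumes "t \<in> Std k \<alpha>"
  shows "cell_actF r k \<alpha> (unit_vec t) a = (\<Sum>u\<in>Std k \<alpha>. smul (cell_coeff r k t u a) (unit_vec u))"
proof -
  have "cell_actF r k \<alpha> (unit_vec t) a =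
      (\<Sum>u\<in>Std k \<alpha>. smul (cell_actF r k \<alpha> (unit_vec t) a u) (unit_vec u))"
    by (rule free_mod_expand[OF finite_Std cell_actF_in])
  also have "\<dots> = (\<Sum>u\<in>Std k \<alpha>. smul (cell_coeff r k t u a) (unit_vec u))"
    by (intro sum.cong refl) (simp add: cell_actF_unit_apply[OF assms])
  finally show ?thesis .
qed

section \<open>Triangular action of the path idempotents on the cell modules\<close>

context
  fixes m :: "path \<Rightarrow> path \<Rightarrow> diagram \<Rightarrow> int poly" and r :: structure_constants
  assumes murphy: "murphy_basis m r"
begin

private lemma cell: "cellular_basis m r k"
  using murphy by (simp add: murphy_basis_def)

private lemma res: "restriction_compatible r k"
  using murphy by (simp add: murphy_basis_def)

private lemmas F = F_cell[OF cell]

lemma cell_actF_mult: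
  assumes a: "a \<in> PA k" and b: "b \<in> PA k"
  shows "cell_actF r k \<alpha> (cell_actF r k \<alpha> v a) b = cell_actF r k \<alpha> v (multF k a b)"
proof
  fix u
  show "cell_actF r k \<alpha> (cell_actF r k \<alpha> v a) b u = cell_actF r k \<alpha> v (multF k a b) u"
  proof (cases "u \<in> Std k \<alpha>")
    case True
    have "cell_actF r k \<alpha> (cell_actF r k \<alpha> v a) b u =
        (\<Sum>w\<in>Std k \<alpha>. (\<Sum>t\<in>Std k \<alpha>. v t * cell_coeff r k t w a) * cell_coeff r k w u b)"
      using True by (simp add: cell_actF_apply)
    also have "\<dots> = (\<Sum>t\<in>Std k \<alpha>. v t * (\<Sum>w\<in>Std k \<alpha>. cell_coeff r k t w a * cell_coeff r k w u b))"
      unfolding sum_distrib_left sum_distrib_right by (subst sum.swap) (simp only: mult.assoc)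
    also have "\<dots> = (\<Sum>t\<in>Std k \<alpha>. v t * cell_coeff r k t u (multF k a b))"
    proof (intro sum.cong refl arg_cong[where f = "\<lambda>x. _ * x"])
      fix t assume "t \<in> Std k \<alpha>"
      then show "(\<Sum>w\<in>Std k \<alpha>. cell_coeff r k t w a * cell_coeff r k w u b) = cell_coeff r k t u (multF k a b)"
        using True cell_coeff_mult[OF cell _ _ _ a b, of t u] by (simp add: Std_iff[of t] Std_iff[of u])
    qed
    finally show ?thesis using True by (simp add: cell_actF_apply)
  next
    case False
    then show ?thesis by (simp add: cell_actF_apply)
  qed
qed

lemma cell_actF_F_cell:
  assumes "Std k \<rho> \<noteq> {}" "v \<in> DeltaF k \<alpha>"
  shows "cell_actF r k \<alpha> v (F_cell r k \<rho>) = (if \<alpha> = \<rho> then v else 0)"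
proof
  fix u
  have "(\<Sum>t\<in>Std k \<alpha>. v t * cell_coeff r k t u (F_cell r k \<rho>)) = (if \<alpha> = \<rho> then v u else 0)"
    if u: "u \<in> Std k \<alpha>"
  proof -
    have "(\<Sum>t\<in>Std k \<alpha>. v t * cell_coeff r k t u (F_cell r k \<rho>)) =
        (\<Sum>t\<in>Std k \<alpha>. if t = u then if \<alpha> = \<rho> then v u else 0 else 0)"
      using u by (intro sum.cong refl) (auto simp: F(4)[OF assms(1)] Std_iff)
    then show ?thesis using u finite_Std[of k \<alpha>] by simp
  qed
  then show "cell_actF r k \<alpha> v (F_cell r k \<rho>) u = (if \<alpha> = \<rho> then v else 0) u"
    using assms(2) by (auto simp: cell_actF_apply free_mod_def)
qed

text \<open>The last factor of \<open>F_path\<close> is the idempotent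
  \<open>F_cell r k \<rho>\<close> itself.\<close>

lemma F_path_F_cell:
  assumes s: "s \<in> Std k \<rho>"
  shows "multF k (F_path r k s) (F_cell r k \<rho>) = F_path r k s"
proof -
  have ne: "Std k \<rho> \<noteq> {}" using s by auto
  have "\<exists>x. F_path r k s = multF k x (F_cell r k \<rho>)"
    using s pa_incl_self[OF F(1)[OF ne]] by (simp add: F_path_def Std_end) blast
  then show ?thesis using pa_mult_assoc[of "to_fract z" k] F(2)[OF ne] by metis
qed

lemma cell_actF_F_path_other:
  assumes "s \<in> Std k \<beta>" "\<alpha> \<noteq> \<beta>"
  shows "cell_actF r k \<alpha> v (F_path r k s) = 0"
proof -
  have ne: "Std k \<beta> \<noteq> {}" using assms by auto
  have "cell_actF r k \<alpha> v (F_path r k s) = cell_actF r k \<alpha> (cell_actF r k \<alpha> v (F_path r k s)) (F_cell r k \<beta>)"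
    using cell_actF_mult[OF F_path_in F(1)[OF ne]] F_path_F_cell[OF assms(1)] by simp
  then show ?thesis using cell_actF_F_cell[OF ne cell_actF_in] assms(2) by simp
qed

context
  fixes k :: nat and \<nu> \<rho> :: partn
  assumes ne: "Std k \<rho> \<noteq> {}"
begin

private definition "e = pa_incl k (Suc k) (F_cell r k \<rho>)"

private abbreviation "X \<equiv> cell_actF r (Suc k) \<nu>"

private lemma e_in: "e \<in> PA (Suc k)"
  unfolding e_def by (rule pa_incl_in) simp

private lemma incl_in: "pa_incl k (Suc k) a \<in> PA (Suc k)"
  by (rule pa_incl_in) simp

private lemma e_idem: "multF (Suc k) e e = e"
  unfolding e_def using F(2)[OF ne] by (simp flip: pa_incl_mult)

private lemma e_commute:
  "a \<in> PA k \<Longrightarrow> multF (Suc k) e (pa_incl k (Suc k) a) = multF (Suc k) (pa_incl k (Suc k) a) e"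
  unfolding e_def using F(3)[OF ne, of a] by (simp flip: pa_incl_mult)

private lemma label_partn: "t \<in> Std (Suc k) \<nu> \<Longrightarrow> is_partn (t ! k)"
  using Std_in_Y[of t "Suc k" \<nu> k] Y_partn by simp

text \<open>
  The idempotent \<open>e\<close> is zero on the subquotients with label different from \<open>\<rho>\<close>, so \<open>m_t e = m_t e e\<close> lets
  the label of \<open>t\<close> grow until it is \<open>\<rho>\<close>.
\<close>

private lemma e_image:
  assumes "t \<in> Std (Suc k) \<nu>"
  shows "X (unit_vec t) e \<in> module.span smul ((\<lambda>s. X (unit_vec s) e) ` {s \<in> Std (Suc k) \<nu>. s ! k = \<rho>}) \<and>
    (\<not> (\<rho> = t ! k \<or> \<rho> \<rhd> t ! k) \<longrightarrow> X (unit_vec t) e = 0)"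
  using assms
proof (induction "rank (t ! k)" arbitrary: t rule: less_induct)
  case less
  note t = less.prems
  let ?S = "module.span smul ((\<lambda>s. X (unit_vec s) e) ` {s \<in> Std (Suc k) \<nu>. s ! k = \<rho>})"
  have \<rho>: "is_partn \<rho>" using ne Std_label_in_Y Y_partn by blast
  show ?case
  proof (cases "t ! k = \<rho>")
    case True
    then show ?thesis using t by (auto intro!: fm.span_base)
  next
    case False
    have coeff: "cell_coeff r (Suc k) t u e = 0" if u: "u \<in> Std (Suc k) \<nu>" "\<not> u ! k \<rhd> t ! k" for u
      unfolding e_def cell_coeff_restrict[OF res t u]
      using F(4)[OF ne, of "take (Suc k) t" "take (Suc k) u"] take_Std(1)[OF t] take_Std(1)[OF u(1)] False
      by (auto simp: Std_iff)
    have "X (unit_vec t) e = X (X (unit_vec t) e) e"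
      using cell_actF_mult[OF e_in e_in] e_idem by simp
    also have "\<dots> = X (\<Sum>u\<in>Std (Suc k) \<nu>. smul (cell_coeff r (Suc k) t u e) (unit_vec u)) e"
      by (simp only: cell_actF_unit[OF t])
    also have "\<dots> = (\<Sum>u\<in>Std (Suc k) \<nu>. smul (cell_coeff r (Suc k) t u e) (X (unit_vec u) e))"
      by (rule cell_actF_sum)
    finally have eq: "X (unit_vec t) e = (\<Sum>u\<in>Std (Suc k) \<nu>. smul (cell_coeff r (Suc k) t u e) (X (unit_vec u) e))" .
    have IH: "X (unit_vec u) e \<in> ?S \<and> (\<not> (\<rho> = u ! k \<or> \<rho> \<rhd> u ! k) \<longrightarrow> X (unit_vec u) e = 0)"
      if "u \<in> Std (Suc k) \<nu>" "u ! k \<rhd> t ! k" for u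
      using less.hyps[OF rank_less[OF label_partn[OF that(1)] label_partn[OF t] that(2)] that(1)] .
    have S: "smul (cell_coeff r (Suc k) t u e) (X (unit_vec u) e) \<in> ?S" if "u \<in> Std (Suc k) \<nu>" for u
      using IH[OF that] coeff[OF that] by (cases "u ! k \<rhd> t ! k") (auto intro: fm.span_scale fm.span_zero)
    have "X (unit_vec t) e \<in> ?S" unfolding eq by (rule fm.span_sum) (rule S)
    moreover have "X (unit_vec t) e = 0" if not: "\<not> (\<rho> = t ! k \<or> \<rho> \<rhd> t ! k)"
    proof -
      have Z: "smul (cell_coeff r (Suc k) t u e) (X (unit_vec u) e) = 0" if u: "u \<in> Std (Suc k) \<nu>" for u
      proof (cases "u ! k \<rhd> t ! k")
        case True
        have "\<not> (\<rho> = u ! k \<or> \<rho> \<rhd> u ! k)"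
          using not True order_gt_trans[OF \<rho> label_partn[OF u]] by blast
        then show ?thesis using IH[OF u True] by simp
      next
        case False
        then show ?thesis using coeff[OF u] by simp
      qed
      show ?thesis unfolding eq by (rule sum.neutral) (intro ballI Z)
    qed
    ultimately show ?thesis by blast
  qed
qed

text \<open>Sending \<open>m_u\<close> to \<open>m_v e\<close>, with \<open>v = u @ [\<nu>]\<close>,
  is a \<open>P_k\<close>-homomorphism from the cell module of \<open>\<rho>\<close>. As
  \<open>e\<close> commutes with \<open>P_k\<close>, the element \<open>a\<close> may act first;
  among the resulting terms, those with label larger than \<open>\<rho>\<close> are killed by
  \<open>e\<close>, and the remaining ones outside label \<open>\<rho>\<close> have zero coefficient
  by triangularity.\<close>

private lemma e_hom:
  assumes t: "t \<in> Std (Suc k) \<nu>" "t ! k = \<rho>" and a: "a \<in> PA k"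
  shows "X (X (unit_vec t) e) (pa_incl k (Suc k) a) =
    (\<Sum>u\<in>Std k \<rho>. smul (cell_coeff r k (take (Suc k) t) u a) (X (unit_vec (u @ [\<nu>])) e))"
proof -
  let ?a = "pa_incl k (Suc k) a"
  have \<rho>: "is_partn \<rho>" using label_partn[OF t(1)] t(2) by simp
  have edge: "edge k \<rho> \<nu>" using take_Std(2)[OF t(1)] t(2) by simp
  let ?g = "\<lambda>u. smul (cell_coeff r (Suc k) t u ?a) (X (unit_vec u) e)"
  have "X (X (unit_vec t) e) ?a = X (X (unit_vec t) ?a) e"
    by (simp only: cell_actF_mult[OF e_in incl_in] cell_actF_mult[OF incl_in e_in] e_commute[OF a])
  also have "\<dots> = (\<Sum>u\<in>Std (Suc k) \<nu>. ?g u)"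
    by (simp only: cell_actF_unit[OF t(1)] cell_actF_sum)
  also have "\<dots> = (\<Sum>u\<in>{u \<in> Std (Suc k) \<nu>. u ! k = \<rho>}. ?g u)"
  proof (rule sum.mono_neutral_right[OF finite_Std])
    show "\<forall>u\<in>Std (Suc k) \<nu> - {u \<in> Std (Suc k) \<nu>. u ! k = \<rho>}. ?g u = 0"
    proof
      fix u assume "u \<in> Std (Suc k) \<nu> - {u \<in> Std (Suc k) \<nu>. u ! k = \<rho>}"
      then have u: "u \<in> Std (Suc k) \<nu>" "u ! k \<noteq> \<rho>" by auto
      show "?g u = 0"
      proof (cases "u ! k \<rhd> \<rho>")
        case True
        then have "\<not> \<rho> \<rhd> u ! k" using order_gt_asym[OF label_partn[OF u(1)] \<rho>] by blast
        then show ?thesis using e_image[OF u(1)] u(2) by auto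
      next
        case False
        then show ?thesis using cell_coeff_restrict[OF res t(1) u(1)] u(2) t(2) by simp
      qed
    qed
  qed auto
  also have "\<dots> = (\<Sum>u\<in>Std k \<rho>. smul (cell_coeff r k (take (Suc k) t) u a) (X (unit_vec (u @ [\<nu>])) e))"
  proof (rule sum.reindex_bij_witness[of _ "\<lambda>u. u @ [\<nu>]" "take (Suc k)"])
    fix u assume "u \<in> {u \<in> Std (Suc k) \<nu>. u ! k = \<rho>}"
    then have u: "u \<in> Std (Suc k) \<nu>" "u ! k = \<rho>" by auto
    show "take (Suc k) u @ [\<nu>] = u" "take (Suc k) u \<in> Std k \<rho>" using take_Std[OF u(1)] u(2) by auto
    show "smul (cell_coeff r k (take (Suc k) t) (take (Suc k) u) a) (X (unit_vec (take (Suc k) u @ [\<nu>])) e) = ?g u"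
      using take_Std(3)[OF u(1)] cell_coeff_restrict[OF res t(1) u(1)] u(2) t(2) order_gt_irrefl by simp
  next
    fix u assume "u \<in> Std k \<rho>"
    then show "take (Suc k) (u @ [\<nu>]) = u" "u @ [\<nu>] \<in> {u \<in> Std (Suc k) \<nu>. u ! k = \<rho>}"
      using append_Std[OF _ edge] by auto
  qed
  finally show ?thesis .
qed

text \<open>On the module of \<open>\<nu>\<close> the last cell idempotent is the identity, so
  \<open>m_t F_s\<close> arises by applying the idempotent of the truncated path to
  \<open>m_t e\<close>. This vector is a combination of vectors \<open>m_u e\<close> with
  \<open>u ! k = \<rho>\<close>, where \<open>e_hom\<close> reduces the question to level
  \<open>k\<close>; the assumption says that the matrix there has proportional rows.\<close>

lemma F_path_step:
  assumes s: "s \<in> Std (Suc k) \<nu>" "s ! k = \<rho>"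
    and IH: "\<And>t. t \<in> Std k \<rho> \<Longrightarrow> \<exists>c. \<forall>u\<in>Std k \<rho>.
      cell_coeff r k t u (F_path r k (take (Suc k) s)) =
      c * cell_coeff r k (take (Suc k) s) u (F_path r k (take (Suc k) s))"
    and t: "t \<in> Std (Suc k) \<nu>"
  shows "\<exists>c. X (unit_vec t) (F_path r (Suc k) s) = smul c (X (unit_vec s) (F_path r (Suc k) s))"
    and "\<not> (\<rho> = t ! k \<or> \<rho> \<rhd> t ! k) \<Longrightarrow> X (unit_vec t) (F_path r (Suc k) s) = 0"
    and "t ! k = \<rho> \<Longrightarrow> \<forall>u\<in>Std k \<rho>. cell_coeff r k (take (Suc k) t) u (F_path r k (take (Suc k) s)) = 0 \<Longrightarrow>
      X (unit_vec t) (F_path r (Suc k) s) = 0"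
proof -
  let ?s = "take (Suc k) s"
  let ?a = "F_path r k ?s"
  let ?a' = "pa_incl k (Suc k) ?a"
  have s': "?s \<in> Std k \<rho>" using take_Std(1)[OF s(1)] s(2) by simp
  have ne': "Std (Suc k) \<nu> \<noteq> {}" using s by auto
  \<comment> \<open>The last factor of the truncated path idempotent is central on level
    \<open>k\<close>, so it can be repeated in front.\<close>
  have a': "?a' = multF (Suc k) e ?a'"
    using F(3)[OF ne F_path_in] F_path_F_cell[OF s'] unfolding e_def by (simp flip: pa_incl_mult)
  have path: "X v (F_path r (Suc k) s) = X (X v e) ?a'" for v
  proof -
    have "F_path r (Suc k) s = multF (Suc k) ?a' (F_cell r (Suc k) \<nu>)"
      using s(1) by (simp add: F_path_Suc Std_end pa_incl_self[OF F(1)[OF ne']])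
    then have "X v (F_path r (Suc k) s) = X (X v ?a') (F_cell r (Suc k) \<nu>)"
      by (simp only: cell_actF_mult[OF incl_in F(1)[OF ne']])
    also have "\<dots> = X v ?a'" using cell_actF_F_cell[OF ne' cell_actF_in] by simp
    also have "\<dots> = X (X v e) ?a'" using cell_actF_mult[OF e_in incl_in] a' by metis
    finally show ?thesis .
  qed
  let ?y = "X (unit_vec s) (F_path r (Suc k) s)"
  have line: "\<exists>c. X (X (unit_vec t) e) ?a' = smul c ?y" if t: "t \<in> Std (Suc k) \<nu>" "t ! k = \<rho>" for t
  proof -
    have "take (Suc k) t \<in> Std k \<rho>" using take_Std(1)[OF t(1)] t(2) by simp
    then obtain c where c: "\<And>u. u \<in> Std k \<rho> \<Longrightarrow>
        cell_coeff r k (take (Suc k) t) u ?a = c * cell_coeff r k ?s u ?a" using IH by blast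
    have "X (X (unit_vec t) e) ?a' =
        (\<Sum>u\<in>Std k \<rho>. smul c (smul (cell_coeff r k ?s u ?a) (X (unit_vec (u @ [\<nu>])) e)))"
      unfolding e_hom[OF t F_path_in] by (intro sum.cong refl) (simp add: c)
    also have "\<dots> = smul c ?y"
      unfolding path e_hom[OF s F_path_in] by (rule fm.scale_sum_right[symmetric])
    finally show ?thesis by blast
  qed
  have "X (unit_vec t) e \<in> module.span smul ((\<lambda>s. X (unit_vec s) e) ` {s \<in> Std (Suc k) \<nu>. s ! k = \<rho>})"
    using e_image[OF t] by blast
  then have "\<exists>c. X (X (unit_vec t) e) ?a' = smul c ?y"
  proof (induction rule: fm.span_induct_alt)
    case base
    then show ?case by (intro exI[of _ 0]) (simp flip: zero_fun_def)
  next
    case (step c x y)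
    then obtain c1 c2 where "X x ?a' = smul c1 ?y" "X y ?a' = smul c2 ?y" using line by blast
    then have "X (smul c x + y) ?a' = smul (c * c1 + c2) ?y"
      by (simp add: cell_actF_add cell_actF_smul fm.scale_left_distrib)
    then show ?case by (intro exI)
  qed
  then show "\<exists>c. X (unit_vec t) (F_path r (Suc k) s) = smul c ?y" by (simp only: path)
  show "X (unit_vec t) (F_path r (Suc k) s) = 0" if "\<not> (\<rho> = t ! k \<or> \<rho> \<rhd> t ! k)"
    using e_image[OF t] that by (simp add: path)
  show "X (unit_vec t) (F_path r (Suc k) s) = 0"
    if "t ! k = \<rho>" "\<forall>u\<in>Std k \<rho>. cell_coeff r k (take (Suc k) t) u ?a = 0"
    unfolding path e_hom[OF t that(1) F_path_in] using that(2) by (intro sum.neutral ballI) simp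
qed

end

text \<open>Restriction removes the last step first, so paths are compared from their ends, whence
  \<open>rev\<close>. If \<open>s\<close> and \<open>t\<close> agree on level \<open>k\<close>, the
  comparison passes to the truncations; otherwise the label of \<open>s\<close> is larger there or
  the vector is zero.\<close>

lemma F_path_triangular:
  assumes "s \<in> Std k \<alpha>" "t \<in> Std k \<alpha>"
  shows "(\<exists>c. cell_actF r k \<alpha> (unit_vec t) (F_path r k s) = smul c (cell_actF r k \<alpha> (unit_vec s) (F_path r k s))) \<and>
    (s = t \<or> (rev s, rev t) \<in> lex partn_order \<or> cell_actF r k \<alpha> (unit_vec t) (F_path r k s) = 0)"
  using assms
proof (induction k arbitrary: \<alpha> s t)
  case 0
  have single: "s = [[]]" if "s \<in> Std 0 \<alpha>" for s
    using that by (cases s) (auto simp: Std_def)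
  from 0 have "s = t" using single[of s] single[of t] by simp
  then show ?case by (intro conjI exI[of _ 1] disjI1) simp_all
next
  case (Suc k)
  note s = Suc.prems(1) and t = Suc.prems(2)
  define \<rho> where "\<rho> = s ! k"
  let ?s = "take (Suc k) s" and ?t = "take (Suc k) t"
  note s' = take_Std[OF s, folded \<rho>_def] and t' = take_Std[OF t]
  have ne: "Std k \<rho> \<noteq> {}" using s'(1) by auto
  have unit: "cell_actF r k \<rho> (unit_vec t) (F_path r k ?s) u = cell_coeff r k t u (F_path r k ?s)"
    if "t \<in> Std k \<rho>" "u \<in> Std k \<rho>" for t u
    using that by (simp add: cell_actF_unit_apply)
  have IH: "\<exists>c. \<forall>u\<in>Std k \<rho>. cell_coeff r k t u (F_path r k ?s) = c * cell_coeff r k ?s u (F_path r k ?s)"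
    if t: "t \<in> Std k \<rho>" for t
  proof -
    obtain c where c: "cell_actF r k \<rho> (unit_vec t) (F_path r k ?s) =
        smul c (cell_actF r k \<rho> (unit_vec ?s) (F_path r k ?s))"
      using Suc.IH[OF s'(1) t] by blast
    have "cell_coeff r k t u (F_path r k ?s) = c * cell_coeff r k ?s u (F_path r k ?s)"
      if u: "u \<in> Std k \<rho>" for u
      using fun_cong[OF c, of u] unit[OF t u] unit[OF s'(1) u] by (simp add: smul_def)
    then show ?thesis by blast
  qed
  note step = F_path_step[OF ne s \<rho>_def[symmetric] IH t]
  have rev: "rev s = \<alpha> # rev ?s" "rev t = \<alpha> # rev ?t"
    by (subst s'(3)[symmetric], simp) (subst t'(3)[symmetric], simp)
  have "s = t \<or> (rev s, rev t) \<in> lex partn_order \<or> cell_actF r (Suc k) \<alpha> (unit_vec t) (F_path r (Suc k) s) = 0"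
  proof (cases "t ! k = \<rho>")
    case True
    then have t'': "?t \<in> Std k \<rho>" using t'(1) by simp
    from Suc.IH[OF s'(1) t''] consider "?s = ?t" | "(rev ?s, rev ?t) \<in> lex partn_order"
      | "cell_actF r k \<rho> (unit_vec ?t) (F_path r k ?s) = 0" by blast
    then show ?thesis
    proof cases
      case 1
      then show ?thesis using s'(3) t'(3) by metis
    next
      case 2
      then show ?thesis unfolding rev by simp
    next
      case 3
      have "\<forall>u\<in>Std k \<rho>. cell_coeff r k ?t u (F_path r k ?s) = 0"
        using unit[OF t''] unfolding 3 by simp
      then show ?thesis using step(3)[OF _ True] by blast
    qed
  next
    case False
    show ?thesis
    proof (cases "\<rho> \<rhd> t ! k")
      case True
      \<comment> \<open>Exposes the labels on level \<open>k\<close> as heads of the reversed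
        truncations, where \<open>lex\<close> sees the first difference; \<open>lex\<close> also
        asks for equal lengths.\<close>
      have last: "rev v = \<gamma> # rev (butlast v)" "length v = Suc k" if "v \<in> Std k \<gamma>" for v \<gamma>
      proof -
        show len: "length v = Suc k" using that by (simp add: Std_def)
        then have "v \<noteq> []" by auto
        moreover have "last v = \<gamma>" using that len \<open>v \<noteq> []\<close> by (simp add: last_conv_nth Std_def)
        ultimately show "rev v = \<gamma> # rev (butlast v)" using append_butlast_last_id[of v] by (metis rev_eq_Cons_iff rev_rev_ident)
      qed
      have "(\<rho>, t ! k) \<in> partn_order"
        using True Std_label_in_Y[OF s'(1)] Std_label_in_Y[OF t'(1)] Y_partn by (auto simp: partn_order_def)
      then have "(rev ?s, rev ?t) \<in> lex partn_order"
        unfolding last(1)[OF s'(1)] last(1)[OF t'(1)] using last(2)[OF s'(1)] last(2)[OF t'(1)] by simp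
      then show ?thesis unfolding rev by simp
    next
      case no: False
      then show ?thesis using step(2) False by metis
    qed
  qed
  then show ?case using step(1) by blast
qed

end


section \<open>Spans of residue class vectors\<close>

definition seminormal :: "structure_constants \<Rightarrow> nat \<Rightarrow> partn \<Rightarrow> path \<Rightarrow> path \<Rightarrow> int poly fract" where
  "seminormal r k \<alpha> s = cell_actF r k \<alpha> (unit_vec s) (F_path r k s)"

lemma cell_actF_sum_right: "cell_actF r k \<alpha> v (\<Sum>i\<in>I. f i) = (\<Sum>i\<in>I. cell_actF r k \<alpha> v (f i))"
proof
  fix u
  have coeff: "cell_coeff r k t u (\<Sum>i\<in>I. f i) = (\<Sum>i\<in>I. cell_coeff r k t u (f i))" for t
    unfolding cell_coeff_def sum_fun_apply sum_distrib_right by (rule sum.swap)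
  have "(\<Sum>t\<in>Std k \<alpha>. v t * cell_coeff r k t u (\<Sum>i\<in>I. f i)) =
      (\<Sum>i\<in>I. \<Sum>t\<in>Std k \<alpha>. v t * cell_coeff r k t u (f i))"
    unfolding coeff sum_distrib_left by (rule sum.swap)
  then show "cell_actF r k \<alpha> v (\<Sum>i\<in>I. f i) u = (\<Sum>i\<in>I. cell_actF r k \<alpha> v (f i)) u"
    by (simp add: cell_actF_apply sum_fun_apply)
qed

lemma f_tilde_eq:
  assumes "murphy_basis m r"
  shows "f_tilde r n k \<alpha> t =
    (\<Sum>s\<in>residue_class n k t \<inter> Std k \<alpha>. cell_actF r k \<alpha> (unit_vec t) (F_path r k s))"
proof -
  have "f_tilde r n k \<alpha> t = (\<Sum>s\<in>residue_class n k t. cell_actF r k \<alpha> (unit_vec t) (F_path r k s))"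
    by (simp only: f_tilde_def F_class_def cell_actF_sum_right)
  also have "\<dots> = (\<Sum>s\<in>residue_class n k t \<inter> Std k \<alpha>. cell_actF r k \<alpha> (unit_vec t) (F_path r k s))"
  proof (rule sum.mono_neutral_right)
    show "finite (residue_class n k t)"
      by (rule finite_subset[OF _ finite_Std_all[of k]]) (auto simp: residue_class_def)
    show "\<forall>s\<in>residue_class n k t - residue_class n k t \<inter> Std k \<alpha>.
        cell_actF r k \<alpha> (unit_vec t) (F_path r k s) = 0"
    proof
      fix s assume "s \<in> residue_class n k t - residue_class n k t \<inter> Std k \<alpha>"
      then have "s \<in> Std k (s ! k)" "s ! k \<noteq> \<alpha>" by (auto simp: residue_class_def Std_iff)
      then show "cell_actF r k \<alpha> (unit_vec t) (F_path r k s) = 0"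
        using cell_actF_F_path_other[OF assms] by metis
    qed
  qed auto
  finally show ?thesis .
qed

text \<open>Closure under residue classes keeps the expansion of each \<open>f_tilde\<close> inside
  \<open>P\<close>: it is the seminormal vector of the same path plus multiples of those of smaller
  paths in the order. Well-founded induction inverts this unitriangular system.\<close>

lemma span_f_tilde:
  assumes murphy: "murphy_basis m r" and P: "P \<subseteq> Std k \<alpha>"
    and closed: "\<And>t s. t \<in> P \<Longrightarrow> s \<in> residue_class n k t \<Longrightarrow> s \<in> Std k \<alpha> \<Longrightarrow> s \<in> P"
  shows "module.span smul (f_tilde r n k \<alpha> ` P) = module.span smul (seminormal r k \<alpha> ` P)"
proof
  have line: "\<exists>c. cell_actF r k \<alpha> (unit_vec t) (F_path r k s) = smul c (seminormal r k \<alpha> s)"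
    if "t \<in> P" "s \<in> P" for s t
    using F_path_triangular[OF murphy, of s k \<alpha> t] P that unfolding seminormal_def by blast
  have "f_tilde r n k \<alpha> t \<in> module.span smul (seminormal r k \<alpha> ` P)" if t: "t \<in> P" for t
    unfolding f_tilde_eq[OF murphy]
  proof (rule fm.span_sum)
    fix s assume "s \<in> residue_class n k t \<inter> Std k \<alpha>"
    then have "s \<in> P" using closed t by blast
    then obtain c where "cell_actF r k \<alpha> (unit_vec t) (F_path r k s) = smul c (seminormal r k \<alpha> s)"
      using line t by blast
    then show "cell_actF r k \<alpha> (unit_vec t) (F_path r k s) \<in> module.span smul (seminormal r k \<alpha> ` P)"
      using \<open>s \<in> P\<close> by (simp add: fm.span_scale fm.span_base)
  qed
  then show "module.span smul (f_tilde r n k \<alpha> ` P) \<subseteq> module.span smul (seminormal r k \<alpha> ` P)"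
    by (intro fm.span_minimal image_subsetI fm.subspace_span) blast
  let ?S = "module.span smul (f_tilde r n k \<alpha> ` P)"
  have wf: "wf (inv_image (lex partn_order) rev)"
    by (intro wf_inv_image wf_lex wf_partn_order)
  have "s \<in> P \<longrightarrow> seminormal r k \<alpha> s \<in> ?S" for s
  proof (induction s rule: wf_induct_rule[OF wf])
    case (1 s)
    show ?case
    proof
      assume s: "s \<in> P"
      let ?C = "residue_class n k s \<inter> Std k \<alpha>"
      let ?y = "\<lambda>s'. cell_actF r k \<alpha> (unit_vec s) (F_path r k s')"
      have fin: "finite ?C" using finite_Std[of k \<alpha>] by blast
      have sC: "s \<in> ?C" using s P by (auto simp: residue_class_def Std_iff)
      have "f_tilde r n k \<alpha> s = seminormal r k \<alpha> s + (\<Sum>s'\<in>?C - {s}. ?y s')"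
        unfolding f_tilde_eq[OF murphy] seminormal_def by (rule sum.remove[OF fin sC])
      then have eq: "seminormal r k \<alpha> s = f_tilde r n k \<alpha> s - (\<Sum>s'\<in>?C - {s}. ?y s')" by simp
      have "?y s' \<in> ?S" if s': "s' \<in> ?C - {s}" for s'
      proof -
        have s'P: "s' \<in> P" using closed[OF s] s' by blast
        have Std: "s' \<in> Std k \<alpha>" "s \<in> Std k \<alpha>" using s s'P P by blast+
        from F_path_triangular[OF murphy Std] s' consider "(rev s', rev s) \<in> lex partn_order" | "?y s' = 0"
          by blast
        then show ?thesis
        proof cases
          case 1
          then have "seminormal r k \<alpha> s' \<in> ?S" using "1.IH"[of s'] s'P by simp
          moreover obtain c where "?y s' = smul c (seminormal r k \<alpha> s')" using line[OF s s'P] by blast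
          ultimately show ?thesis by (simp add: fm.span_scale)
        next
          case 2
          then show ?thesis by (simp only: fm.span_zero)
        qed
      qed
      then have "(\<Sum>s'\<in>?C - {s}. ?y s') \<in> ?S" by (rule fm.span_sum)
      moreover have "f_tilde r n k \<alpha> s \<in> ?S" using s by (intro fm.span_base imageI)
      ultimately show "seminormal r k \<alpha> s \<in> ?S" unfolding eq by (intro fm.span_diff)
    qed
  qed
  then show "module.span smul (seminormal r k \<alpha> ` P) \<subseteq> ?S"
    by (intro fm.span_minimal image_subsetI fm.subspace_span) blast
qed

section \<open>Extension of scalars from the localisation to the field\<close>

lemma z_minus_of_nat: "z - of_nat n = [:- int n, 1:]"
  by (simp add: z_def of_nat_poly)

lemma span_loc_span: "module.span smul (loc_span n B) = module.span smul B"
proof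
  have "loc_span n B \<subseteq> module.span smul B"
    by (auto simp: loc_span_def intro!: fm.span_sum fm.span_scale intro: fm.span_base)
  then show "module.span smul (loc_span n B) \<subseteq> module.span smul B"
    by (intro fm.span_minimal fm.subspace_span)
  have one: "1 \<in> loc_ring n"
  proof -
    have "\<not> (z - of_nat n) dvd (1 :: int poly)"
      unfolding z_minus_of_nat by (simp flip: poly_eq_0_iff_dvd)
    then show ?thesis by (auto simp: loc_ring_def One_fract_def)
  qed
  have "b \<in> loc_span n B" if "b \<in> B" for b
    unfolding loc_span_def using that one
    by (intro CollectI exI[of _ "{b}"] exI[of _ "\<lambda>_. 1"]) auto
  then show "module.span smul B \<subseteq> module.span smul (loc_span n B)"
    by (intro fm.span_mono) blast
qed

lemma Delta_sub_eq:
  "Delta_sub r n k \<alpha> = module.span smul (f_tilde r n k \<alpha> ` (Std k \<alpha> - Std_perm n k \<alpha>))"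
  unfolding Delta_sub_def Delta_loc_def span_loc_span by (intro arg_cong[where f = "module.span smul"]) auto

lemma Delta_sub_subset: "Delta_sub r n k \<alpha> \<subseteq> DeltaF k \<alpha>"
  unfolding Delta_sub_eq
proof (rule fm.span_minimal)
  show "f_tilde r n k \<alpha> ` (Std k \<alpha> - Std_perm n k \<alpha>) \<subseteq> DeltaF k \<alpha>"
    by (intro image_subsetI) (simp add: f_tilde_def cell_actF_in)
  show "module.subspace smul (DeltaF k \<alpha>)"
    by (auto simp: fm.subspace_def free_mod_def smul_def)
qed


section \<open>Residues of permissible paths\<close>

text \<open>A denominator not divisible by \<open>z - n\<close> does not vanish at \<open>n\<close>,
  so any representing fraction gives the same value.\<close>

lemma specialise_to_fract: "specialise n (to_fract p) = of_int (poly p (int n))"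
  unfolding specialise_def
proof (rule the_equality)
  show "\<exists>a b. \<not> (z - of_nat n) dvd b \<and> to_fract p = Fract a b \<and>
      of_int (poly p (int n)) = of_int (poly a (int n)) / (of_int (poly b (int n)) :: rat)"
  proof (intro exI conjI)
    show "\<not> (z - of_nat n) dvd (1 :: int poly)"
      unfolding z_minus_of_nat by (simp flip: poly_eq_0_iff_dvd)
    show "to_fract p = Fract p 1" by (simp add: Fract_conv_to_fract)
  qed simp
  fix q :: rat
  assume "\<exists>a b. \<not> (z - of_nat n) dvd b \<and> to_fract p = Fract a b \<and>
      q = of_int (poly a (int n)) / of_int (poly b (int n))"
  then obtain a b where ab: "\<not> (z - of_nat n) dvd b" "to_fract p = Fract a b"
    "q = of_int (poly a (int n)) / of_int (poly b (int n))" by blast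
  have b: "poly b (int n) \<noteq> 0" using ab(1) unfolding z_minus_of_nat poly_eq_0_iff_dvd .
  then have "b \<noteq> 0" by auto
  then have "to_fract (p * b) = to_fract a"
    using ab(2) by (simp add: Fract_conv_to_fract)
  then have "p * b = a" by (simp only: to_fract_eq_iff)
  then show "q = of_int (poly p (int n))" using ab(3) b by auto
qed

lemma poly_z [simp]: "poly z x = x"
  by (simp add: z_def)

lemma in_alcove_1_decreasing:
  assumes "in_alcove 1 x" "i < j"
  shows "x j < x i"
  using assms lift_Suc_antimono_le[of "\<lambda>i. x i"] lift_Suc_mono_less[of "\<lambda>i. - x i" i j]
  by (simp add: in_alcove_def)

lemma in_alcove_1_inj: "in_alcove 1 x \<Longrightarrow> x i = x j \<Longrightarrow> i = j"
  using in_alcove_1_decreasing[of x i j] in_alcove_1_decreasing[of x j i]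
  by (cases i j rule: linorder_cases) auto

text \<open>Rows of \<open>boxes\<close> are initial segments, so a single new box can only stand at
  the end of its row.\<close>

lemma add_box_row:
  assumes "add_box \<mu> \<alpha>"
  obtains p where "1 \<le> p" "\<And>i. 1 \<le> i \<Longrightarrow> part \<alpha> i = part \<mu> i + (if i = p then 1 else 0)"
    "the_elem (boxes \<alpha> - boxes \<mu>) = (p, part \<alpha> p)"
proof -
  obtain p q where b: "(p, q) \<notin> boxes \<mu>" "boxes \<alpha> = insert (p, q) (boxes \<mu>)"
    using assms by (auto simp: add_box_def)
  have iff: "j \<le> part \<alpha> i \<longleftrightarrow> j \<le> part \<mu> i \<or> (i = p \<and> j = q)" if "1 \<le> i" "1 \<le> j" for i j
    using b(2) that unfolding boxes_def set_eq_iff by auto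
  have "(p, q) \<in> boxes \<alpha>" using b(2) by simp
  then have pq: "1 \<le> p" "1 \<le> q" "q \<le> part \<alpha> p" "\<not> q \<le> part \<mu> p"
    using b(1) by (auto simp: boxes_def)
  have "q = part \<mu> p + 1" "part \<alpha> p = part \<mu> p + 1"
    using iff[OF pq(1), of "part \<mu> p + 1"] iff[OF pq(1), of "q - 1"] iff[OF pq(1), of "part \<alpha> p"]
      iff[OF pq(1), of "q"] pq by auto
  moreover have "part \<alpha> i = part \<mu> i" if "1 \<le> i" "i \<noteq> p" for i
  proof (rule antisym)
    show "part \<alpha> i \<le> part \<mu> i" using iff[OF that(1), of "part \<alpha> i"] that(2) by (cases "part \<alpha> i") auto
    show "part \<mu> i \<le> part \<alpha> i" using iff[OF that(1), of "part \<mu> i"] that(2) by (cases "part \<mu> i") auto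
  qed
  moreover have "boxes \<alpha> - boxes \<mu> = {(p, q)}" using b by auto
  ultimately show ?thesis using that[of p] pq(1) by simp
qed

lemma phi_Suc: "1 \<le> j \<Longrightarrow> phi n \<mu> i j = int (part \<mu> j) - int j"
  by (simp add: phi_def bracket_def)

text \<open>
  The witness \<open>j\<close> is the row of the box that is added or removed, and \<open>0\<close> if the partition does not change.
\<close>

lemma edge_residue:
  assumes e: "edge i \<mu> \<alpha>" and t: "t ! i = \<mu>" "t ! Suc i = \<alpha>"
  obtains j where "poly (residue t (Suc i)) (int n) =
      (if even i then int n - phi n \<mu> i j else phi n \<mu> i j + 1)"
    "\<And>l. 1 \<le> l \<Longrightarrow> (if even i then part \<mu> l = part \<alpha> l + (if l = j then 1 else 0)
      else part \<alpha> l = part \<mu> l + (if l = j then 1 else 0))"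
proof (cases "\<alpha> = \<mu>")
  case True
  show ?thesis
  proof (rule that[of 0])
    \<comment> \<open>If no box moves, the residue is governed by coordinate 0, which is
      \<open>n - |\<mu>|\<close> for even \<open>i\<close> and \<open>n - 1 - |\<mu>|\<close> for
      odd \<open>i\<close>. The shift at odd levels is what lets one formula cover this case and
      that of a moved box.\<close>
    show "poly (residue t (Suc i)) (int n) =
      (if even i then int n - phi n \<mu> i 0 else phi n \<mu> i 0 + 1)"
      using True t by (simp add: residue_def phi_def bracket_def)
  qed (use True in auto)
next
  case False
  show ?thesis
  proof (cases "even i")
    case True
    then have "add_box \<alpha> \<mu>" using e False by (auto simp: edge_def)
    then obtain p where p: "1 \<le> p" "\<And>l. 1 \<le> l \<Longrightarrow> part \<mu> l = part \<alpha> l + (if l = p then 1 else 0)"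
      "the_elem (boxes \<mu> - boxes \<alpha>) = (p, part \<mu> p)" by (rule add_box_row) metis
    show ?thesis
      by (rule that[of p]) (use p True False t in \<open>simp_all add: residue_def phi_Suc\<close>)
  next
    case odd: False
    then have "add_box \<mu> \<alpha>" using e False by (auto simp: edge_def)
    then obtain p where p: "1 \<le> p" "\<And>l. 1 \<le> l \<Longrightarrow> part \<alpha> l = part \<mu> l + (if l = p then 1 else 0)"
      "the_elem (boxes \<alpha> - boxes \<mu>) = (p, part \<alpha> p)" by (rule add_box_row) metis
    show ?thesis
      by (rule that[of p]) (use p odd False t in \<open>simp_all add: residue_def phi_Suc\<close>)
  qed
qed

lemma residue_determines_step:
  assumes s: "edge i \<mu> \<alpha>" "s ! i = \<mu>" "s ! Suc i = \<alpha>" and t: "edge i \<mu> \<beta>" "t ! i = \<mu>" "t ! Suc i = \<beta>"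
    and alcove: "in_alcove 1 (phi n \<mu> i)"
    and eq: "spec_residue n s (Suc i) = spec_residue n t (Suc i)"
  shows "\<alpha> = \<beta>"
proof -
  have eq': "poly (residue s (Suc i)) (int n) = poly (residue t (Suc i)) (int n)"
    using eq by (simp add: spec_residue_def specialise_to_fract)
  obtain j where j: "poly (residue s (Suc i)) (int n) = (if even i then int n - phi n \<mu> i j else phi n \<mu> i j + 1)"
    "\<And>l. 1 \<le> l \<Longrightarrow> (if even i then part \<mu> l = part \<alpha> l + (if l = j then 1 else 0)
      else part \<alpha> l = part \<mu> l + (if l = j then 1 else 0))"
    using edge_residue[OF s, where n = n] by blast
  obtain j' where j': "poly (residue t (Suc i)) (int n) = (if even i then int n - phi n \<mu> i j' else phi n \<mu> i j' + 1)"
    "\<And>l. 1 \<le> l \<Longrightarrow> (if even i then part \<mu> l = part \<beta> l + (if l = j' then 1 else 0)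
      else part \<beta> l = part \<mu> l + (if l = j' then 1 else 0))"
    using edge_residue[OF t, where n = n] by blast
  have "phi n \<mu> i j = phi n \<mu> i j'" using eq' j(1) j'(1) by (simp split: if_splits)
  then have "j = j'" by (rule in_alcove_1_inj[OF alcove])
  show ?thesis
  proof (rule partn_eqI)
    show "is_partn \<alpha>" "is_partn \<beta>" using s(1) t(1) by (auto simp: edge_def Y_def)
    show "part \<alpha> l = part \<beta> l" if "1 \<le> l" for l
      using j(2)[OF that] j'(2)[OF that] \<open>j = j'\<close> by (cases "even i") auto
  qed
qed

text \<open>The residues rebuild the path step by step. Once the paths agree on level
  \<open>i\<close>, the alcove condition on \<open>t ! i\<close> makes the next step unique.\<close>

lemma residue_class_singleton:
  assumes t: "t \<in> Std_all k" and s: "s \<in> residue_class n k t"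
    and alcove: "\<And>i. i \<le> k \<Longrightarrow> in_alcove 1 (phi n (t ! i) i)"
  shows "s = t"
proof -
  have Std: "s \<in> Std k (s ! k)" "t \<in> Std k (t ! k)"
    using s t by (auto simp: residue_class_def Std_iff)
  have "s ! i = t ! i" if "i \<le> k" for i
    using that
  proof (induction i)
    case 0
    then show ?case using Std by (simp add: Std_def)
  next
    case (Suc i)
    then have i: "s ! i = t ! i" "i \<le> k" "i < k" by auto
    have "edge i (t ! i) (s ! Suc i)" "edge i (t ! i) (t ! Suc i)"
      using Std i by (auto simp: Std_def)
    moreover have "spec_residue n s (Suc i) = spec_residue n t (Suc i)"
      using s Suc.prems by (auto simp: residue_class_def)
    ultimately show ?case
      using residue_determines_step[OF _ i(1) refl _ refl refl alcove[OF i(2)]] by blast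
  qed
  then show ?thesis
    using Std by (intro nth_equalityI) (auto simp: Std_def)
qed

text \<open>Lying on a wall or in a later alcove requires coordinate 0 to be at most some later
  coordinate, contrary to strict decrease.\<close>

lemma permissible_first_alcove:
  assumes "in_alcove 1 (phi n \<nu> k)"
  shows "permissible n k \<nu> t \<longleftrightarrow> (\<forall>i\<le>k. in_alcove 1 (phi n (t ! i) i))"
proof -
  have "\<not> on_wall j (phi n \<nu> k)" for j
    using in_alcove_1_inj[OF assms, of 0 j] by (auto simp: on_wall_def)
  moreover have "\<not> in_alcove j (phi n \<nu> k)" if "2 \<le> j" for j
  proof
    assume "in_alcove j (phi n \<nu> k)"
    then have "phi n \<nu> k 0 < phi n \<nu> k (j - 1)" using that by (simp add: in_alcove_def)
    moreover have "phi n \<nu> k (j - 1) < phi n \<nu> k 0"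
      by (rule in_alcove_1_decreasing[OF assms]) (use that in simp)
    ultimately show False by simp
  qed
  ultimately show ?thesis using assms unfolding permissible_def by blast
qed

text \<open>Passing to \<open>n + 1\<close> raises coordinate 0 by one and changes no other, so
  strict decrease persists.\<close>

lemma in_alcove_1_mono:
  assumes "in_alcove 1 (phi n \<alpha> i)"
  shows "in_alcove 1 (phi (n + 1) \<alpha> i)"
proof -
  have "phi (n + 1) \<alpha> i j = phi n \<alpha> i j + (if j = 0 then 1 else 0)" for j
    by (simp add: phi_def bracket_def)
  moreover have "phi n \<alpha> i (Suc j) < phi n \<alpha> i j" for j
    using assms by (simp add: in_alcove_def)
  ultimately have "phi (n + 1) \<alpha> i (Suc j) < phi (n + 1) \<alpha> i j" for j
    by (simp only:) (smt (verit) nat.distinct(2))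
  then show ?thesis by (simp add: in_alcove_def)
qed

lemma Delta_sub_seminormal:
  assumes "murphy_basis m r" "in_alcove 1 (phi n \<nu> k)"
  shows "Delta_sub r n k \<nu> = module.span smul (seminormal r k \<nu> ` (Std k \<nu> - Std_perm n k \<nu>))"
  unfolding Delta_sub_eq
proof (rule span_f_tilde[OF assms(1)])
  fix t s assume t: "t \<in> Std k \<nu> - Std_perm n k \<nu>" and s: "s \<in> residue_class n k t" "s \<in> Std k \<nu>"
  show "s \<in> Std k \<nu> - Std_perm n k \<nu>"
  proof (rule ccontr)
    assume "s \<notin> Std k \<nu> - Std_perm n k \<nu>"
    then have "\<forall>i\<le>k. in_alcove 1 (phi n (s ! i) i)" "s \<in> Std_perm n k \<nu>"
      using s(2) permissible_first_alcove[OF assms(2)] by (auto simp: Std_perm_def)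
    moreover have "s \<in> Std_all k" "t \<in> residue_class n k s"
      using s t by (auto simp: residue_class_def Std_iff)
    ultimately have "t = s" using residue_class_singleton by blast
    then show False using t \<open>s \<in> Std_perm n k \<nu>\<close> by simp
  qed
qed blast

theorem proposition7p6:
  fixes m :: "path \<Rightarrow> path \<Rightarrow> diagram \<Rightarrow> int poly"
    and r :: structure_constants
    and n k :: nat
    and \<nu> :: partn
  assumes "murphy_basis m r"
    and "\<nu> \<in> Y k"
    and "in_alcove 1 (phi n \<nu> k)"
  shows "Delta_sub r (n + 1) k \<nu> \<subseteq> Delta_sub r n k \<nu> \<and> Delta_sub r n k \<nu> \<subseteq> DeltaF k \<nu>"
proof
  have alcove: "in_alcove 1 (phi (n + 1) \<nu> k)" by (rule in_alcove_1_mono[OF assms(3)])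
  \<comment> \<open>Permissible paths are left out of the spanning sets, so more of them gives a
    smaller span.\<close>
  have "Std_perm n k \<nu> \<subseteq> Std_perm (n + 1) k \<nu>"
    unfolding Std_perm_def permissible_first_alcove[OF assms(3)] permissible_first_alcove[OF alcove]
    using in_alcove_1_mono by blast
  then show "Delta_sub r (n + 1) k \<nu> \<subseteq> Delta_sub r n k \<nu>"
    unfolding Delta_sub_seminormal[OF assms(1,3)] Delta_sub_seminormal[OF assms(1) alcove]
    by (intro fm.span_mono image_mono) blast
  show "Delta_sub r n k \<nu> \<subseteq> DeltaF k \<nu>" by (rule Delta_sub_subset)
qed

end
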